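(* Let $p\equiv 1\pmod 4$ be a prime and write $p=x^2+y^2$ with $x,y\in\mathbb{Z}$, $x\equiv 1\pmod 4$ and $y\equiv 0\pmod 2$. (i) We have $$(-1)^{(p-1)/4}\,x\equiv\sum_{k=0}^{(p-1)/2}\frac{k+1}{8^k}\binom{2k}{k}^2\equiv\sum_{k=0}^{(p-1)/2}\frac{2k+1}{(-16)^k}\binom{2k}{k}^2\pmod{p^2}.$$ Also, $$\sum_{k=0}^{(p-1)/2}\frac{\binom{2k}{k}C_k}{8^k}\equiv-2\sum_{k=0}^{p-1}\frac{k\binom{2k}{k}^2}{8^k}\equiv(-1)^{(p-1)/4}\left(2x-\frac{p}{x}\right)\pmod{p^2},$$ $$S_{(p-1)/2}\equiv\sum_{k=0}^{(p-1)/2}\frac{\binom{2k}{k}C_k}{(-16)^k}\equiv-8\sum_{k=0}^{(p-1)/2}\frac{k\binom{2k}{k}^2}{(-16)^k}\equiv(-1)^{(p-1)/4}\,2\left(2x-\frac{p}{x}\right)\pmod{p^2},$$ $$\sum_{k=0}^{(p-1)/2}\frac{k^2\binom{2k}{k}^2}{8^k}\equiv(-1)^{(p-1)/4}\left(x-\frac{3p}{4x}\right)\pmod{p^2},$$ and $$\sum_{k=0}^{(p-1)/2}\frac{k^2\binom{2k}{k}^2}{(-16)^k}\equiv(-1)^{(p+3)/4}\frac{p}{16x}\pmod{p^2}.$$ (ii) We have $$\sum_{k=0}^{p-1}\frac{\binom{2k}{k}^2\binom{2k}{k+1}}{(-8)^k}\equiv 2p-2x^2\pmod{p^2}$$ and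 $$\sum_{k=0}^{p-1}\frac{\binom{2k}{k}\binom{2k}{k+1}^2}{(-8)^k}\equiv-2p\pmod{p^2}.$$
   Context: $C_k=\frac{1}{k+1}\binom{2k}{k}=\binom{2k}{k}-\binom{2k}{k+1}$ is the $k$-th Catalan number, and $S_n=\sum_{k=0}^n\binom{n+k}{2k}C_k$ is the $n$-th (large) Schröder number. Congruences modulo powers of $p$ between rational numbers whose denominators are prime to $p$ are understood in the ring of $p$-adic integers (equivalently, in $\mathbb{Z}_{(p)}$). As usual, $\binom{n}{m}=0$ for integers $m>n\ge 0$. *)

theory Defs
  imports Complex_Main "HOL-Computational_Algebra.Primes" "HOL-Number_Theory.Cong"
begin

definition catalan :: "nat \<Rightarrow> rat" where
  "catalan k = 1 / of_nat (k + 1) * of_nat ((2 * k) choose k)"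

lemma catalan_alt:
  "catalan k = of_nat ((2 * k) choose k) - of_nat ((2 * k) choose (k + 1))"
proof -
  have "Suc k * ((2 * k) choose (Suc k)) = k * ((2 * k) choose k)"
    using binomial_absorb_comp[of "2 * k" k] binomial_absorption[of k "2 * k"]
    by (simp add: mult_2)
  then have "of_nat (Suc k) * of_nat ((2 * k) choose (Suc k))
      = (of_nat k * of_nat ((2 * k) choose k) :: rat)"
    by (metis of_nat_mult)
  then show ?thesis
    by (simp add: catalan_def field_simps)
qed

definition schroeder :: "nat \<Rightarrow> rat" where
  "schroeder n = (\<Sum>k\<le>n. of_nat ((n + k) choose (2 * k)) * catalan k)"

text \<open>The ring of rational numbers whose denominator in lowest terms is prime to \<open>p\<close>
  (the localization of the integers at a prime \<open>p\<close>).\<close>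
definition p_integral :: "nat \<Rightarrow> rat set" where
  "p_integral p = {r. coprime (snd (quotient_of r)) (int p)}"

text \<open>Congruence modulo \<open>p ^ n\<close> in this ring; both sides are required to lie in it.\<close>
definition rat_cong :: "nat \<Rightarrow> nat \<Rightarrow> rat \<Rightarrow> rat \<Rightarrow> bool" where
  "rat_cong p n a b \<longleftrightarrow> a \<in> p_integral p \<and> b \<in> p_integral p \<and>
     (\<exists>c\<in>p_integral p. a - b = of_nat p ^ n * c)"

end

theory Submission
  imports Defs "HOL-Number_Theory.Number_Theory" "HOL-Computational_Algebra.Polynomial"
    "HOL-Computational_Algebra.Formal_Power_Series"
begin

text \<open>
  Put \<open>p = 4 m + 1\<close>, \<open>n = (p - 1) / 2 = 2 m\<close> and \<open>e = (-1)^m\<close>.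

  The sums with two binomial coefficients are moments of a Legendre polynomial. The coefficients \<open>C(n,k) C(n+k,k)\<close> of
  \<open>P_n(1 + 2 t)\<close> agree with \<open>C(2k,k)^2 / (-16)^k\<close> modulo \<open>p^2\<close> (lemma \<open>legendre_coeff_cong_central\<close>).
  Base -16 therefore belongs to \<open>t = 1\<close> and base 8 to \<open>t = -2\<close>, and these two points are exchanged by the
  symmetry \<open>t \<mapsto> -1 - t\<close> of the Legendre equation (\<open>legendre_poly_reflect\<close>). The sums with three
  binomial coefficients and base -8 belong to the square of \<open>P_n(3)\<close> by Clausen's identity
  \<open>P_n(1 + 2 t)^2 = \<Sum>k. C(n+k,2k) C(2k,k)^2 (t (1 + t))^k\<close> (\<open>clausen\<close>), because \<open>t (1 + t) = 2\<close>
  at \<open>t = 1\<close>. The recurrences for the coefficients express all weights \<open>k^2\<close>, \<open>1 / (k + 1)\<close> and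
  \<open>1 / (k + 1)^2\<close> through two numbers only: the value \<open>A = P_n(3)\<close> and \<open>V = A + 4 M\<close>, where \<open>M\<close> is
  the first moment of the coefficients.

  These two numbers are, up to the sign \<open>e\<close>, the two roots of \<open>T^2 - 2 x T + p\<close>, the characteristic
  polynomial of Frobenius on an elliptic curve with complex multiplication by the Gaussian integers:
  \<open>A \<equiv> e (2 x - p / (2 x))\<close> is the unit root and \<open>V \<equiv> e p / (2 x)\<close> the other one
  (\<open>leg_sum_and_conj_sum_values\<close>). In particular \<open>A V \<equiv> p\<close> and \<open>V^2 \<equiv> 0\<close>, which makes all the
  combinations collapse to the stated values.

  To reach \<open>A\<close> and \<open>V\<close>, the sums are read off from the Taylor coefficients of
  \<open>(1 + z)^n / (1 - z)^(n+1) = (1 - z^2)^(-1/2) ((1 + z) / (1 - z))^(p/2)\<close>. Modulo \<open>p^2\<close> only the terms of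
  degree at most one in \<open>p\<close> survive; they give \<open>A \<equiv> C(2m,m) / 4^m\<close> (\<open>leg_sum_cong\<close>) and, after an
  evaluation of an alternating binomial sum, \<open>V \<equiv> e p / C(n,m)\<close> (\<open>conj_sum_cong\<close>).

  It remains to compare \<open>C(2m,m) / 4^m\<close> with \<open>x\<close>, which is the theorem of Chowla, Dwork and Evans
  (\<open>chowla_dwork_evans\<close>). The number \<open>x\<close> enters through Jacobsthal's character sum
  \<open>\<Sum>a. \<chi>(a^3 - a) = - 2 e x\<close> (\<open>jacobsthal\<close>): the second moment of these sums makes half of it one of
  the two coordinates of a representation of \<open>p\<close> as a sum of two squares, and its residue modulo 4
  fixes coordinate and sign. The same character sum is computable
  modulo \<open>p^2\<close>: the character has a polynomial lift \<open>2 \<chi> \<equiv> 3 z^n - z^(3n)\<close>, and replacing \<open>a\<close> by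
  \<open>a^p\<close> turns the expanded sum into power sums of Teichmueller-like representatives, which leave only
  three binomial coefficients (\<open>jacobsthal_cong_binomials\<close>). A first-order comparison of
  \<open>C(n,m)\<close> and \<open>C(6m+1,m)\<close> with \<open>C(-1/2,m)\<close> and Wilson's theorem for \<open>C(6m,3m)\<close> finish the proof.
\<close>

section \<open>Elementary identities\<close>

lemma sum_even_odd: "(\<Sum>i<2 * k. f i) = (\<Sum>i<k. f (2 * i)) + (\<Sum>i<k. f (2 * i + 1))"
  for f :: "nat \<Rightarrow> 'a :: comm_monoid_add"
  by (induction k) (simp_all add: ac_simps)

text \<open>
  Turning one summand from 1 to -1 lowers the sum by 2 and flips the sign of the product, so modulo 4
  the product and the number of terms determine the sum.
\<close>
lemma sum_pm1_mod_4:
  fixes f :: "'a \<Rightarrow> int"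
  assumes "finite S" "\<And>a. a \<in> S \<Longrightarrow> f a \<in> {-1, 1}"
  shows "[(\<Sum>a\<in>S. f a) = int (card S) + (\<Prod>a\<in>S. f a) - 1] (mod 4) \<and> (\<Prod>a\<in>S. f a) \<in> {-1, 1}"
  using assms
proof (induction S rule: finite_induct)
  case (insert a S)
  then have IH: "[sum f S = int (card S) + prod f S - 1] (mod 4)" and P: "prod f S \<in> {-1, 1}" by auto
  have "[f a + sum f S = f a + (int (card S) + prod f S - 1)] (mod 4)" by (intro cong_add IH cong_refl)
  moreover have "[f a + (int (card S) + prod f S - 1) = int (card S) + 1 + f a * prod f S - 1] (mod 4)"
    using P insert.prems[of a] by (auto simp: cong_iff_dvd_diff)
  ultimately have "[f a + sum f S = int (card S) + 1 + f a * prod f S - 1] (mod 4)" by (rule cong_trans)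
  moreover have "f a * prod f S \<in> {-1, 1}" using P insert.prems[of a] by auto
  ultimately show ?case using insert.hyps by (simp add: add.commute)
qed auto

text \<open>
  With \<open>a^3 - a = (a - 1) a (a + 1)\<close> the product telescopes into three factorials; multiplying by
  the denominator keeps the identity in the integers.
\<close>
lemma prod_cubic: "(\<Prod>a\<in>{2..Suc N}. int a * (int a * int a - 1)) * (2 * int (Suc N)) = fact (Suc N) ^ 3 * (int N + 2)"
proof (induction N)
  case 0 show ?case by simp
next
  case (Suc N)
  define P where "P = (\<Prod>a\<in>{2..Suc N}. int a * (int a * int a - 1))"
  have e: "{2..Suc (Suc N)} = insert (Suc (Suc N)) {2..Suc N}" by auto
  have IH: "P * (2 * (int N + 1)) = fact (Suc N) ^ 3 * (int N + 2)" using Suc by (simp add: P_def add.commute)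
  have "(\<Prod>a\<in>{2..Suc (Suc N)}. int a * (int a * int a - 1)) = int (Suc (Suc N)) * (int (Suc (Suc N)) * int (Suc (Suc N)) - 1) * P"
    unfolding e P_def by (subst prod.insert) simp_all
  also have "int (Suc (Suc N)) = int N + 2" by simp
  finally have "(\<Prod>a\<in>{2..Suc (Suc N)}. int a * (int a * int a - 1)) * (2 * int (Suc (Suc N)))
     = (P * (2 * (int N + 1))) * ((int N + 2) * (int N + 3) * (int N + 2))"
    by (simp add: algebra_simps)
  also have "\<dots> = (fact (Suc N) * (int N + 2)) ^ 3 * (int N + 3)"
    unfolding IH by (simp add: power3_eq_cube algebra_simps)
  also have "fact (Suc N) * (int N + 2) = fact (Suc (Suc N))" by (simp add: algebra_simps)
  finally show ?case by simp
qed

lemma cubic_power: "(t * (t * t - 1)) ^ r = (\<Sum>k\<le>r. (-1) ^ (r - k) * int (r choose k) * t ^ (r + 2 * k))" for t :: int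
proof -
  have "(t * (t * t - 1)) ^ r = t ^ r * (t * t + (-1)) ^ r" by (simp add: power_mult_distrib)
  also have "\<dots> = (\<Sum>k\<le>r. t ^ r * (int (r choose k) * (t * t) ^ k * (-1) ^ (r - k)))"
    unfolding binomial_ring sum_distrib_left ..
  also have "\<dots> = (\<Sum>k\<le>r. (-1) ^ (r - k) * int (r choose k) * t ^ (r + 2 * k))"
    by (intro sum.cong refl) (simp add: power_add power_mult power2_eq_square)
  finally show ?thesis .
qed

section \<open>Congruences in the localization at p\<close>

text \<open>
  The parameters \<open>n\<close> and \<open>m\<close> are tied to \<open>p\<close> by linear equations, so that the arithmetic of
  exponents needs no division.
\<close>
locale gauss_prime =
  fixes p n m :: nat
  assumes prime_p: "prime p" and p_def: "p = 4 * m + 1" and n_def: "n = 2 * m"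
begin

abbreviation Zp :: "rat set" where "Zp \<equiv> p_integral p"

lemma p_ge: "p \<ge> 5" and m_pos: "m > 0"
proof -
  have "p \<noteq> 1" using prime_p by auto
  then show "m > 0" using p_def by (cases m) auto
  then show "p \<ge> 5" using p_def by simp
qed

lemma n_pos: "n > 0" using m_pos by (simp add: n_def)

lemma p_eq: "p = 2 * n + 1" by (simp add: p_def n_def)

lemma rat_p: "rat_of_nat p = 4 * of_nat m + 1" "rat_of_nat n = 2 * of_nat m"
  by (simp_all add: p_def n_def)

text \<open>
  The definition through the reduced fraction is awkward for closure properties; any denominator
  prime to \<open>p\<close> will do.
\<close>
lemma Zp_iff: "r \<in> Zp \<longleftrightarrow> (\<exists>a b::int. \<not> int p dvd b \<and> r = of_int a / of_int b)"
proof
  assume r: "r \<in> Zp"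
  obtain a b where ab: "quotient_of r = (a, b)" by force
  have "coprime b (int p)" using r ab by (simp add: p_integral_def)
  then have "\<not> int p dvd b"
    using prime_p by (metis coprime_absorb_left coprime_commute not_prime_unit prime_nat_int_transfer)
  then show "\<exists>a b::int. \<not> int p dvd b \<and> r = of_int a / of_int b"
    using quotient_of_div[OF ab] by blast
next
  assume "\<exists>a b::int. \<not> int p dvd b \<and> r = of_int a / of_int b"
  then obtain a b where b: "\<not> int p dvd b" and r: "r = of_int a / of_int b" by blast
  obtain c d where cd: "quotient_of r = (c, d)" by force
  have d: "d > 0" "coprime c d" using quotient_of_denom_pos[OF cd] quotient_of_coprime[OF cd] by auto
  have "b \<noteq> 0" using b by auto
  have "rat_of_int a / of_int b = of_int c / of_int d" using r quotient_of_div[OF cd] by simp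
  then have "rat_of_int (a * d) = of_int (c * b)" using \<open>b \<noteq> 0\<close> d by (simp add: field_simps)
  then have "a * d = c * b" by (simp only: of_int_eq_iff)
  then have "d dvd c * b" by (metis dvd_triv_right)
  then have "d dvd b" using d(2) by (simp add: coprime_commute coprime_dvd_mult_right_iff)
  then have "\<not> int p dvd d" using b dvd_trans by blast
  then have "coprime d (int p)" using prime_p
    by (metis coprime_commute prime_imp_coprime prime_nat_int_transfer)
  then show "r \<in> Zp" by (simp add: p_integral_def cd)
qed

lemma int_p_prime: "prime (int p)" using prime_p by simp

lemma Zp_of_int [simp, intro]: "of_int a \<in> Zp"
  unfolding Zp_iff using int_p_prime
  by (intro exI[of _ a] exI[of _ 1]) auto

lemma Zp_of_nat [simp, intro]: "of_nat a \<in> Zp"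
  using Zp_of_int[of "int a"] by simp

lemma Zp_numeral [simp, intro]: "numeral a \<in> Zp" "0 \<in> Zp" "1 \<in> Zp"
  using Zp_of_int[of "numeral a"] Zp_of_int[of 0] Zp_of_int[of 1] by simp_all

lemma Zp_add [intro]: assumes "a \<in> Zp" "b \<in> Zp" shows "a + b \<in> Zp"
proof -
  obtain s t u v where h: "\<not> int p dvd t" "\<not> int p dvd v" "a = of_int s / of_int t" "b = of_int u / of_int v"
    using assms unfolding Zp_iff by blast
  have "t \<noteq> 0" "v \<noteq> 0" using h by auto
  then have "a + b = of_int (s * v + u * t) / of_int (t * v)" using h by (simp add: field_simps)
  moreover have "\<not> int p dvd t * v" using h(1,2) int_p_prime by (simp add: prime_dvd_mult_iff)
  ultimately show ?thesis unfolding Zp_iff by blast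
qed

lemma Zp_mult [intro]: assumes "a \<in> Zp" "b \<in> Zp" shows "a * b \<in> Zp"
proof -
  obtain s t u v where h: "\<not> int p dvd t" "\<not> int p dvd v" "a = of_int s / of_int t" "b = of_int u / of_int v"
    using assms unfolding Zp_iff by blast
  then have "a * b = of_int (s * u) / of_int (t * v)" by simp
  moreover have "\<not> int p dvd t * v" using h(1,2) int_p_prime by (simp add: prime_dvd_mult_iff)
  ultimately show ?thesis unfolding Zp_iff by blast
qed

lemma Zp_uminus [intro]: "a \<in> Zp \<Longrightarrow> - a \<in> Zp"
  using Zp_mult[OF Zp_of_int[of "-1"], of a] by simp

lemma Zp_diff [intro]: "a \<in> Zp \<Longrightarrow> b \<in> Zp \<Longrightarrow> a - b \<in> Zp"
  using Zp_add[of a "- b"] by auto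

lemma Zp_power [intro]: "a \<in> Zp \<Longrightarrow> a ^ k \<in> Zp"
  by (induction k) auto

lemma Zp_sum [intro]: "(\<And>i. i \<in> S \<Longrightarrow> f i \<in> Zp) \<Longrightarrow> sum f S \<in> Zp"
  by (induction S rule: infinite_finite_induct) auto

definition unit :: "rat \<Rightarrow> bool" where "unit a \<longleftrightarrow> a \<noteq> 0 \<and> a \<in> Zp \<and> inverse a \<in> Zp"

lemma unit_Zp: "unit a \<Longrightarrow> a \<in> Zp" by (simp add: unit_def)
lemma unit_nonzero: "unit a \<Longrightarrow> a \<noteq> 0" by (simp add: unit_def)

lemma unit_of_int: assumes "\<not> int p dvd a" shows "unit (of_int a)"
proof -
  have "inverse (rat_of_int a) = of_int 1 / of_int a" by (simp add: field_simps)
  then have "inverse (rat_of_int a) \<in> Zp" using assms unfolding Zp_iff by blast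
  then show ?thesis using assms by (auto simp: unit_def)
qed

lemma unit_of_nat: "\<not> p dvd a \<Longrightarrow> unit (of_nat a)"
  using unit_of_int[of "int a"] by simp

lemma unit_less: "0 < a \<Longrightarrow> a < p \<Longrightarrow> unit (of_nat a)"
  by (rule unit_of_nat) (auto dest: dvd_imp_le)

lemma unit_mult: "unit a \<Longrightarrow> unit b \<Longrightarrow> unit (a * b)"
  by (auto simp: unit_def)

lemma unit_uminus: "unit a \<Longrightarrow> unit (- a)"
  by (auto simp: unit_def)

lemma unit_power: "unit a \<Longrightarrow> unit (a ^ k)"
  by (induction k) (auto simp: unit_mult, simp add: unit_def)

lemma unit_numeral [simp]: "unit 1" "unit 2" "unit 3" "unit 4" "unit 8" "unit 16"
proof -
  show "unit 1" "unit 2" "unit 3" "unit 4"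
    using unit_less[of 1] unit_less[of 2] unit_less[of 3] unit_less[of 4] p_ge by simp_all
  then show "unit 8" "unit 16" using unit_mult[of 2 4] unit_mult[of 4 4] by simp_all
qed

lemma Zp_divide [intro]: "a \<in> Zp \<Longrightarrow> unit b \<Longrightarrow> a / b \<in> Zp"
  unfolding divide_inverse by (auto simp: unit_def)

text \<open>
  No integrality of \<open>a\<close> and \<open>b\<close> is demanded, only of their difference after division by \<open>p^j\<close>. Hence the
  relation is transitive and additive without side conditions, and integrality has to be checked only once, at the
  ends of a chain.
\<close>
definition pcong :: "nat \<Rightarrow> rat \<Rightarrow> rat \<Rightarrow> bool" where
  "pcong j a b \<longleftrightarrow> (\<exists>c\<in>Zp. a - b = of_nat p ^ j * c)"

lemma rat_congI: "a \<in> Zp \<Longrightarrow> b \<in> Zp \<Longrightarrow> pcong j a b \<Longrightarrow> rat_cong p j a b"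
  by (simp add: rat_cong_def pcong_def)

lemma pcongI: "c \<in> Zp \<Longrightarrow> a = b + of_nat p ^ j * c \<Longrightarrow> pcong j a b"
  by (auto simp: pcong_def)

lemma pcongE: assumes "pcong j a b" obtains c where "c \<in> Zp" "a = b + of_nat p ^ j * c"
proof -
  from assms obtain c where "c \<in> Zp" "a - b = of_nat p ^ j * c" by (auto simp: pcong_def)
  then show ?thesis using that[of c] by (simp add: algebra_simps)
qed

lemma pcong_refl [simp, intro]: "pcong j a a" by (rule pcongI[of 0]) auto

lemma pcong_sym: "pcong j a b \<Longrightarrow> pcong j b a"
proof (elim pcongE)
  fix c assume "c \<in> Zp" "a = b + of_nat p ^ j * c"
  then show ?thesis by (intro pcongI[of "-c"]) auto
qed

lemma pcong_add: "pcong j a b \<Longrightarrow> pcong j c d \<Longrightarrow> pcong j (a + c) (b + d)"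
proof (elim pcongE)
  fix e f assume "e \<in> Zp" "f \<in> Zp" "a = b + of_nat p ^ j * e" "c = d + of_nat p ^ j * f"
  then show ?thesis by (intro pcongI[of "e + f"]) (auto simp: algebra_simps)
qed

lemma pcong_scale: "r \<in> Zp \<Longrightarrow> pcong j a b \<Longrightarrow> pcong j (r * a) (r * b)"
proof (elim pcongE)
  fix c assume "r \<in> Zp" "c \<in> Zp" "a = b + of_nat p ^ j * c"
  then show ?thesis by (intro pcongI[of "r * c"]) (auto simp: algebra_simps)
qed

lemma pcong_scaleR: "r \<in> Zp \<Longrightarrow> pcong j a b \<Longrightarrow> pcong j (a * r) (b * r)"
  using pcong_scale[of r j a b] by (simp add: mult.commute)

lemma pcong_uminus: "pcong j a b \<Longrightarrow> pcong j (- a) (- b)"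
  using pcong_scale[of "-1" j a b] by auto

lemma pcong_diff: "pcong j a b \<Longrightarrow> pcong j c d \<Longrightarrow> pcong j (a - c) (b - d)"
  using pcong_add[of j a b "-c" "-d"] pcong_uminus[of j c d] by auto

lemma pcong_trans [trans]: "pcong j a b \<Longrightarrow> pcong j b c \<Longrightarrow> pcong j a c"
  using pcong_diff[of j a b c b] pcong_add[of j a b b c] by (auto simp: pcong_def algebra_simps)

lemma pcong_mult: "pcong j a b \<Longrightarrow> pcong j c d \<Longrightarrow> c \<in> Zp \<Longrightarrow> b \<in> Zp \<Longrightarrow> pcong j (a * c) (b * d)"
  using pcong_trans[OF pcong_scaleR[of c j a b] pcong_scale[of b j c d]] by blast

lemma pcong_sum: "(\<And>i. i \<in> S \<Longrightarrow> pcong j (f i) (g i)) \<Longrightarrow> pcong j (sum f S) (sum g S)"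
  by (induction S rule: infinite_finite_induct) (auto intro!: pcong_add)

lemma pcong_divide: "unit r \<Longrightarrow> pcong j a b \<Longrightarrow> pcong j (a / r) (b / r)"
  using pcong_scale[of "inverse r" j a b] by (simp add: unit_def field_simps)

lemma pcong_cancel: "unit r \<Longrightarrow> pcong j (r * a) (r * b) \<Longrightarrow> pcong j a b"
  using pcong_divide[of r j "r * a" "r * b"] by (simp add: unit_def)

lemma pcong_Zp: "pcong j a b \<Longrightarrow> b \<in> Zp \<Longrightarrow> a \<in> Zp"
  by (elim pcongE) (auto)

lemma pcong_21: "pcong 2 a b \<Longrightarrow> pcong 1 a b"
proof (elim pcongE)
  fix c assume "c \<in> Zp" "a = b + of_nat p ^ 2 * c"
  then show ?thesis by (intro pcongI[of "of_nat p * c"]) (auto simp: power2_eq_square)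
qed

lemma pcong_p_mult: "pcong 1 a b \<Longrightarrow> pcong 2 (of_nat p * a) (of_nat p * b)"
proof (elim pcongE)
  fix c assume "c \<in> Zp" "a = b + of_nat p ^ 1 * c"
  then show ?thesis by (intro pcongI[of c]) (auto simp: power2_eq_square algebra_simps)
qed

lemma pcong_p2: "c \<in> Zp \<Longrightarrow> pcong 2 (of_nat p ^ 2 * c) 0"
  by (intro pcongI[of c]) auto

lemma pcong_p1: "c \<in> Zp \<Longrightarrow> pcong 1 (of_nat p * c) 0"
  by (intro pcongI[of c]) auto

lemma pcong_of_int: assumes "[a = b] (mod int p ^ j)" shows "pcong j (of_int a) (of_int b)"
proof -
  have "int p ^ j dvd a - b" using assms by (simp add: cong_iff_dvd_diff)
  then obtain k where "a - b = int p ^ j * k" by blast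
  then have "a = b + int p ^ j * k" by simp
  then have "rat_of_int a = of_int b + of_nat p ^ j * of_int k" by simp
  then show ?thesis by (intro pcongI[of "of_int k"]) auto
qed

text \<open>
  If \<open>a = b (1 + p r)\<close> with \<open>r = s / t\<close>, then \<open>1 + p r = (t + p s) / t\<close>, and \<open>p\<close> does not divide
  \<open>t + p s\<close>.
\<close>
lemma pcong_unit: assumes "pcong 1 a b" "unit b" shows "unit a"
proof -
  obtain c where c: "c \<in> Zp" "a = b + of_nat p * c" using assms(1) by (auto elim: pcongE)
  obtain s t where st: "\<not> int p dvd t" "inverse b * c = of_int s / of_int t"
    using c assms(2) Zp_iff[of "inverse b * c"] by (auto simp: unit_def)
  have t0: "t \<noteq> 0" using st by auto
  have "a = b * (1 + of_nat p * (inverse b * c))"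
    using c assms(2) by (simp add: unit_def algebra_simps)
  then have a: "a = b * (of_int (t + int p * s) / of_int t)" using t0 unfolding st(2) by (simp add: add_divide_distrib)
  have "\<not> int p dvd t + int p * s" using st(1) by (simp add: dvd_add_left_iff)
  from unit_of_int[OF this] unit_of_int[OF st(1)]
  have "unit (of_int (t + int p * s))" "unit (of_int t)" .
  then have "unit (of_int (t + int p * s) / of_int t)"
    unfolding divide_inverse by (intro unit_mult) (auto simp: unit_def)
  with assms(2) show ?thesis unfolding a by (rule unit_mult)
qed

section \<open>Jacobsthal sums\<close>

lemma half_p: "(p - 1) div 2 = n" by (simp add: p_def n_def)

definition chi :: "int \<Rightarrow> int" where "chi a = Legendre a (int p)"

lemma chi_cong_power: "[chi a = a ^ n] (mod int p)"
  using euler_criterion[OF prime_p, of a] p_ge unfolding chi_def half_p by simp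

lemma chi_values: "chi a \<in> {-1, 0, 1}"
  by (auto simp: chi_def Legendre_def)

lemma chi_eq_0_iff: "chi a = 0 \<longleftrightarrow> int p dvd a"
  by (simp add: chi_def Legendre_def cong_0_iff)

text \<open>
  Values of the character, and differences of such values, are smaller than \<open>p\<close>, so identities between
  them can be checked modulo \<open>p\<close>.
\<close>
lemma small_cong_eq: assumes "[a = b] (mod int p)" "\<bar>a - b\<bar> < int p" shows "a = b"
  using assms dvd_imp_le_int[of "a - b" "int p"] by (auto simp: cong_iff_dvd_diff)

lemma chi_eqI: "[c = a ^ n] (mod int p) \<Longrightarrow> c \<in> {-1, 0, 1} \<Longrightarrow> chi a = c"
  using chi_cong_power[of a] chi_values[of a] p_ge
  by (intro small_cong_eq) (auto intro: cong_trans cong_sym)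

lemma chi_cong: "[a = b] (mod int p) \<Longrightarrow> chi a = chi b"
  using chi_values[of b] cong_trans[OF chi_cong_power[of b] cong_sym[OF cong_pow[of a b "int p" n]]]
  by (intro chi_eqI)

lemma chi_mult: "chi (a * b) = chi a * chi b"
proof (rule chi_eqI)
  show "[chi a * chi b = (a * b) ^ n] (mod int p)"
    unfolding power_mult_distrib by (intro cong_mult chi_cong_power)
  show "chi a * chi b \<in> {-1, 0, 1}" using chi_values[of a] chi_values[of b] by auto
qed

lemma even_n: "even n" by (simp add: n_def)

lemma chi_minus_1 [simp]: "chi (-1) = 1" and chi_1 [simp]: "chi 1 = 1"
  using even_n by (intro chi_eqI; simp)+

lemma chi_minus: "chi (- a) = chi a"
  using chi_mult[of "-1" a] by simp

lemma chi_0 [simp]: "chi 0 = 0" by (simp add: chi_eq_0_iff)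

lemma chi_square: "\<not> int p dvd a \<Longrightarrow> chi (a * a) = 1"
  using chi_values[of a] chi_eq_0_iff[of a] by (auto simp: chi_mult)

lemma chi_square_eq: "\<not> int p dvd a \<Longrightarrow> chi a * chi a = 1"
  using chi_square[of a] by (simp add: chi_mult)

abbreviation R :: "int set" where "R \<equiv> {0..<int p}"
abbreviation U :: "int set" where "U \<equiv> {1..<int p}"

lemma U_not_dvd: "a \<in> U \<Longrightarrow> \<not> int p dvd a"
  by (auto dest: zdvd_imp_le)

lemma R_eq: "R = insert 0 U" using p_ge by auto

definition periodic :: "(int \<Rightarrow> int) \<Rightarrow> bool" where
  "periodic f \<longleftrightarrow> (\<forall>a b. [a = b] (mod int p) \<longrightarrow> f a = f b)"

lemma cong_R_eq: assumes "a \<in> R" "b \<in> R" "[a = b] (mod int p)" shows "a = b"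
  using assms by (simp add: cong_def)

text \<open>
  Change of variable in a sum over a complete residue system: an injective substitution permutes it.
\<close>
lemma sum_reindex_R:
  assumes f: "periodic f" and h: "\<And>a b. [h a = h b] (mod int p) \<Longrightarrow> [a = b] (mod int p)"
  shows "(\<Sum>a\<in>R. f (h a)) = (\<Sum>a\<in>R. f a)"
proof -
  have p0: "int p > 0" using p_ge by simp
  have inj: "inj_on (\<lambda>a. h a mod int p) R"
  proof (rule inj_onI)
    fix a b assume "a \<in> R" "b \<in> R" "h a mod int p = h b mod int p"
    then have "[a = b] (mod int p)" by (rule_tac h) (simp_all only: cong_def)
    with \<open>a \<in> _\<close> \<open>b \<in> _\<close> show "a = b" by (rule_tac cong_R_eq) auto
  qed
  have "(\<lambda>a. h a mod int p) ` R = R"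
  proof (rule endo_inj_surj[OF _ _ inj])
    show "(\<lambda>a. h a mod int p) ` R \<subseteq> R" by (rule image_subsetI) (simp add: p0)
  qed simp
  then have "(\<Sum>a\<in>R. f a) = (\<Sum>a\<in>R. f (h a mod int p))"
    using sum.reindex[OF inj, of f] by (simp only: comp_def)
  also have "\<dots> = (\<Sum>a\<in>R. f (h a))"
    using f unfolding periodic_def by (intro sum.cong refl) (metis cong_mod_left cong_refl)
  finally show ?thesis ..
qed

lemma sum_reindex_U:
  assumes f: "periodic f" and h: "\<And>a b. a \<in> U \<Longrightarrow> b \<in> U \<Longrightarrow> [h a = h b] (mod int p) \<Longrightarrow> [a = b] (mod int p)"
    and u: "\<And>a. a \<in> U \<Longrightarrow> \<not> int p dvd h a"
  shows "(\<Sum>a\<in>U. f (h a)) = (\<Sum>a\<in>U. f a)"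
proof -
  have p0: "int p > 0" using p_ge by simp
  have inj: "inj_on (\<lambda>a. h a mod int p) U"
  proof (rule inj_onI)
    fix a b assume "a \<in> U" "b \<in> U" "h a mod int p = h b mod int p"
    then have "[a = b] (mod int p)" by (rule_tac h) (simp_all only: cong_def)
    with \<open>a \<in> _\<close> \<open>b \<in> _\<close> show "a = b" by (rule_tac cong_R_eq) auto
  qed
  have "h a mod int p \<in> U" if "a \<in> U" for a
  proof -
    have "h a mod int p \<noteq> 0" using u[OF that] by (simp add: dvd_eq_mod_eq_0)
    moreover have "h a mod int p \<ge> 0" "h a mod int p < int p" using p0 by simp_all
    ultimately show ?thesis by simp
  qed
  then have "(\<lambda>a. h a mod int p) ` U \<subseteq> U" by blast
  then have "(\<lambda>a. h a mod int p) ` U = U"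
    by (intro endo_inj_surj[OF _ _ inj]) simp_all
  then have "(\<Sum>a\<in>U. f a) = (\<Sum>a\<in>U. f (h a mod int p))"
    using sum.reindex[OF inj, of f] by (simp only: comp_def)
  also have "\<dots> = (\<Sum>a\<in>U. f (h a))"
    using f unfolding periodic_def by (intro sum.cong refl) (metis cong_mod_left cong_refl)
  finally show ?thesis ..
qed

lemma cong_mult_cancel: "\<not> int p dvd c \<Longrightarrow> [c * a = c * b] (mod int p) \<Longrightarrow> [a = b] (mod int p)"
  using int_p_prime prime_dvd_mult_iff[of "int p" c "a - b"]
  by (simp add: cong_iff_dvd_diff right_diff_distrib[symmetric])

lemma periodic_chi: "periodic chi" by (simp add: periodic_def chi_cong)

lemma obtain_generator:
  obtains g :: nat where "\<not> int p dvd int g" and "\<And>j. [int g ^ j = 1] (mod int p) \<longleftrightarrow> 2 * n dvd j"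
    and "bij_betw (\<lambda>i. int g ^ i mod int p) {..<2 * n} U"
proof -
  obtain g where g: "residue_primroot p g" using prime_primitive_root_exists[OF _ prime_p] p_ge by auto
  have tot: "totient p = 2 * n" using prime_p by (simp add: totient_prime p_def n_def)
  have o: "ord p g = 2 * n" "coprime p g" using g by (simp_all add: residue_primroot_def tot)
  have 1: "\<not> int p dvd int g"
    using o(2) prime_p by (metis coprime_absorb_left int_dvd_int_iff not_prime_unit)
  have 2: "[int g ^ j = 1] (mod int p) \<longleftrightarrow> 2 * n dvd j" for j
    using ord_divides[of g j p] cong_int_iff[of "g ^ j" 1 p] by (simp add: o)
  have "bij_betw (\<lambda>i. g ^ i mod p) {..<2 * n} (totatives p)"
    using residue_primroot_is_generator[OF _ g] p_ge tot by simp
  also have "totatives p = {1..<p}" using prime_p by (auto simp: totatives_prime)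
  finally have b: "bij_betw (\<lambda>i. g ^ i mod p) {..<2 * n} {1..<p}" .
  have "bij_betw int {1..<p} U"
    by (intro bij_betw_imageI inj_on_of_nat) (simp add: image_int_atLeastLessThan)
  from bij_betw_trans[OF b this] have "bij_betw (\<lambda>i. int g ^ i mod int p) {..<2 * n} U"
    by (simp add: comp_def zmod_int)
  with 1 2 that show ?thesis by blast
qed

text \<open>
  A generator \<open>g\<close> is a non-residue; the substitution \<open>a \<mapsto> g a\<close> changes the sign of the sum.
\<close>
lemma sum_chi: "(\<Sum>a\<in>R. chi a) = 0"
proof -
  obtain g where g: "\<not> int p dvd int g" "\<And>j. [int g ^ j = 1] (mod int p) \<longleftrightarrow> 2 * n dvd j"
    using obtain_generator by metis
  have "\<not> 2 * n dvd n" using m_pos by (auto simp: n_def dest: dvd_imp_le)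
  then have "chi (int g) \<noteq> 1" using g(2) chi_cong_power[of "int g"] by (auto simp: cong_sym_eq)
  then have c: "chi (int g) = -1" using chi_values[of "int g"] chi_eq_0_iff[of "int g"] g(1) by auto
  have "(\<Sum>a\<in>R. chi (int g * a)) = (\<Sum>a\<in>R. chi a)"
    by (rule sum_reindex_R[OF periodic_chi cong_mult_cancel[OF g(1)]])
  then show ?thesis by (simp add: chi_mult c sum_negf)
qed

lemma inverse_mod: assumes "a \<in> U" shows "[a * a ^ (p - 2) = 1] (mod int p)"
proof -
  have "\<not> p dvd nat a" using assms by (auto dest!: dvd_imp_le)
  then have "[nat a ^ (p - 1) = 1] (mod p)" by (intro fermat_theorem prime_p)
  then have "[int (nat a ^ (p - 1)) = int 1] (mod int p)" by (simp only: cong_int_iff)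
  then have "[a ^ (p - 1) = 1] (mod int p)" using assms by simp
  moreover have "p - 1 = Suc (p - 2)" using p_ge by simp
  ultimately show ?thesis by simp
qed

text \<open>
  After a shift the summand is \<open>\<chi>(k (k + e))\<close> with \<open>e = d - c\<close>. Multiplication by the square of the
  inverse \<open>l\<close> of \<open>k\<close> turns it into \<open>\<chi>(1 + e l)\<close>, a linear character sum with the term \<open>l = 0\<close> missing.
\<close>
lemma sum_chi_quadratic:
  "(\<Sum>k\<in>R. chi ((k + c) * (k + d))) = (if [c = d] (mod int p) then int p - 1 else -1)"
proof -
  define e where "e = d - c"
  have "(\<Sum>k\<in>R. chi ((k + c) * (k + d))) = (\<Sum>k\<in>R. (\<lambda>k. chi (k * (k + e))) (k + c))"
    by (simp add: e_def algebra_simps)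
  also have "\<dots> = (\<Sum>k\<in>R. chi (k * (k + e)))"
  proof (rule sum_reindex_R)
    show "periodic (\<lambda>k. chi (k * (k + e)))"
      unfolding periodic_def by (intro allI impI chi_cong cong_mult cong_add) auto
    show "[a = b] (mod int p)" if "[a + c = b + c] (mod int p)" for a b
      using that by (simp add: cong_iff_dvd_diff)
  qed
  also have "\<dots> = (\<Sum>k\<in>U. chi (k * (k + e)))"
    unfolding R_eq by (simp add: chi_eq_0_iff)
  also have "\<dots> = (\<Sum>k\<in>U. (\<lambda>k. chi (1 + e * k)) (k ^ (p - 2)))"
  proof (intro sum.cong refl)
    fix k assume k: "k \<in> U"
    define l where "l = k ^ (p - 2)"
    have kl: "[k * l = 1] (mod int p)" using inverse_mod[OF k] by (simp add: l_def)
    have "\<not> int p dvd l"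
      unfolding l_def using U_not_dvd[OF k] prime_dvd_power[OF int_p_prime, of k "p - 2"] by blast
    then have "chi (k * (k + e)) = chi (l * l) * chi (k * (k + e))" by (simp add: chi_square)
    also have "\<dots> = chi ((k * l) * (k * l + e * l))" by (simp add: chi_mult[symmetric] algebra_simps)
    also have "\<dots> = chi (1 * (1 + e * l))" by (intro chi_cong cong_mult cong_add kl cong_refl)
    finally show "chi (k * (k + e)) = (\<lambda>k. chi (1 + e * k)) (k ^ (p - 2))" by (simp add: l_def)
  qed
  also have "\<dots> = (\<Sum>k\<in>U. chi (1 + e * k))"
  proof (rule sum_reindex_U)
    show "periodic (\<lambda>k. chi (1 + e * k))"
      unfolding periodic_def by (intro allI impI chi_cong cong_mult cong_add) auto
    show "\<not> int p dvd a ^ (p - 2)" if "a \<in> U" for a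
      using U_not_dvd[OF that] prime_dvd_power[OF int_p_prime, of a "p - 2"] by blast
    show "[a = b] (mod int p)" if "a \<in> U" "b \<in> U" "[a ^ (p - 2) = b ^ (p - 2)] (mod int p)" for a b
    proof -
      have "[a * b * a ^ (p - 2) = a * b * b ^ (p - 2)] (mod int p)" by (intro cong_mult cong_refl that)
      moreover have "[b * (a * a ^ (p - 2)) = b * 1] (mod int p)" by (intro cong_mult cong_refl inverse_mod that)
      moreover have "[a * (b * b ^ (p - 2)) = a * 1] (mod int p)" by (intro cong_mult cong_refl inverse_mod that)
      ultimately show ?thesis by (simp add: cong_def mult_ac)
    qed
  qed
  also have "\<dots> = (\<Sum>k\<in>R. chi (1 + e * k)) - 1"
    unfolding R_eq by simp
  also have "(\<Sum>k\<in>R. chi (1 + e * k)) = (if int p dvd e then int p else 0)"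
  proof (cases "int p dvd e")
    case True
    then have "chi (1 + e * k) = 1" for k
      using chi_cong[of "1 + e * k" 1] by (simp add: cong_iff_dvd_diff)
    then show ?thesis using True by simp
  next
    case False
    have "(\<Sum>k\<in>R. chi (1 + e * k)) = (\<Sum>k\<in>R. chi k)"
      by (rule sum_reindex_R[OF periodic_chi])
         (use False in \<open>auto intro: cong_mult_cancel simp: cong_add_lcancel\<close>)
    then show ?thesis using False by (simp add: sum_chi)
  qed
  finally show ?thesis
    by (simp add: e_def cong_iff_dvd_diff dvd_diff_commute)
qed

definition jacobsthal_sum :: "int \<Rightarrow> int" where "jacobsthal_sum k = (\<Sum>a\<in>R. chi (a * (a * a + k)))"

lemma jacobsthal_sum_cong: "[k = l] (mod int p) \<Longrightarrow> jacobsthal_sum k = jacobsthal_sum l"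
  unfolding jacobsthal_sum_def by (intro sum.cong refl chi_cong cong_mult cong_add) auto

lemma jacobsthal_sum_0: "jacobsthal_sum 0 = 0"
proof -
  have "jacobsthal_sum 0 = (\<Sum>a\<in>R. chi a)" unfolding jacobsthal_sum_def
  proof (intro sum.cong refl)
    fix a
    show "chi (a * (a * a + 0)) = chi a"
      using chi_square_eq[of a] chi_eq_0_iff[of a] by (cases "int p dvd a") (auto simp: chi_mult)
  qed
  then show ?thesis by (simp add: sum_chi)
qed

text \<open>
  Substitute \<open>a \<mapsto> c a\<close>. So up to sign only two Jacobsthal sums with nonzero parameter exist, one
  for residues and one for non-residues.
\<close>
lemma jacobsthal_sum_scale: assumes "\<not> int p dvd c" shows "jacobsthal_sum (k * (c * c)) = chi c * jacobsthal_sum k"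
proof -
  have "jacobsthal_sum (k * (c * c)) = (\<Sum>a\<in>R. (\<lambda>a. chi (a * (a * a + k * (c * c)))) (c * a))"
    unfolding jacobsthal_sum_def
    by (rule sum_reindex_R[OF _ cong_mult_cancel[OF assms], symmetric])
       (auto simp: periodic_def intro!: chi_cong cong_mult cong_add)
  also have "\<dots> = (\<Sum>a\<in>R. chi c * chi (a * (a * a + k)))"
  proof (intro sum.cong refl)
    fix a
    have "chi (c * a * (c * a * (c * a) + k * (c * c))) = chi ((c * c) * (c * (a * (a * a + k))))"
      by (simp add: algebra_simps)
    also have "\<dots> = chi c * chi (a * (a * a + k))"
      using chi_square[OF assms] chi_mult[of "c * c" "c * (a * (a * a + k))"] chi_mult[of c "a * (a * a + k)"] by simp
    finally show "(\<lambda>a. chi (a * (a * a + k * (c * c)))) (c * a) = chi c * chi (a * (a * a + k))" .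
  qed
  finally show ?thesis by (simp add: jacobsthal_sum_def sum_distrib_left)
qed

text \<open>
  Squaring out and summing over \<open>k\<close> first, the inner sums are those of \<open>sum_chi_quadratic\<close>. Their
  constant part \<open>-1\<close> contributes a product of vanishing character sums, and the part \<open>p\<close> occurs exactly for
  \<open>b = a\<close> and \<open>b = -a\<close>.
\<close>
lemma sum_jacobsthal_square: "(\<Sum>k\<in>R. jacobsthal_sum k ^ 2) = 2 * int p * (int p - 1)"
proof -
  have "(\<Sum>k\<in>R. jacobsthal_sum k ^ 2) = (\<Sum>k\<in>R. \<Sum>a\<in>R. \<Sum>b\<in>R. chi (a * b) * chi ((k + a * a) * (k + b * b)))"
    unfolding jacobsthal_sum_def power2_eq_square sum_product
    by (intro sum.cong refl) (simp add: chi_mult[symmetric] algebra_simps)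
  also have "\<dots> = (\<Sum>a\<in>R. \<Sum>k\<in>R. \<Sum>b\<in>R. chi (a * b) * chi ((k + a * a) * (k + b * b)))"
    by (rule sum.swap)
  also have "\<dots> = (\<Sum>a\<in>R. \<Sum>b\<in>R. \<Sum>k\<in>R. chi (a * b) * chi ((k + a * a) * (k + b * b)))"
    by (rule sum.cong[OF refl], rule sum.swap)
  also have "\<dots> = (\<Sum>a\<in>R. \<Sum>b\<in>R. chi (a * b) * ((if [a * a = b * b] (mod int p) then int p else 0) - 1))"
    by (rule sum.cong[OF refl], rule sum.cong[OF refl], subst sum_distrib_left[symmetric], subst sum_chi_quadratic) simp
  also have "\<dots> = (\<Sum>a\<in>R. \<Sum>b\<in>R. chi a * chi b * (if [a * a = b * b] (mod int p) then int p else 0)) - (\<Sum>a\<in>R. chi a) * (\<Sum>b\<in>R. chi b)"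
    unfolding sum_product by (simp add: right_diff_distrib sum_subtractf chi_mult)
  also have "\<dots> = (\<Sum>a\<in>R. \<Sum>b\<in>R. chi a * chi b * (if [a * a = b * b] (mod int p) then int p else 0))"
    by (simp add: sum_chi)
  also have "\<dots> = (\<Sum>a\<in>U. \<Sum>b\<in>R. chi a * chi b * (if [a * a = b * b] (mod int p) then int p else 0))"
    unfolding R_eq by (simp add: chi_eq_0_iff)
  also have "\<dots> = (\<Sum>a\<in>U. 2 * int p)"
  proof (intro sum.cong refl)
    fix a assume a: "a \<in> U"
    have iff: "[a * a = b * b] (mod int p) \<longleftrightarrow> b = a \<or> b = int p - a" if "b \<in> R" for b
    proof -
      have "[a * a = b * b] (mod int p) \<longleftrightarrow> int p dvd (b - a) * (b - (int p - a))"
      proof -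
        have e: "(b * b - a * a) - int p * (b - a) = (b - a) * (b - (int p - a))" by (simp add: algebra_simps)
        have "[a * a = b * b] (mod int p) \<longleftrightarrow> int p dvd b * b - a * a"
          unfolding cong_iff_dvd_diff by (rule dvd_diff_commute)
        also have "\<dots> \<longleftrightarrow> int p dvd (b * b - a * a) - int p * (b - a)" by (simp add: dvd_diff_left_iff)
        finally show ?thesis unfolding e .
      qed
      also have "\<dots> \<longleftrightarrow> [b = a] (mod int p) \<or> [b = int p - a] (mod int p)"
        using int_p_prime by (simp add: prime_dvd_mult_iff cong_iff_dvd_diff)
      also have "\<dots> \<longleftrightarrow> b = a \<or> b = int p - a"
        using a that cong_R_eq[of b a] cong_R_eq[of b "int p - a"] by auto
      finally show ?thesis .
    qed
    have ne: "a \<noteq> int p - a"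
    proof
      assume "a = int p - a"
      then have "int p = 2 * a" by simp
      then have "even (int p)" by simp
      then show False by (simp add: p_def)
    qed
    have "(\<Sum>b\<in>R. chi a * chi b * (if [a * a = b * b] (mod int p) then int p else 0))
       = (\<Sum>b\<in>{a, int p - a}. chi a * chi b * int p)"
      using a by (intro sum.mono_neutral_cong_right) (auto simp: iff)
    also have "\<dots> = chi a * chi a * int p + chi a * chi (int p - a) * int p" using ne by simp
    also have "chi (int p - a) = chi a"
      using chi_cong[of "int p - a" "- a"] chi_minus[of a] by (simp add: cong_iff_dvd_diff)
    finally show "(\<Sum>b\<in>R. chi a * chi b * (if [a * a = b * b] (mod int p) then int p else 0)) = 2 * int p"
      using chi_square_eq[OF U_not_dvd[OF a]] by simp
  qed
  also have "\<dots> = 2 * int p * (int p - 1)" using p_ge by simp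
  finally show ?thesis .
qed

lemma sum_U_even:
  assumes "periodic f" "\<And>a. f (- a) = f a"
  shows "(\<Sum>a\<in>U. f a) = 2 * (\<Sum>a\<in>{1..int n}. f a)"
proof -
  have U: "U = {1..int n} \<union> {int n + 1..<int p}" using p_eq by auto
  have bij: "bij_betw (\<lambda>a. int p - a) {1..int n} {int n + 1..<int p}"
    by (rule bij_betwI[of _ _ _ "\<lambda>a. int p - a"]) (auto simp: p_eq)
  have "(\<Sum>a\<in>{int n + 1..<int p}. f a) = (\<Sum>a\<in>{1..int n}. f (int p - a))"
    by (rule sum.reindex_bij_betw[OF bij, symmetric])
  also have "\<dots> = (\<Sum>a\<in>{1..int n}. f a)"
  proof (rule sum.cong[OF refl])
    fix a
    have "f (int p - a) = f (- a)" using assms(1) by (simp add: periodic_def cong_iff_dvd_diff)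
    then show "f (int p - a) = f a" by (simp add: assms(2))
  qed
  finally show ?thesis unfolding U by (subst sum.union_disjoint) auto
qed

definition jacobsthal_half :: "int \<Rightarrow> int" where "jacobsthal_half k = (\<Sum>a\<in>{1..int n}. chi (a * (a * a + k)))"

text \<open>
  As \<open>p \<equiv> 1\<close> modulo 4, the character is even: \<open>a\<close> and \<open>-a\<close> contribute equally.
\<close>
lemma jacobsthal_sum_eq_half: "jacobsthal_sum k = 2 * jacobsthal_half k"
proof -
  have "jacobsthal_sum k = (\<Sum>a\<in>U. chi (a * (a * a + k)))" unfolding jacobsthal_sum_def R_eq by simp
  also have "\<dots> = 2 * jacobsthal_half k" unfolding jacobsthal_half_def
  proof (rule sum_U_even)
    show "periodic (\<lambda>a. chi (a * (a * a + k)))"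
      unfolding periodic_def by (intro allI impI chi_cong cong_mult cong_add) auto
    show "chi (- a * (- a * - a + k)) = chi (a * (a * a + k))" for a
      using chi_minus[of "a * (a * a + k)"] by simp
  qed
  finally show ?thesis .
qed

text \<open>
  Along the powers of a generator \<open>G\<close> the squared sums alternate between the values at \<open>1\<close> and at \<open>G\<close>;
  the second moment thus gives \<open>J(1)^2 + J(G)^2 = 4 p\<close>. The parameter \<open>-1 = G^(2m)\<close> is a square, hence in
  the class of 1.
\<close>
lemma jacobsthal_half_norm: "\<exists>Y. jacobsthal_half (-1) ^ 2 + Y ^ 2 = int p"
proof -
  obtain g where g: "\<not> int p dvd int g" "\<And>j. [int g ^ j = 1] (mod int p) \<longleftrightarrow> 2 * n dvd j"
    and bij: "bij_betw (\<lambda>i. int g ^ i mod int p) {..<2 * n} U"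
    using obtain_generator by metis
  define G where "G = int g"
  have Gi: "\<not> int p dvd G ^ i" for i
    using g(1) prime_dvd_power[OF int_p_prime, of G i] unfolding G_def by blast
  have sq: "jacobsthal_sum (k * (c * c)) ^ 2 = jacobsthal_sum k ^ 2" if "\<not> int p dvd c" for k c
    using jacobsthal_sum_scale[OF that, of k] chi_square_eq[OF that] by (simp add: power2_eq_square)
  have "2 * int p * (int p - 1) = (\<Sum>k\<in>U. jacobsthal_sum k ^ 2)"
    using sum_jacobsthal_square unfolding R_eq by (simp add: jacobsthal_sum_0)
  also have "\<dots> = (\<Sum>i<2 * n. jacobsthal_sum (G ^ i mod int p) ^ 2)"
    using sum.reindex_bij_betw[OF bij, of "\<lambda>k. jacobsthal_sum k ^ 2"] by (simp add: G_def)
  also have "\<dots> = (\<Sum>i<2 * n. jacobsthal_sum (G ^ i) ^ 2)"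
    by (intro sum.cong refl arg_cong[where f = "\<lambda>x. x ^ 2"] jacobsthal_sum_cong) (simp add: cong_def)
  also have "\<dots> = (\<Sum>i<n. jacobsthal_sum 1 ^ 2 + jacobsthal_sum G ^ 2)"
    unfolding sum_even_odd sum.distrib[symmetric]
  proof (rule sum.cong[OF refl])
    fix i
    have "jacobsthal_sum (G ^ (2 * i)) ^ 2 = jacobsthal_sum 1 ^ 2" using sq[OF Gi[of i], of 1] by (simp add: power_mult power2_eq_square power_mult_distrib)
    moreover have "jacobsthal_sum (G ^ (2 * i + 1)) ^ 2 = jacobsthal_sum G ^ 2"
      using sq[OF Gi[of i], of G] by (simp add: power_mult power2_eq_square power_mult_distrib)
    ultimately show "jacobsthal_sum (G ^ (2 * i)) ^ 2 + jacobsthal_sum (G ^ (2 * i + 1)) ^ 2 = jacobsthal_sum 1 ^ 2 + jacobsthal_sum G ^ 2" by simp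
  qed
  also have "\<dots> = int n * (jacobsthal_sum 1 ^ 2 + jacobsthal_sum G ^ 2)" by simp
  finally have "int n * (4 * int p) = int n * (jacobsthal_sum 1 ^ 2 + jacobsthal_sum G ^ 2)" by (simp add: p_eq)
  then have s: "jacobsthal_sum 1 ^ 2 + jacobsthal_sum G ^ 2 = 4 * int p" using m_pos by (simp add: n_def)
  (* The square of G^n is 1, but G^n itself is not, as G has order 2 n. *)
  have "[G ^ n = - 1] (mod int p)"
  proof -
    have "int p dvd (G ^ n - 1) * (G ^ n + 1)"
    proof -
      have "G ^ (2 * n) = G ^ n * G ^ n" by (simp add: mult_2 power_add)
      then have "(G ^ n - 1) * (G ^ n + 1) = G ^ (2 * n) - 1" by (simp add: algebra_simps)
      then show ?thesis using g(2)[of "2 * n"] by (simp add: G_def cong_iff_dvd_diff)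
    qed
    moreover have "\<not> int p dvd G ^ n - 1"
      using g(2)[of n] m_pos by (auto simp: G_def cong_iff_dvd_diff n_def dest: dvd_imp_le)
    ultimately have "int p dvd G ^ n + 1" using int_p_prime by (simp add: prime_dvd_mult_iff)
    then show ?thesis by (simp add: cong_iff_dvd_diff)
  qed
  then have "jacobsthal_sum (-1) = jacobsthal_sum (1 * (G ^ m * G ^ m))"
    by (intro jacobsthal_sum_cong) (simp add: cong_sym n_def mult_2 power_add)
  then have "jacobsthal_sum (-1) ^ 2 = jacobsthal_sum 1 ^ 2" by (simp only: sq[OF Gi])
  with s have "jacobsthal_half (-1) ^ 2 + jacobsthal_half G ^ 2 = int p" by (simp add: jacobsthal_sum_eq_half)
  then show ?thesis by blast
qed

text \<open>
  Wilson's theorem with the upper \<open>k\<close> factors \<open>p - i \<equiv> -i\<close> split off.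
\<close>
lemma fact_reflect: "k \<le> p - 1 \<Longrightarrow> [fact k * fact (p - 1 - k) * (-1) ^ k = - 1] (mod int p)"
proof (induction k)
  case 0
  have "[fact (p - 1) = (- 1 :: int)] (mod int p)" using wilson_theorem[OF prime_p] by simp
  then show ?case by simp
next
  case (Suc k)
  then have e: "p - 1 - k = Suc (p - 1 - Suc k)" by simp
  have "[int (Suc k) * (fact k * fact (p - 1 - Suc k) * (-1) ^ Suc k)
    = int (p - 1 - k) * (fact k * fact (p - 1 - Suc k) * (-1) ^ k)] (mod int p)"
  proof -
    define z :: int where "z = fact k * fact (p - 1 - Suc k) * (-1) ^ k"
    have z: "fact k * fact (p - 1 - Suc k) * (-1) ^ Suc k = - z" by (simp add: z_def)
    have "int (Suc k) * (- z) - int (p - 1 - k) * z = int p * (- z)"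
      using Suc.prems by (simp add: of_nat_diff algebra_simps)
    then show ?thesis unfolding z z_def[symmetric] cong_iff_dvd_diff by (metis dvd_triv_left)
  qed
  also have "int (p - 1 - k) * (fact k * fact (p - 1 - Suc k) * (-1) ^ k) = fact k * fact (p - 1 - k) * (-1) ^ k"
    unfolding e fact_Suc by simp
  also have "[\<dots> = - 1] (mod int p)" using Suc by simp
  finally show ?case by (simp add: mult_ac)
qed

lemma fact_n_square: "[fact n * fact n = - 1] (mod int p)"
  using fact_reflect[of n] even_n by (simp add: p_eq)

text \<open>
  A sum of signs is determined modulo 4 by their product (\<open>sum_pm1_mod_4\<close>), and this product is
  the character of \<open>prod_cubic\<close>. With \<open>c = n!\<close> and \<open>c^2 \<equiv> -1\<close> everything reduces to \<open>\<chi>(2) \<chi>(c)\<close>, which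
  is 1 because \<open>2 c \<equiv> (1 + c)^2\<close>.
\<close>
lemma jacobsthal_half_mod_4: "[jacobsthal_half (-1) = 2 * int m - 1] (mod 4)"
proof -
  define f where "f a = chi (int a * (int a * int a - 1))" for a
  have inj: "inj_on int {1..n}" by simp
  have "{1..int n} = int ` {1..n}" by (simp add: image_int_atLeastAtMost)
  then have "jacobsthal_half (-1) = (\<Sum>a\<in>{1..n}. f a)"
    unfolding jacobsthal_half_def f_def by (simp add: sum.reindex)
  also have "{1..n} = insert 1 {2..n}" using m_pos by (auto simp: n_def)
  also have "(\<Sum>a\<in>\<dots>. f a) = (\<Sum>a\<in>{2..n}. f a)" by (simp add: f_def)
  finally have j: "jacobsthal_half (-1) = (\<Sum>a\<in>{2..n}. f a)" .
  have nd: "\<not> int p dvd int a" if "0 < a" "a < p" for a using that by (auto dest: dvd_imp_le)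
  have f_pm1: "f a \<in> {-1, 1}" if "a \<in> {2..n}" for a
  proof -
    have "int a * (int a * int a - 1) = int a * (int (a - 1) * int (a + 1))"
      using that by (simp add: of_nat_diff algebra_simps)
    moreover have "\<not> int p dvd int a * (int (a - 1) * int (a + 1))"
    proof -
      have "\<not> int p dvd int a" "\<not> int p dvd int (a - 1)" "\<not> int p dvd int (a + 1)"
        by (rule nd; use that p_eq in auto)+
      then show ?thesis by (simp only: prime_dvd_mult_iff[OF int_p_prime]) blast
    qed
    ultimately have "f a \<noteq> 0" unfolding f_def chi_eq_0_iff by (simp only: not_False_eq_True)
    then show ?thesis using chi_values by (auto simp: f_def)
  qed
  have s: "[(\<Sum>a\<in>{2..n}. f a) = int (card {2..n}) + (\<Prod>a\<in>{2..n}. f a) - 1] (mod 4)"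
    using sum_pm1_mod_4[of "{2..n}" f, OF _ f_pm1] by blast
  have "(\<Prod>a\<in>{2..n}. f a) = 1"
  proof -
    define c :: int where "c = fact n"
    have cc: "[c * c = -1] (mod int p)" using fact_n_square by (simp add: c_def)
    have cnd: "\<not> int p dvd c"
    proof
      assume "int p dvd c"
      then have "[c * c = 0] (mod int p)" by (simp add: cong_0_iff)
      then have "[-1 = 0] (mod int p)" using cc cong_trans cong_sym by blast
      then show False using p_ge by (simp add: cong_0_iff zdvd1_eq)
    qed
    have c2: "chi c * chi c = 1" by (rule chi_square_eq[OF cnd])
    have prod_chi: "(\<Prod>a\<in>S. chi (g a)) = chi (\<Prod>a\<in>S. g a)" if "finite S" for S :: "nat set" and g
      using that by (induction S rule: finite_induct) (simp_all add: chi_mult)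
    have "(\<Prod>a\<in>{2..n}. int a * (int a * int a - 1)) * (2 * int n) = c ^ 3 * (int n + 1)"
    proof -
      obtain N where "n = Suc N" using m_pos by (cases n) (auto simp: n_def)
      then show ?thesis using prod_cubic[of N] by (simp add: c_def)
    qed
    from arg_cong[OF this, of chi]
    have "(\<Prod>a\<in>{2..n}. f a) * chi (2 * int n) = chi c * chi c * chi c * chi (int n + 1)"
    proof -
      assume e: "chi ((\<Prod>a\<in>{2..n}. int a * (int a * int a - 1)) * (2 * int n)) = chi (c ^ 3 * (int n + 1))"
      have "(\<Prod>a\<in>{2..n}. f a) = chi (\<Prod>a\<in>{2..n}. int a * (int a * int a - 1))"
        unfolding f_def by (rule prod_chi) simp
      then show ?thesis using e by (simp add: chi_mult power3_eq_cube)
    qed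
    (* Modulo p, 2 n is -1 and 2 (n + 1) is 1. *)
    moreover have "chi (2 * int n) = 1"
    proof -
      have "2 * int n - (-1) = int p * 1" by (simp add: p_eq)
      then have "[2 * int n = -1] (mod int p)" unfolding cong_iff_dvd_diff by (metis dvd_triv_left)
      from chi_cong[OF this] show ?thesis by simp
    qed
    moreover have "chi 2 * chi (int n + 1) = 1"
    proof -
      have "2 * (int n + 1) - 1 = int p * 1" by (simp add: p_eq)
      then have "[2 * (int n + 1) = 1] (mod int p)" unfolding cong_iff_dvd_diff by (metis dvd_triv_left)
      from chi_cong[OF this] show ?thesis by (simp only: chi_mult chi_1)
    qed
    moreover have "chi 2 * chi c = 1"
    proof -
      have "\<not> int p dvd c + 1"
      proof
        assume "int p dvd c + 1"
        then have "[c = -1] (mod int p)" by (simp add: cong_iff_dvd_diff)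
        then have "[c * c = (-1) * (-1)] (mod int p)" by (intro cong_mult)
        then have "[1 = c * c] (mod int p)" by (simp add: cong_sym)
        then have "[1 = -1] (mod int p)" by (rule cong_trans[OF _ cc])
        then have "int p dvd 2" by (simp add: cong_iff_dvd_diff)
        then show False using p_ge zdvd_imp_le[of "int p" 2] by simp
      qed
      then have "1 = chi ((c + 1) * (c + 1))" by (simp add: chi_square)
      also have "\<dots> = chi (2 * c)"
      proof (rule chi_cong)
        have "[c * c + (2 * c + 1) = -1 + (2 * c + 1)] (mod int p)" by (intro cong_add cc cong_refl)
        then show "[(c + 1) * (c + 1) = 2 * c] (mod int p)" by (simp add: algebra_simps)
      qed
      finally show ?thesis by (simp add: chi_mult)
    qed
    ultimately show ?thesis using c2 chi_values[of 2] chi_values[of c] by auto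
  qed
  moreover have "int (card {2..n}) = 2 * int m - 1" using m_pos by (simp add: n_def of_nat_diff)
  ultimately show ?thesis using s j by simp
qed

text \<open>
  Since \<open>p\<close> divides \<open>(x X - y Y) (x X + y Y)\<close>, it divides one factor; by the composition identity
  \<open>(x X - y Z)^2 + (x Z + y X)^2 = p^2\<close> the other coordinate of that composition must vanish.
\<close>
lemma two_squares_unique:
  fixes x y X Y :: int
  assumes "x ^ 2 + y ^ 2 = int p" "X ^ 2 + Y ^ 2 = int p" "odd x" "odd X"
  shows "x ^ 2 = X ^ 2"
proof -
  have p_odd: "odd (int p)" by (simp add: p_def)
  have ev: "even y" "even Y" using assms p_odd by (metis even_add even_power odd_pos zero_less_numeral)+
  have main: "x ^ 2 = X ^ 2" if d: "int p dvd x * X - y * Z" and Z: "X ^ 2 + Z ^ 2 = int p" "even Z" for Z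
  proof -
    obtain t where t: "x * X - y * Z = int p * t" using d by blast
    have "odd (x * X - y * Z)" using assms ev Z by simp
    (* Here parity enters: x X is odd and y Z even, so the multiple of p is not 0. *)
    then have t0: "t \<noteq> 0" using t by auto
    have id: "(x * X - y * Z) ^ 2 + (x * Z + y * X) ^ 2 = int p ^ 2"
    proof -
      have "(x * X - y * Z) ^ 2 + (x * Z + y * X) ^ 2 = (x ^ 2 + y ^ 2) * (X ^ 2 + Z ^ 2)"
        by (simp add: power2_eq_square algebra_simps)
      then show ?thesis using assms Z by (simp add: power2_eq_square)
    qed
    have "t ^ 2 \<ge> 1" using t0 by (smt (verit) zero_less_power2)
    then have "int p ^ 2 * 1 \<le> int p ^ 2 * t ^ 2" by (intro mult_left_mono) auto
    then have "(x * X - y * Z) ^ 2 \<ge> int p ^ 2" unfolding t by (simp add: power_mult_distrib)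
    then have "(x * Z + y * X) ^ 2 \<le> 0" using id by linarith
    then have "x * Z = - (y * X)" by (simp add: add_eq_0_iff)
    then have "x ^ 2 * Z ^ 2 = y ^ 2 * X ^ 2" by (metis power2_minus power_mult_distrib)
    then have "x ^ 2 * (X ^ 2 + Z ^ 2) = (x ^ 2 + y ^ 2) * X ^ 2" by (simp add: algebra_simps)
    then show ?thesis using assms Z p_ge by simp
  qed
  have yy: "y ^ 2 = int p - x ^ 2" "Y ^ 2 = int p - X ^ 2" using assms by simp_all
  have "(x * X - y * Y) * (x * X + y * Y) = x ^ 2 * X ^ 2 - y ^ 2 * Y ^ 2"
    by (simp add: power2_eq_square algebra_simps)
  also have "\<dots> = x ^ 2 * X ^ 2 - (int p - x ^ 2) * (int p - X ^ 2)" unfolding yy ..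
  also have "\<dots> = int p * (x ^ 2 + X ^ 2 - int p)" by (simp add: power2_eq_square algebra_simps)
  finally have "int p dvd (x * X - y * Y) * (x * X + y * Y)" by simp
  then have "int p dvd x * X - y * Y \<or> int p dvd x * X - y * (- Y)"
    using int_p_prime by (simp add: prime_dvd_mult_iff)
  then show ?thesis using main[of Y] main[of "- Y"] assms ev by auto
qed

text \<open>
  Both \<open>x\<close> and half of the sum are the odd coordinate of a representation of \<open>p\<close> as a sum of two
  squares, so they agree up to sign; the residue modulo 4 decides the sign.
\<close>
theorem jacobsthal:
  assumes "int p = x ^ 2 + y ^ 2" "[x = 1] (mod 4)"
  shows "jacobsthal_sum (-1) = - 2 * (-1) ^ m * x"
proof -
  define X where "X = jacobsthal_half (-1)"
  obtain Y where Y: "X ^ 2 + Y ^ 2 = int p" using jacobsthal_half_norm unfolding X_def by blast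
  have X4: "[X = 2 * int m - 1] (mod 4)" using jacobsthal_half_mod_4 unfolding X_def .
  have mod2: "odd x" "odd X" using assms(2) X4 unfolding cong_def by presburger+
  have "x ^ 2 = X ^ 2" using two_squares_unique[of x y X Y] assms Y mod2 by simp
  then have "X = x \<or> X = - x" by (auto simp: power2_eq_iff)
  then have "X = - ((-1) ^ m) * x"
  proof (cases "even m")
    case True
    then have "[X = -1] (mod 4)" using X4 unfolding cong_def by presburger
    then have "X \<noteq> x" using assms(2) unfolding cong_def by presburger
    then show ?thesis using \<open>X = x \<or> X = - x\<close> True by simp
  next
    case False
    then have "[X = 1] (mod 4)" using X4 unfolding cong_def by presburger
    then have "X \<noteq> - x" using assms(2) unfolding cong_def by presburger
    then show ?thesis using \<open>X = x \<or> X = - x\<close> False by simp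
  qed
  then show ?thesis by (simp add: jacobsthal_sum_eq_half X_def)
qed

section \<open>The Jacobsthal sum modulo the square of p\<close>

text \<open>
  So \<open>a^p\<close> is, modulo \<open>p^2\<close>, a function of the residue of \<open>a\<close> modulo \<open>p\<close>: it is the Teichmueller
  representative truncated at \<open>p^2\<close>.
\<close>
lemma cong_power_p: assumes "[a = b] (mod int p)" shows "[a ^ p = b ^ p] (mod int p ^ 2)"
proof -
  have "[(\<Sum>i<p. b ^ (p - Suc i) * a ^ i) = (\<Sum>i<p. b ^ (p - 1))] (mod int p)"
  proof (intro cong_sum)
    fix i assume "i \<in> {..<p}"
    then have "b ^ (p - 1) = b ^ (p - Suc i) * b ^ i" by (simp add: power_add[symmetric])
    then show "[b ^ (p - Suc i) * a ^ i = b ^ (p - 1)] (mod int p)"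
      using assms by (simp add: cong_mult cong_pow)
  qed
  then have "int p dvd (\<Sum>i<p. b ^ (p - Suc i) * a ^ i)"
    by (simp add: cong_iff_dvd_diff dvd_diff_left_iff)
  moreover have "int p dvd a - b" using assms by (simp add: cong_iff_dvd_diff)
  ultimately have "int p * int p dvd (a - b) * (\<Sum>i<p. b ^ (p - Suc i) * a ^ i)" by (rule mult_dvd_mono[rotated])
  then show ?thesis by (simp add: cong_iff_dvd_diff power_diff_sumr2 power2_eq_square)
qed

lemma unit_power_cong_1: assumes "\<not> int p dvd a" shows "[a ^ (2 * n) = 1] (mod int p)"
proof -
  have "[a ^ n * a ^ n = chi a * chi a] (mod int p)" by (intro cong_mult cong_sym[OF chi_cong_power])
  then show ?thesis using chi_square_eq[OF assms] by (simp add: mult_2 power_add)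
qed

lemma fermat_cong: "[a ^ p = a] (mod int p)"
proof (cases "int p dvd a")
  case True
  then have "[a = 0] (mod int p)" by (simp add: cong_0_iff)
  moreover have "int p dvd a ^ p" using p_ge by (intro dvd_trans[OF True dvd_power]) simp
  then have "[a ^ p = 0] (mod int p)" by (simp only: cong_0_iff)
  ultimately show ?thesis using cong_trans cong_sym by blast
next
  case False
  from cong_mult[OF unit_power_cong_1[OF False] cong_refl[of a]]
  show ?thesis by (simp add: p_eq mult.commute)
qed

text \<open>
  By multiplicativity the sum is invariant under multiplication by \<open>h = g^(p j)\<close> for a generator \<open>g\<close>;
  unless \<open>p - 1\<close> divides \<open>j\<close>, the factor \<open>h - 1\<close> is a unit and the sum vanishes. Ordinary powers
  \<open>a^j\<close> would give this only modulo \<open>p\<close>.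
\<close>
lemma sum_teichmueller_powers:
  assumes "j > 0"
  shows "[(\<Sum>a\<in>R. (a ^ p) ^ j) = (if 2 * n dvd j then int p - 1 else 0)] (mod int p ^ 2)"
proof -
  have "(\<Sum>a\<in>R. (a ^ p) ^ j) = (\<Sum>a\<in>U. (a ^ p) ^ j)"
    unfolding R_eq using assms p_ge by simp
  moreover have "[(\<Sum>a\<in>U. (a ^ p) ^ j) = (if 2 * n dvd j then int p - 1 else 0)] (mod int p ^ 2)"
  proof (cases "2 * n dvd j")
    case True
    then obtain i where i: "j = 2 * n * i" by blast
    have "[(\<Sum>a\<in>U. (a ^ p) ^ j) = (\<Sum>a\<in>U. 1)] (mod int p ^ 2)"
    proof (intro cong_sum)
      fix a assume "a \<in> U"
      then have "[(a ^ (2 * n)) ^ p = 1 ^ p] (mod int p ^ 2)"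
        by (intro cong_power_p unit_power_cong_1 U_not_dvd)
      then have "[((a ^ (2 * n)) ^ p) ^ i = (1 ^ p) ^ i] (mod int p ^ 2)" by (rule cong_pow)
      moreover have "((a ^ (2 * n)) ^ p) ^ i = (a ^ p) ^ j" by (simp add: i power_mult[symmetric] mult_ac)
      ultimately show "[(a ^ p) ^ j = 1] (mod int p ^ 2)" by simp
    qed
    moreover have "(\<Sum>a\<in>U. (1 :: int)) = int p - 1" using p_ge by simp
    ultimately show ?thesis using True by (simp only: if_True)
  next
    case False
    obtain g where g: "\<not> int p dvd int g" "\<And>j. [int g ^ j = 1] (mod int p) \<longleftrightarrow> 2 * n dvd j"
      using obtain_generator by metis
    define h where "h = (int g ^ p) ^ j"
    define f where "f a = (a ^ p) ^ j mod int p ^ 2" for a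
    define S where "S = (\<Sum>a\<in>U. (a ^ p) ^ j)"
    have f: "[f a = (a ^ p) ^ j] (mod int p ^ 2)" for a by (simp add: f_def)
    have per: "periodic f" unfolding periodic_def f_def
      by (metis cong_def cong_pow cong_power_p)
    have "(\<Sum>a\<in>U. f (int g * a)) = (\<Sum>a\<in>U. f a)"
    proof (rule sum_reindex_U[OF per])
      show "[a = b] (mod int p)" if "[int g * a = int g * b] (mod int p)" for a b
        using that by (rule cong_mult_cancel[OF g(1)])
      show "\<not> int p dvd int g * a" if "a \<in> U" for a
        using U_not_dvd[OF that] g(1) int_p_prime by (simp only: prime_dvd_mult_iff) blast
    qed
    moreover have "[(\<Sum>a\<in>U. f (int g * a)) = (\<Sum>a\<in>U. h * (a ^ p) ^ j)] (mod int p ^ 2)"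
    proof (intro cong_sum)
      fix a show "[f (int g * a) = h * (a ^ p) ^ j] (mod int p ^ 2)"
        using f[of "int g * a"] by (simp only: h_def power_mult_distrib)
    qed
    moreover have "[(\<Sum>a\<in>U. f a) = S] (mod int p ^ 2)"
      unfolding S_def by (intro cong_sum f)
    ultimately have "[h * S = S] (mod int p ^ 2)"
      by (metis S_def cong_sym cong_trans sum_distrib_left)
    then have "int p ^ 2 dvd (h - 1) * S" by (simp add: cong_iff_dvd_diff algebra_simps)
    moreover have "coprime (int p ^ 2) (h - 1)"
    proof -
      have "[h = int g ^ j] (mod int p)" unfolding h_def by (intro cong_pow fermat_cong)
      then have "\<not> [h = 1] (mod int p)" using g(2)[of j] False cong_sym cong_trans by blast
      then have "\<not> int p dvd h - 1" by (simp add: cong_iff_dvd_diff)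
      then show ?thesis using int_p_prime by (simp add: prime_imp_coprime)
    qed
    ultimately have "int p ^ 2 dvd S" by (simp add: coprime_dvd_mult_right_iff)
    then show ?thesis using False by (simp add: cong_0_iff S_def)
  qed
  ultimately show ?thesis by simp
qed

text \<open>
  The power \<open>z^n\<close> equals the sign \<open>\<chi>(c)\<close> only modulo \<open>p\<close>. One Newton step for \<open>w^2 = 1\<close>, namely
  \<open>w \<mapsto> w (3 - w^2) / 2\<close>, has quadratic convergence and makes it correct modulo \<open>p^2\<close>.
\<close>
lemma chi_lift: assumes "[z = c] (mod int p)" shows "[2 * chi c = 3 * z ^ n - z ^ (3 * n)] (mod int p ^ 2)"
proof -
  have "[z ^ n = chi c] (mod int p)"
    using cong_trans[OF cong_pow[OF assms] cong_sym[OF chi_cong_power]] .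
  then obtain s where "z ^ n - chi c = int p * s" by (auto simp: cong_iff_dvd_diff)
  then have s: "z ^ n = chi c + int p * s" by simp
  have z3: "z ^ (3 * n) = (z ^ n) ^ 3" by (simp add: power_mult[symmetric] mult.commute)
  show ?thesis
  proof (cases "chi c = 0")
    case True
    then have "[c = 0] (mod int p)" by (simp add: chi_eq_0_iff cong_0_iff)
    then have "int p dvd z" using assms cong_trans cong_0_iff by blast
    then have "int p ^ n dvd z ^ n" by (rule dvd_power_same)
    moreover have "int p ^ 2 dvd int p ^ n" using m_pos by (intro le_imp_power_dvd) (simp add: n_def)
    ultimately have "int p ^ 2 dvd z ^ n" by (rule dvd_trans[rotated])
    then have "int p ^ 2 dvd 3 * z ^ n - z ^ (3 * n)" unfolding z3 by (simp add: power3_eq_cube)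
    then have "[3 * z ^ n - z ^ (3 * n) = 0] (mod int p ^ 2)" by (simp only: cong_0_iff)
    then show ?thesis unfolding True mult_zero_right by (rule cong_sym)
  next
    case False
    define e where "e = chi c"
    have e: "e * e = 1" using False chi_values[of c] by (auto simp: e_def)
    (* With z^n = e + p s and e^2 = 1 the terms linear in p s cancel. *)
    have "3 * z ^ n - z ^ (3 * n) = 3 * e - e * (e * e) + int p * s * (3 - 3 * (e * e)) - int p ^ 2 * (3 * e * s ^ 2 + int p * s ^ 3)"
      unfolding z3 s e_def[symmetric] by (simp add: power2_eq_square power3_eq_cube algebra_simps)
    then have "2 * e - (3 * z ^ n - z ^ (3 * n)) = int p ^ 2 * (3 * e * s ^ 2 + int p * s ^ 3)"
      unfolding e by simp
    then show ?thesis unfolding cong_iff_dvd_diff e_def by (metis dvd_triv_left)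
  qed
qed

text \<open>
  The sum of those coefficients of \<open>(t^3 - t)^r\<close> whose exponent is divisible by \<open>p - 1\<close>, the only ones
  that survive summation over Teichmueller representatives.
\<close>
definition coeff_sum :: "nat \<Rightarrow> int" where
  "coeff_sum r = (\<Sum>k\<le>r. if 2 * n dvd r + 2 * k then (-1) ^ (r - k) * int (r choose k) else 0)"

lemma sum_cubic_powers: assumes "r > 0"
  shows "[(\<Sum>a\<in>R. (a ^ p * (a ^ p * a ^ p - 1)) ^ r) = (int p - 1) * coeff_sum r] (mod int p ^ 2)"
proof -
  define c where "c k = (-1) ^ (r - k) * int (r choose k)" for k
  have "(\<Sum>a\<in>R. (a ^ p * (a ^ p * a ^ p - 1)) ^ r) = (\<Sum>a\<in>R. \<Sum>k\<le>r. c k * (a ^ p) ^ (r + 2 * k))"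
    unfolding cubic_power c_def ..
  then have 1: "(\<Sum>a\<in>R. (a ^ p * (a ^ p * a ^ p - 1)) ^ r) = (\<Sum>k\<le>r. c k * (\<Sum>a\<in>R. (a ^ p) ^ (r + 2 * k)))"
    by (subst (asm) sum.swap) (simp only: sum_distrib_left)
  have "c k * (if 2 * n dvd r + 2 * k then int p - 1 else 0)
      = (int p - 1) * (if 2 * n dvd r + 2 * k then c k else 0)" for k
    by (cases "2 * n dvd r + 2 * k") (simp_all only: if_True if_False mult_zero_right mult_ac)
  then have 2: "(\<Sum>k\<le>r. c k * (if 2 * n dvd r + 2 * k then int p - 1 else 0)) = (int p - 1) * coeff_sum r"
    unfolding coeff_sum_def c_def[symmetric] by (simp only: sum_distrib_left)
  have "[(\<Sum>k\<le>r. c k * (\<Sum>a\<in>R. (a ^ p) ^ (r + 2 * k)))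
      = (\<Sum>k\<le>r. c k * (if 2 * n dvd r + 2 * k then int p - 1 else 0))] (mod int p ^ 2)"
  proof (rule cong_sum)
    fix k
    have "r + 2 * k > 0" using assms by simp
    from cong_mult[OF cong_refl sum_teichmueller_powers[OF this]]
    show "[c k * (\<Sum>a\<in>R. (a ^ p) ^ (r + 2 * k)) = c k * (if 2 * n dvd r + 2 * k then int p - 1 else 0)] (mod int p ^ 2)" .
  qed
  then show ?thesis unfolding 1 2 .
qed

text \<open>
  The exponents \<open>n + 2 k\<close> run from \<open>n\<close> to \<open>3 n\<close> and meet a multiple of \<open>2 n\<close> only at \<open>k = m\<close>.
\<close>
lemma coeff_sum_n: "coeff_sum n = (-1) ^ m * int (n choose m)"
proof -
  have iff: "2 * n dvd n + 2 * k \<longleftrightarrow> k = m" if "k \<le> n" for k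
  proof
    assume "2 * n dvd n + 2 * k"
    then obtain i where i: "n + 2 * k = 2 * n * i" by blast
    have "i \<noteq> 0" by (rule notI) (use i n_pos in simp)
    moreover have "\<not> i \<ge> 2"
    proof
      assume "i \<ge> 2"
      then have "2 * n * 2 \<le> 2 * n * i" by (rule mult_le_mono2)
      then show False using i that n_pos by linarith
    qed
    ultimately have "i = 1" by linarith
    then have "n + 2 * k = 2 * n" using i by simp
    then show "k = m" using n_def by linarith
  qed (simp add: n_def)
  have "coeff_sum n = (\<Sum>k\<le>n. if k = m then (-1) ^ (n - k) * int (n choose k) else 0)"
    unfolding coeff_sum_def by (intro sum.cong refl) (simp add: iff)
  also have "\<dots> = (-1) ^ (n - m) * int (n choose m)" by (simp add: n_def)
  finally show ?thesis by (simp add: n_def)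
qed

text \<open>
  The exponents \<open>3 n + 2 k\<close> run from \<open>3 n\<close> to \<open>9 n\<close> and meet \<open>4 n\<close>, \<open>6 n\<close> and \<open>8 n\<close>.
\<close>
lemma coeff_sum_3n: "coeff_sum (3 * n) = (-1) ^ m * (2 * int ((6 * m) choose m) + int ((6 * m) choose (3 * m)))"
proof -
  have iff: "2 * n dvd 3 * n + 2 * k \<longleftrightarrow> k \<in> {m, 3 * m, 5 * m}" if "k \<le> 3 * n" for k
  proof
    assume "2 * n dvd 3 * n + 2 * k"
    then obtain i where i: "3 * n + 2 * k = 2 * n * i" by blast
    have "\<not> i \<le> 1"
    proof
      assume "i \<le> 1"
      then have "2 * n * i \<le> 2 * n * 1" by (rule mult_le_mono2)
      then show False using i n_pos by linarith
    qed
    moreover have "\<not> i \<ge> 5"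
    proof
      assume "i \<ge> 5"
      then have "2 * n * 5 \<le> 2 * n * i" by (rule mult_le_mono2)
      then show False using i that n_pos by linarith
    qed
    ultimately have "i = 2 \<or> i = 3 \<or> i = 4" by linarith
    then have "3 * n + 2 * k = 4 * n \<or> 3 * n + 2 * k = 6 * n \<or> 3 * n + 2 * k = 8 * n" using i by (elim disjE) simp_all
    then have "k = m \<or> k = 3 * m \<or> k = 5 * m" using n_def by linarith
    then show "k \<in> {m, 3 * m, 5 * m}" by simp
  next
    assume "k \<in> {m, 3 * m, 5 * m}"
    then have "3 * n + 2 * k \<in> {2 * n * 2, 2 * n * 3, 2 * n * 4}" by (auto simp: n_def)
    then show "2 * n dvd 3 * n + 2 * k" by (metis dvd_triv_left insertE singletonD)
  qed
  have "coeff_sum (3 * n) = (\<Sum>k\<in>{m, 3 * m, 5 * m}. (-1) ^ (3 * n - k) * int ((3 * n) choose k))"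
    unfolding coeff_sum_def
  proof (rule sum.mono_neutral_cong_right)
    show sub: "{m, 3 * m, 5 * m} \<subseteq> {..3 * n}" by (simp add: n_def)
    show "\<forall>k\<in>{..3 * n} - {m, 3 * m, 5 * m}. (if 2 * n dvd 3 * n + 2 * k then (-1) ^ (3 * n - k) * int ((3 * n) choose k) else 0) = 0"
      using iff by auto
    show "(if 2 * n dvd 3 * n + 2 * k then (-1) ^ (3 * n - k) * int ((3 * n) choose k) else 0)
      = (-1) ^ (3 * n - k) * int ((3 * n) choose k)" if "k \<in> {m, 3 * m, 5 * m}" for k
      using iff[of k] that sub by auto
  qed simp
  also have "3 * n = 6 * m" by (simp add: n_def)
  also have "(\<Sum>k\<in>{m, 3 * m, 5 * m}. (-1) ^ (6 * m - k) * int ((6 * m) choose k))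
     = (-1) ^ (5 * m) * int ((6 * m) choose m) + (-1) ^ (3 * m) * int ((6 * m) choose (3 * m))
     + (-1) ^ m * int ((6 * m) choose (5 * m))" using m_pos by simp
  also have "(6 * m) choose (5 * m) = (6 * m) choose m" using binomial_symmetric[of m "6 * m"] by simp
  finally have "coeff_sum (6 * m) = (-1) ^ (5 * m) * int ((6 * m) choose m)
     + (-1) ^ (3 * m) * int ((6 * m) choose (3 * m)) + (-1) ^ m * int ((6 * m) choose m)" .
  moreover have "(-1 :: int) ^ (5 * m) = (-1) ^ m" "(-1 :: int) ^ (3 * m) = (-1) ^ m" by (simp_all add: minus_one_power_iff)
  moreover have "3 * n = 6 * m" by (simp add: n_def)
  ultimately show ?thesis by (simp add: algebra_simps)
qed

text \<open>
  Each summand is lifted by \<open>chi_lift\<close> at \<open>z = t^3 - t\<close> with \<open>t = a^p\<close>, which is congruent to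
  \<open>a^3 - a\<close> modulo \<open>p\<close>.
\<close>
lemma jacobsthal_cong_binomials:
  "[2 * jacobsthal_sum (-1) = (int p - 1) * (-1) ^ m *
     (3 * int (n choose m) - 2 * int ((6 * m) choose m) - int ((6 * m) choose (3 * m)))] (mod int p ^ 2)"
proof -
  define z where "z a = a ^ p * (a ^ p * a ^ p - 1)" for a :: int
  have z: "[z a = a * (a * a + -1)] (mod int p)" for a
    unfolding z_def diff_conv_add_uminus by (intro cong_mult cong_add fermat_cong cong_refl)
  have "2 * jacobsthal_sum (-1) = (\<Sum>a\<in>R. 2 * chi (a * (a * a + -1)))" by (simp add: jacobsthal_sum_def sum_distrib_left)
  also have "[\<dots> = (\<Sum>a\<in>R. 3 * z a ^ n - z a ^ (3 * n))] (mod int p ^ 2)"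
    by (intro cong_sum chi_lift z)
  also have "(\<Sum>a\<in>R. 3 * z a ^ n - z a ^ (3 * n)) = 3 * (\<Sum>a\<in>R. z a ^ n) - (\<Sum>a\<in>R. z a ^ (3 * n))"
    by (simp add: sum_subtractf sum_distrib_left)
  also have "[\<dots> = 3 * ((int p - 1) * coeff_sum n) - (int p - 1) * coeff_sum (3 * n)] (mod int p ^ 2)"
    unfolding z_def using m_pos by (intro cong_diff cong_mult cong_refl sum_cubic_powers) (simp_all add: n_def)
  also have "3 * ((int p - 1) * coeff_sum n) - (int p - 1) * coeff_sum (3 * n)
    = (int p - 1) * (-1) ^ m * (3 * int (n choose m) - 2 * int ((6 * m) choose m) - int ((6 * m) choose (3 * m)))"
    unfolding coeff_sum_n coeff_sum_3n by (simp add: algebra_simps)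
  finally show ?thesis .
qed

end

section \<open>Legendre polynomials and Clausen's identity\<close>

text \<open>
  The coefficient of \<open>t^k\<close> in the Legendre polynomial \<open>P_n(1 + 2 t)\<close>.
\<close>
definition legendre_coeff :: "nat \<Rightarrow> nat \<Rightarrow> rat" where
  "legendre_coeff n k = of_nat (n choose k) * of_nat ((n + k) choose k)"

text \<open>
  The coefficient of \<open>w^k\<close> in the hypergeometric polynomial \<open>3F2(-n, n + 1, 1/2; 1, 1; -4 w)\<close>.
\<close>
definition clausen_coeff :: "nat \<Rightarrow> nat \<Rightarrow> rat" where
  "clausen_coeff n k = legendre_coeff n k * of_nat ((2 * k) choose k)"

lemma legendre_coeff_0 [simp]: "legendre_coeff n 0 = 1" and clausen_coeff_0 [simp]: "clausen_coeff n 0 = 1"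
  by (simp_all add: legendre_coeff_def clausen_coeff_def)

lemma legendre_coeff_beyond: "k > n \<Longrightarrow> legendre_coeff n k = 0" and clausen_coeff_beyond: "k > n \<Longrightarrow> clausen_coeff n k = 0"
  by (simp_all add: legendre_coeff_def clausen_coeff_def binomial_eq_0)

lemma rat_binomial_Suc:
  "(of_nat k + 1) * (of_nat (n choose Suc k) :: rat) = (of_nat n - of_nat k) * of_nat (n choose k)"
proof (cases "k \<le> n")
  case True
  have "Suc k * (n choose Suc k) = (n - k) * (n choose k)"
    using binomial_absorb_comp[of n k] binomial_absorption[of k n] by simp
  then have "rat_of_nat (Suc k * (n choose Suc k)) = of_nat ((n - k) * (n choose k))" by simp
  then show ?thesis using True by (simp add: of_nat_diff algebra_simps)
qed (simp add: binomial_eq_0)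

lemma rat_binomial_diag_Suc:
  "(of_nat k + 1) * (of_nat ((n + Suc k) choose Suc k) :: rat) = (of_nat n + of_nat k + 1) * of_nat ((n + k) choose k)"
proof -
  have "Suc k * (Suc (n + k) choose Suc k) = Suc (n + k) * ((n + k) choose k)"
    using Suc_times_binomial_eq[of "n + k" k] by simp
  then have "rat_of_nat (Suc k * (Suc (n + k) choose Suc k)) = of_nat (Suc (n + k) * ((n + k) choose k))"
    by (simp only:)
  then show ?thesis unfolding of_nat_mult by (simp add: algebra_simps del: binomial_Suc_Suc)
qed

lemma rat_central_binomial_Suc:
  "(of_nat k + 1) * (of_nat ((2 * Suc k) choose Suc k) :: rat) = 2 * (2 * of_nat k + 1) * of_nat ((2 * k) choose k)"
proof -
  have a: "(of_nat k + 1) * (of_nat (Suc (k + Suc k) choose Suc k) :: rat) = (2 * of_nat k + 2) * of_nat ((k + Suc k) choose k)"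
    using Suc_times_binomial_eq[of "k + Suc k" k, THEN arg_cong, of rat_of_nat] by (simp add: algebra_simps)
  have b: "(k + Suc k) choose k = (k + Suc k) choose Suc k"
    using binomial_symmetric[of k "k + Suc k"] by simp
  have c: "2 * Suc k = Suc (k + Suc k)" "2 * k = k + k" by simp_all
  have "(of_nat k + 1) * ((of_nat k + 1) * (of_nat (Suc (k + Suc k) choose Suc k) :: rat)) =
    (2 * of_nat k + 2) * ((of_nat k + 1) * of_nat ((k + Suc k) choose Suc k))"
    unfolding a unfolding b by (simp only: mult_ac)
  also have "\<dots> = (of_nat k + 1) * (2 * (2 * of_nat k + 1) * of_nat ((k + k) choose k))"
    unfolding rat_binomial_diag_Suc by (simp add: algebra_simps)
  finally have "rat_of_nat k + 1 = 0 \<or> (of_nat k + 1) * (of_nat (Suc (k + Suc k) choose Suc k) :: rat)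
    = 2 * (2 * of_nat k + 1) * of_nat ((k + k) choose k)"
    by (simp only: mult_cancel_left)
  moreover have "rat_of_nat k + 1 \<noteq> 0" using of_nat_neq_0[of k] by (simp add: add.commute)
  ultimately show ?thesis unfolding c by blast
qed

lemma legendre_coeff_Suc: "(of_nat k + 1) ^ 2 * legendre_coeff n (Suc k) = (of_nat n * (of_nat n + 1) - of_nat k * (of_nat k + 1)) * legendre_coeff n k"
proof -
  have "(of_nat k + 1) ^ 2 * legendre_coeff n (Suc k) =
    ((of_nat k + 1) * of_nat (n choose Suc k)) * ((of_nat k + 1) * of_nat ((n + Suc k) choose Suc k))"
    by (simp add: legendre_coeff_def power2_eq_square del: binomial_Suc_Suc)
  also have "\<dots> = (of_nat n * (of_nat n + 1) - of_nat k * (of_nat k + 1)) * legendre_coeff n k"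
    unfolding rat_binomial_Suc[of k n] rat_binomial_diag_Suc[of k n] by (simp add: legendre_coeff_def algebra_simps)
  finally show ?thesis .
qed

lemma clausen_coeff_Suc: "(of_nat k + 1) ^ 3 * clausen_coeff n (Suc k)
  = 2 * (2 * of_nat k + 1) * (of_nat n * (of_nat n + 1) - of_nat k * (of_nat k + 1)) * clausen_coeff n k"
proof -
  have "(of_nat k + 1) ^ 3 * clausen_coeff n (Suc k) =
    ((of_nat k + 1) ^ 2 * legendre_coeff n (Suc k)) * ((of_nat k + 1) * of_nat ((2 * Suc k) choose Suc k))"
    by (simp add: clausen_coeff_def power2_eq_square power3_eq_cube del: binomial_Suc_Suc mult_Suc_right)
  also have "\<dots> = 2 * (2 * of_nat k + 1) * (of_nat n * (of_nat n + 1) - of_nat k * (of_nat k + 1)) * clausen_coeff n k"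
    unfolding legendre_coeff_Suc rat_central_binomial_Suc by (simp add: clausen_coeff_def algebra_simps)
  finally show ?thesis .
qed

lemma legendre_coeff_eq_choose: "legendre_coeff n k = of_nat ((n + k) choose (2 * k)) * of_nat ((2 * k) choose k)"
proof (cases "k \<le> n")
  case True
  have "((n + k) choose (2 * k)) * ((2 * k) choose k) = ((n + k) choose k) * (n choose k)"
    using choose_mult[of k "2 * k" "n + k"] True by simp
  then have "rat_of_nat (((n + k) choose (2 * k)) * ((2 * k) choose k)) = of_nat (((n + k) choose k) * (n choose k))"
    by simp
  then show ?thesis by (simp add: legendre_coeff_def mult.commute)
qed (simp add: legendre_coeff_def binomial_eq_0)

lemma sum_shift: fixes g :: "nat \<Rightarrow> rat"
  assumes "g 0 = 0" "g (Suc n) = 0" shows "(\<Sum>k\<le>n. g k) = (\<Sum>k\<le>n. g (Suc k))"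
  using sum.atMost_Suc_shift[of g n] assms by simp

definition poly_upto :: "(nat \<Rightarrow> rat) \<Rightarrow> nat \<Rightarrow> rat poly" where
  "poly_upto c n = (\<Sum>k\<le>n. monom (c k) k)"

lemma coeff_poly_upto: "coeff (poly_upto c n) k = (if k \<le> n then c k else 0)"
  by (simp add: poly_upto_def coeff_sum)

lemma poly_poly_upto: "poly (poly_upto c n) t = (\<Sum>k\<le>n. c k * t ^ k)"
  by (simp add: poly_upto_def poly_sum poly_monom)

lemma poly_pderiv_poly_upto: "t * poly (pderiv (poly_upto c n)) t = (\<Sum>k\<le>n. of_nat k * c k * t ^ k)"
proof -
  have "t * poly (pderiv (monom a k)) t = of_nat k * a * t ^ k" for a :: rat and k
    by (cases k) (simp_all add: pderiv_monom poly_monom)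
  then show ?thesis
    unfolding poly_upto_def by (induction n) (simp_all add: pderiv_add distrib_left)
qed

lemma poly_pderiv2_poly_upto:
  "t ^ 2 * poly (pderiv (pderiv (poly_upto c n))) t + t * poly (pderiv (poly_upto c n)) t = (\<Sum>k\<le>n. of_nat k ^ 2 * c k * t ^ k)"
proof -
  have *: "t ^ 2 * poly (pderiv (pderiv (monom a k))) t + t * poly (pderiv (monom a k)) t = of_nat k ^ 2 * a * t ^ k" for a :: rat and k
  proof (cases k)
    case (Suc j)
    then show ?thesis by (cases j) (simp_all add: pderiv_monom poly_monom power2_eq_square algebra_simps)
  qed (simp add: pderiv_monom)
  show ?thesis
    unfolding poly_upto_def
  proof (induction n)
    case 0 show ?case using *[of "c 0" 0] by simp
  next
    case (Suc n) then show ?case using *[of "c (Suc n)" "Suc n"]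
      by (simp add: pderiv_add distrib_left del: of_nat_Suc power_Suc)
  qed
qed

definition quad :: "rat poly" where "quad = [:0, 1, 1:]"

lemma coeff_quad_mult: "coeff (quad * f) (Suc k) = coeff f k + (if k = 0 then 0 else coeff f (k - 1))"
  "coeff (quad * f) 0 = 0"
  by (cases k) (simp_all add: quad_def)

lemma pderiv_quad: "pderiv quad = [:1, 2:]" by (simp add: quad_def pderiv_pCons)

lemma coeff_quad'_mult: "coeff ([:1, 2:] * f) k = coeff f k + (if k = 0 then 0 else 2 * coeff f (k - 1 :: nat) :: rat)"
  by (cases k) simp_all

text \<open>
  Legendre's differential equation \<open>(q F')' = N F\<close> in the variable \<open>t\<close>, where \<open>q = t (1 + t)\<close>.
\<close>
definition legendre_ode :: "rat \<Rightarrow> rat poly \<Rightarrow> bool" where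
  "legendre_ode N F \<longleftrightarrow> quad * pderiv (pderiv F) + pderiv quad * pderiv F = smult N F"

lemma coeff_ode: "coeff (quad * pderiv (pderiv F) + pderiv quad * pderiv F) k
  = (of_nat k + 1) ^ 2 * coeff F (Suc k) + of_nat k * (of_nat k + 1) * coeff F k"
proof (cases k)
  case 0 then show ?thesis by (simp add: pderiv_quad coeff_quad_mult coeff_quad'_mult coeff_pderiv)
next
  case (Suc j)
  then show ?thesis
    by (cases j) (simp_all add: pderiv_quad coeff_quad_mult coeff_quad'_mult coeff_pderiv algebra_simps power2_eq_square)
qed

text \<open>
  On coefficients the equation is a two-term recurrence, so a solution is determined by its constant
  term; this carries both the uniqueness and the reflection argument below.
\<close>
lemma legendre_ode_iff: "legendre_ode N F \<longleftrightarrow>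
  (\<forall>k. (of_nat k + 1) ^ 2 * coeff F (Suc k) = (N - of_nat k * (of_nat k + 1)) * coeff F k)"
  unfolding legendre_ode_def poly_eq_iff coeff_ode by (auto simp: algebra_simps)

definition legendre_poly :: "nat \<Rightarrow> rat poly" where "legendre_poly n = poly_upto (legendre_coeff n) n"

lemma coeff_legendre_poly: "coeff (legendre_poly n) k = legendre_coeff n k"
  by (simp add: legendre_poly_def coeff_poly_upto legendre_coeff_beyond)

lemma legendre_ode_legendre_poly: "legendre_ode (of_nat n * (of_nat n + 1)) (legendre_poly n)"
  unfolding legendre_ode_iff coeff_legendre_poly legendre_coeff_Suc by simp

lemma legendre_ode_unique:
  assumes "legendre_ode (of_nat n * (of_nat n + 1)) F"
  shows "F = smult (coeff F 0) (legendre_poly n)"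
proof (rule poly_eqI)
  fix k show "coeff F k = coeff (smult (coeff F 0) (legendre_poly n)) k"
  proof (induction k)
    case (Suc k)
    have "(of_nat k + 1) ^ 2 * coeff F (Suc k) = coeff F 0 * ((of_nat k + 1) ^ 2 * legendre_coeff n (Suc k))"
      using assms Suc unfolding legendre_ode_iff legendre_coeff_Suc by (simp add: coeff_legendre_poly)
    moreover have "(rat_of_nat k + 1) ^ 2 \<noteq> 0"
      by (simp add: add_eq_0_iff flip: of_nat_Suc)
    ultimately have "coeff F (Suc k) = coeff F 0 * legendre_coeff n (Suc k)"
      by (metis mult_left_cancel mult.left_commute)
    then show ?case by (simp add: coeff_legendre_poly)
  qed (simp add: coeff_legendre_poly)
qed

lemma degree_legendre_poly: "degree (legendre_poly n) = n"
proof (rule antisym)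
  show "degree (legendre_poly n) \<le> n" by (rule degree_le) (auto simp: coeff_legendre_poly legendre_coeff_beyond)
  show "n \<le> degree (legendre_poly n)" by (rule le_degree) (simp add: coeff_legendre_poly legendre_coeff_def binomial_eq_0_iff)
qed

text \<open>
  The substitution \<open>t \<mapsto> -1 - t\<close> fixes \<open>t (1 + t)\<close> and hence the differential equation. The
  reflected polynomial is thus a multiple of the original one, and the leading coefficients show that
  the factor is \<open>(-1)^n\<close>.
\<close>
lemma legendre_poly_reflect: assumes "even n" shows "legendre_poly n \<circ>\<^sub>p [:-1, -1:] = legendre_poly n"
proof -
  define r :: "rat poly" where "r = [:-1, -1:]"
  define F where "F = legendre_poly n \<circ>\<^sub>p r"
  have r': "pderiv r = [:-1:]" by (simp add: r_def pderiv_pCons)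
  have qr: "quad \<circ>\<^sub>p r = quad" by (simp add: quad_def r_def pcompose_pCons)
  have quad'r: "pderiv quad \<circ>\<^sub>p r = - pderiv quad" by (simp add: pderiv_quad r_def pcompose_pCons)
  have F': "pderiv F = - (pderiv (legendre_poly n) \<circ>\<^sub>p r)"
    by (simp add: F_def pderiv_pcompose r')
  have F'': "pderiv (pderiv F) = pderiv (pderiv (legendre_poly n)) \<circ>\<^sub>p r"
    by (simp add: F' pderiv_pcompose r' pderiv_minus)
  have "(quad * pderiv (pderiv (legendre_poly n)) + pderiv quad * pderiv (legendre_poly n)) \<circ>\<^sub>p r
     = (smult (of_nat n * (of_nat n + 1)) (legendre_poly n)) \<circ>\<^sub>p r"
    using legendre_ode_legendre_poly[of n] by (simp add: legendre_ode_def)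
  then have "legendre_ode (of_nat n * (of_nat n + 1)) F"
    unfolding legendre_ode_def F'' unfolding F'
    by (simp add: pcompose_add pcompose_mult qr quad'r pcompose_smult F_def[symmetric])
  from legendre_ode_unique[OF this] have e: "F = smult (coeff F 0) (legendre_poly n)" .
  (* The leading coefficients identify the constant of proportionality. *)
  have "lead_coeff F = lead_coeff (legendre_poly n) * (-1) ^ n"
    unfolding F_def by (subst lead_coeff_comp) (simp_all add: r_def degree_legendre_poly)
  moreover have "lead_coeff F = coeff F 0 * lead_coeff (legendre_poly n)"
    using arg_cong[OF e, of lead_coeff] by simp
  moreover have "lead_coeff (legendre_poly n) \<noteq> 0"
    by (simp add: degree_legendre_poly coeff_legendre_poly legendre_coeff_def binomial_eq_0_iff)
  ultimately have "coeff F 0 = 1" using assms by simp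
  then show ?thesis using e by (simp add: F_def r_def)
qed

text \<open>
  The symmetric square of Legendre's equation: the third-order equation satisfied by the products of any two of its
  solutions.
\<close>
definition square_ode :: "rat \<Rightarrow> rat poly \<Rightarrow> bool" where
  "square_ode N F \<longleftrightarrow>
     pderiv (quad * (quad * pderiv (pderiv F) + pderiv quad * pderiv F - smult (2 * N) F)) = smult (2 * N) (quad * pderiv F)"

lemma pderiv_double: "pderiv (2 * f) = 2 * pderiv (f :: rat poly)"
  unfolding mult_2 pderiv_add ..

lemma pderiv_square: "pderiv (f ^ 2) = 2 * (f * (pderiv f :: rat poly))"
  by (subst power2_eq_square, subst pderiv_mult, subst mult_2, rule refl)

text \<open>
  The polynomial arithmetic of the following two lemmas, stated with indeterminates for the
  polynomials and their derivatives so that it is decided by pure ring reasoning.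
\<close>
lemma square_ode_ring_identities: fixes s a b c d e f :: "'a :: idom"
  shows "2 * (s * (s * (a * b + a * b) + (a * a) * c) + (s * (a * a)) * c) = 4 * ((s * a) * (s * b + c * a))"
    and "4 * (a * b * (c * d)) = 2 * (c * (a * (2 * (d * b))))"
    and "s * (2 * (a * b + c * c)) + d * (2 * (a * c)) - 2 * (e * a ^ 2)
        = 2 * (s * (c * c)) + 2 * a * (s * b + d * c - e * a)"
    and "s * (2 * (a * b)) = 2 * (s * (a * b))"
    and "a * (c * a) + d * 2 = a * a * c + 2 * d"
    and "s * (a * a * c + 2 * d) + a * (a * d) - e = s * (a * a) * c + (a * a + 2 * s) * d - e"
  by Groebner_Basis.algebra+

text \<open>
  With \<open>F = f^2\<close> and \<open>(q f')' = N f\<close>, the second-order expression inside \<open>square_ode\<close> is \<open>2 q f'^2\<close>.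
  Since \<open>q\<close> times it is \<open>2 (q f')^2\<close>, its derivative is \<open>4 (q f') N f\<close>, which is \<open>2 N q F'\<close>.
\<close>
lemma square_ode_square: assumes "legendre_ode N f" shows "square_ode N (f ^ 2)"
proof -
  define f' where "f' = pderiv f"
  define f'' where "f'' = pderiv f'"
  define quad' where "quad' = pderiv quad"
  define M where "M = [:N:]"
  have sm: "smult N g = M * g" "smult (2 * N) g = 2 * (M * g)" for g
    unfolding M_def by (simp_all add: numeral_poly mult.commute[of 2 N])
  have F': "pderiv (f ^ 2) = 2 * (f * f')"
    unfolding f'_def by (rule pderiv_square)
  have F'': "pderiv (pderiv (f ^ 2)) = 2 * (f * f'' + f' * f')"
    unfolding F' by (subst pderiv_double, subst pderiv_mult, fold f'_def f''_def, rule refl)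
  have ode: "quad * f'' + quad' * f' = M * f"
    using assms unfolding legendre_ode_def f'_def f''_def quad'_def sm(1) .
  have Y: "quad * pderiv (pderiv (f ^ 2)) + quad' * pderiv (f ^ 2) - smult (2 * N) (f ^ 2) = 2 * (quad * (f' * f'))"
  proof -
    have "quad * (2 * (f * f'' + f' * f')) + quad' * (2 * (f * f')) - 2 * (M * f ^ 2)
        = 2 * (quad * (f' * f')) + 2 * f * (quad * f'' + quad' * f' - M * f)"
      by (rule square_ode_ring_identities)
    also have "\<dots> = 2 * (quad * (f' * f'))" unfolding ode by simp
    finally show ?thesis unfolding F'' sm(2) unfolding F' .
  qed
  have "pderiv (quad * (2 * (quad * (f' * f')))) = pderiv (2 * (quad * (quad * (f' * f'))))"
    by (subst square_ode_ring_identities(4), rule refl)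
  also have "\<dots> = 2 * (quad * (quad * (f' * f'' + f' * f'') + (f' * f') * quad') + (quad * (f' * f')) * quad')"
    by (subst pderiv_double, subst pderiv_mult, subst pderiv_mult, subst pderiv_mult, fold f''_def quad'_def, rule refl)
  also have "\<dots> = 4 * ((quad * f') * (quad * f'' + quad' * f'))"
    by (rule square_ode_ring_identities)
  also have "\<dots> = smult (2 * N) (quad * pderiv (f ^ 2))"
    unfolding ode F' sm(2) by (rule square_ode_ring_identities)
  finally show ?thesis unfolding square_ode_def quad'_def[symmetric] Y .
qed

text \<open>
  The point \<open>t = 0\<close> is singular with triple exponent 0: the equation determines the coefficient of
  index \<open>k + 1\<close> from the preceding ones, with the factor \<open>(k + 1)^3\<close>.
\<close>
lemma square_ode_unique:
  assumes "square_ode N F" "square_ode N G" "coeff F 0 = coeff G 0"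
  shows "F = G"
proof -
  define H where "H = F - G"
  define Y where "Y = quad * pderiv (pderiv H) + pderiv quad * pderiv H - smult (2 * N) H"
  have "Y = (quad * pderiv (pderiv F) + pderiv quad * pderiv F - smult (2 * N) F)
          - (quad * pderiv (pderiv G) + pderiv quad * pderiv G - smult (2 * N) G)"
    unfolding Y_def H_def pderiv_diff by (simp add: right_diff_distrib smult_diff_right)
  then have "pderiv (quad * Y) = smult (2 * N) (quad * pderiv F) - smult (2 * N) (quad * pderiv G)"
    using assms(1,2) unfolding square_ode_def by (simp only: right_diff_distrib pderiv_diff)
  also have "\<dots> = smult (2 * N) (quad * pderiv H)"
    unfolding H_def by (simp only: pderiv_diff right_diff_distrib smult_diff_right)
  finally have ode: "(of_nat k + 1) * coeff (quad * Y) (Suc k) = 2 * N * coeff (quad * pderiv H) k" for k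
    by (metis coeff_pderiv coeff_smult add.commute of_nat_Suc)
  have Yk: "coeff Y k = (of_nat k + 1) ^ 2 * coeff H (Suc k) + (of_nat k * (of_nat k + 1) - 2 * N) * coeff H k" for k
    unfolding Y_def coeff_diff coeff_ode by (simp add: algebra_simps)
  have "\<forall>j\<le>k. coeff H j = 0" for k
  proof (induction k)
    case 0 show ?case using assms(3) by (simp add: H_def)
  next
    case (Suc k)
    have 1: "coeff (quad * pderiv H) k = 0"
      using Suc by (cases k) (auto simp: coeff_quad_mult coeff_pderiv)
    have 2: "coeff (quad * Y) (Suc k) = (of_nat k + 1) ^ 2 * coeff H (Suc k)"
      using Suc by (cases k) (auto simp: coeff_quad_mult Yk)
    have "(of_nat k + 1) * ((of_nat k + 1) ^ 2 * coeff H (Suc k)) = 0"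
      using ode[of k] unfolding 1 2 by simp
    then have "coeff H (Suc k) = 0"
      by (simp add: add_eq_0_iff flip: of_nat_Suc)
    then show ?case using Suc by (auto simp: le_Suc_eq)
  qed
  then have "H = 0" by (auto simp: poly_eq_iff)
  then show ?thesis by (simp add: H_def)
qed

definition clausen_poly :: "nat \<Rightarrow> rat poly" where "clausen_poly n = poly_upto (clausen_coeff n) n"

lemma coeff_clausen_poly: "coeff (clausen_poly n) k = clausen_coeff n k"
  by (simp add: clausen_poly_def coeff_poly_upto clausen_coeff_beyond)

text \<open>
  In the variable \<open>w = t (1 + t)\<close> the recurrence of the coefficients is a third-order equation for
  \<open>clausen_poly\<close>, the fact called \<open>ode\<close> in the proof. Pulling it back along \<open>w\<close> gives the symmetric square,
  because \<open>(1 + 2 t)^2 = 1 + 4 w\<close>.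
\<close>
lemma square_ode_clausen_poly: "square_ode (of_nat n * (of_nat n + 1)) (clausen_poly n \<circ>\<^sub>p quad)"
proof -
  define N :: rat where "N = of_nat n * (of_nat n + 1)"
  define Q where "Q = clausen_poly n"
  define Q' where "Q' = pderiv Q"
  define Q'' where "Q'' = pderiv Q'"
  define y where "y = [:0, 1, 4:] * Q'' + [:1, 6:] * Q' - smult (2 * N) Q"
  define quad' where "quad' = pderiv quad"
  define M where "M = [:N:]"
  have sm: "smult N g = M * g" "smult (2 * N) g = 2 * M * g" for g
    by (simp_all add: M_def numeral_poly mult.commute[of 2 N])
  have yk: "coeff y k = (of_nat k + 1) ^ 2 * clausen_coeff n (Suc k) + (4 * of_nat k ^ 2 + 2 * of_nat k - 2 * N) * clausen_coeff n k" for k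
  proof (cases k)
    case (Suc j) then show ?thesis
      by (cases j) (simp_all add: y_def Q''_def Q'_def Q_def coeff_pderiv coeff_clausen_poly algebra_simps power2_eq_square)
  qed (simp add: y_def Q''_def Q'_def Q_def coeff_pderiv coeff_clausen_poly)
  have ode: "pderiv ([:0, 1:] * y) = smult (2 * N) ([:0, 1:] * Q')"
  proof (rule poly_eqI)
    fix k
    have "coeff (pderiv ([:0, 1:] * y)) k = (of_nat k + 1) ^ 3 * clausen_coeff n (Suc k)
        + (of_nat k + 1) * (4 * of_nat k ^ 2 + 2 * of_nat k - 2 * N) * clausen_coeff n k"
      by (simp add: coeff_pderiv yk power3_eq_cube power2_eq_square algebra_simps)
    also have "\<dots> = 2 * N * of_nat k * clausen_coeff n k"
      unfolding clausen_coeff_Suc N_def[symmetric] by (simp add: power2_eq_square algebra_simps)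
    also have "\<dots> = coeff (smult (2 * N) ([:0, 1:] * Q')) k"
      by (cases k) (simp_all add: Q'_def Q_def coeff_pderiv coeff_clausen_poly)
    finally show "coeff (pderiv ([:0, 1:] * y)) k = coeff (smult (2 * N) ([:0, 1:] * Q')) k" .
  qed
  define F where "F = Q \<circ>\<^sub>p quad"
  have quad'2: "quad' * quad' = [:1, 4, 4:]" "pderiv quad' = 2"
    by (simp_all add: quad'_def pderiv_quad pderiv_pCons numeral_poly)
  have yq: "y \<circ>\<^sub>p quad = quad * (quad' * quad') * (Q'' \<circ>\<^sub>p quad) + (quad' * quad' + 2 * quad) * (Q' \<circ>\<^sub>p quad) - smult (2 * N) F"
  proof -
    have a: "[:0, 1, 4:] \<circ>\<^sub>p quad = quad * (quad' * quad')" "[:1, 6:] \<circ>\<^sub>p quad = quad' * quad' + 2 * quad"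
      unfolding quad'2 by (simp_all add: quad_def pcompose_pCons numeral_poly)
    show ?thesis
      by (simp only: y_def pcompose_add pcompose_diff pcompose_mult pcompose_smult a F_def)
  qed
  have F': "pderiv F = quad' * (Q' \<circ>\<^sub>p quad)"
    by (simp add: F_def pderiv_pcompose Q'_def quad'_def mult.commute)
  have F'': "pderiv (pderiv F) = quad' * quad' * (Q'' \<circ>\<^sub>p quad) + 2 * (Q' \<circ>\<^sub>p quad)"
    unfolding F' pderiv_mult pderiv_pcompose Q''_def[symmetric] quad'_def[symmetric] quad'2(2)
    by (rule square_ode_ring_identities)
  have Y: "quad * pderiv (pderiv F) + quad' * pderiv F - smult (2 * N) F = y \<circ>\<^sub>p quad"
    unfolding F'' unfolding F' yq by (rule square_ode_ring_identities)
  have "quad * (y \<circ>\<^sub>p quad) = ([:0, 1:] * y) \<circ>\<^sub>p quad"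
    by (simp add: pcompose_mult pcompose_pCons)
  then have "pderiv (quad * (y \<circ>\<^sub>p quad)) = (pderiv ([:0, 1:] * y) \<circ>\<^sub>p quad) * quad'"
    by (simp only: pderiv_pcompose quad'_def)
  also have "\<dots> = smult (2 * N) (quad * pderiv F)"
    unfolding ode F' pcompose_smult pcompose_mult by (simp add: pcompose_pCons mult_ac)
  finally show ?thesis
    unfolding square_ode_def quad'_def[symmetric] F_def[symmetric] Q_def[symmetric] N_def[symmetric] Y .
qed

text \<open>
  Both sides solve the same third-order equation and have constant term 1.
\<close>
theorem clausen: "legendre_poly n ^ 2 = clausen_poly n \<circ>\<^sub>p quad"
proof (rule square_ode_unique)
  show "square_ode (of_nat n * (of_nat n + 1)) (legendre_poly n ^ 2)"
    by (intro square_ode_square legendre_ode_legendre_poly)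
  show "coeff (legendre_poly n ^ 2) 0 = coeff (clausen_poly n \<circ>\<^sub>p quad) 0"
    by (simp add: power2_eq_square coeff_mult_0 coeff_legendre_poly coeff_pcompose_0 quad_def coeff_clausen_poly poly_0_coeff_0)
qed (rule square_ode_clausen_poly)

section \<open>Moments of the coefficients\<close>

text \<open>
  The recurrence \<open>legendre_coeff_Suc\<close> summed against \<open>t^(k+1)\<close>; equivalently Legendre's equation
  evaluated at \<open>t\<close>.
\<close>
lemma sum_legendre_square:
  "(1 + t) * (\<Sum>k\<le>n. of_nat k ^ 2 * legendre_coeff n k * t ^ k) + t * (\<Sum>k\<le>n. of_nat k * legendre_coeff n k * t ^ k)
    = of_nat n * (of_nat n + 1) * t * (\<Sum>k\<le>n. legendre_coeff n k * t ^ k)"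
proof -
  have "(\<Sum>k\<le>n. of_nat k ^ 2 * legendre_coeff n k * t ^ k) = (\<Sum>k\<le>n. of_nat (Suc k) ^ 2 * legendre_coeff n (Suc k) * t ^ Suc k)"
    by (rule sum_shift) (simp_all add: legendre_coeff_beyond)
  also have "\<dots> = (\<Sum>k\<le>n. t * (of_nat n * (of_nat n + 1) * (legendre_coeff n k * t ^ k)
      - of_nat k ^ 2 * legendre_coeff n k * t ^ k - of_nat k * legendre_coeff n k * t ^ k))"
  proof (intro sum.cong refl)
    fix k
    have "of_nat (Suc k) ^ 2 * legendre_coeff n (Suc k) = (of_nat n * (of_nat n + 1) - of_nat k * (of_nat k + 1)) * legendre_coeff n k"
      using legendre_coeff_Suc[of k n] by (simp add: add.commute)
    then show "of_nat (Suc k) ^ 2 * legendre_coeff n (Suc k) * t ^ Suc k = t * (of_nat n * (of_nat n + 1) * (legendre_coeff n k * t ^ k)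
      - of_nat k ^ 2 * legendre_coeff n k * t ^ k - of_nat k * legendre_coeff n k * t ^ k)"
      by (simp only: power_Suc) (simp add: algebra_simps power2_eq_square)
  qed
  also have "\<dots> = t * (of_nat n * (of_nat n + 1) * (\<Sum>k\<le>n. legendre_coeff n k * t ^ k)
      - (\<Sum>k\<le>n. of_nat k ^ 2 * legendre_coeff n k * t ^ k) - (\<Sum>k\<le>n. of_nat k * legendre_coeff n k * t ^ k))"
    by (simp only: sum_distrib_left sum_subtractf right_diff_distrib)
  finally show ?thesis by Groebner_Basis.algebra
qed

text \<open>
  The integrated form of Legendre's equation: the recurrence divided by \<open>k + 1\<close> before summation.
\<close>
lemma sum_legendre_over_Suc:
  "of_nat n * (of_nat n + 1) * t * (\<Sum>k\<le>n. legendre_coeff n k / (of_nat k + 1) * t ^ k)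
    = (1 + t) * (\<Sum>k\<le>n. of_nat k * legendre_coeff n k * t ^ k)"
proof -
  have nz: "rat_of_nat k + 1 \<noteq> 0" for k using of_nat_neq_0[of k] by (simp add: add.commute)
  have "(\<Sum>k\<le>n. of_nat k * legendre_coeff n k * t ^ k) = (\<Sum>k\<le>n. of_nat (Suc k) * legendre_coeff n (Suc k) * t ^ Suc k)"
    by (rule sum_shift) (simp_all add: legendre_coeff_beyond)
  also have "\<dots> = (\<Sum>k\<le>n. t * (of_nat n * (of_nat n + 1) * (legendre_coeff n k / (of_nat k + 1) * t ^ k)
      - of_nat k * legendre_coeff n k * t ^ k))"
  proof (intro sum.cong refl)
    fix k
    have "(of_nat k + 1) * (of_nat (Suc k) * legendre_coeff n (Suc k)) =
      (of_nat n * (of_nat n + 1) - of_nat k * (of_nat k + 1)) * legendre_coeff n k"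
      using legendre_coeff_Suc[of k n] by (simp add: power2_eq_square algebra_simps)
    then have "of_nat (Suc k) * legendre_coeff n (Suc k) =
      (of_nat n * (of_nat n + 1) - of_nat k * (of_nat k + 1)) * legendre_coeff n k / (of_nat k + 1)"
      using nz[of k] by (simp add: field_simps)
    also have "\<dots> = of_nat n * (of_nat n + 1) * (legendre_coeff n k / (of_nat k + 1)) - of_nat k * legendre_coeff n k"
      using nz[of k] by (simp add: field_simps)
    finally show "of_nat (Suc k) * legendre_coeff n (Suc k) * t ^ Suc k =
      t * (of_nat n * (of_nat n + 1) * (legendre_coeff n k / (of_nat k + 1) * t ^ k) - of_nat k * legendre_coeff n k * t ^ k)"
      by (simp only: power_Suc) (simp add: algebra_simps)
  qed
  also have "\<dots> = t * (of_nat n * (of_nat n + 1) * (\<Sum>k\<le>n. legendre_coeff n k / (of_nat k + 1) * t ^ k)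
      - (\<Sum>k\<le>n. of_nat k * legendre_coeff n k * t ^ k))"
    by (simp only: sum_distrib_left sum_subtractf right_diff_distrib)
  finally show ?thesis by Groebner_Basis.algebra
qed

text \<open>
  The points \<open>1\<close> and \<open>-2\<close> are exchanged by \<open>t \<mapsto> -1 - t\<close>. The operator \<open>t d/dt\<close> brings the factor
  \<open>t\<close> of the second identity.
\<close>
lemma sum_legendre_reflect:
  assumes "even n"
  shows "(\<Sum>k\<le>n. legendre_coeff n k * (-2) ^ k) = (\<Sum>k\<le>n. legendre_coeff n k)"
    and "(\<Sum>k\<le>n. of_nat k * legendre_coeff n k * (-2) ^ k) = 2 * (\<Sum>k\<le>n. of_nat k * legendre_coeff n k)"
proof -
  have "poly (legendre_poly n) (-2) = poly (legendre_poly n \<circ>\<^sub>p [:-1, -1:]) 1"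
    by (simp add: poly_pcompose)
  then have "poly (legendre_poly n) (-2) = poly (legendre_poly n) 1"
    by (simp only: legendre_poly_reflect[OF assms])
  then show "(\<Sum>k\<le>n. legendre_coeff n k * (-2) ^ k) = (\<Sum>k\<le>n. legendre_coeff n k)"
    by (simp add: legendre_poly_def poly_poly_upto)
  have "pderiv (legendre_poly n) = - (pderiv (legendre_poly n) \<circ>\<^sub>p [:-1, -1:])"
    using arg_cong[OF legendre_poly_reflect[OF assms], of pderiv]
    by (simp add: pderiv_pcompose pderiv_pCons)
  from arg_cong[OF this, of "\<lambda>f. poly f 1"]
  have "poly (pderiv (legendre_poly n)) 1 = - poly (pderiv (legendre_poly n)) (-2)"
    by (simp add: poly_pcompose)
  then have "(-2) * poly (pderiv (legendre_poly n)) (-2) = 2 * (1 * poly (pderiv (legendre_poly n)) 1)" by simp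
  then show "(\<Sum>k\<le>n. of_nat k * legendre_coeff n k * (-2) ^ k) = 2 * (\<Sum>k\<le>n. of_nat k * legendre_coeff n k)"
    unfolding legendre_poly_def poly_pderiv_poly_upto by simp
qed

text \<open>
  Clausen's identity and its first two derivatives at \<open>t = 1\<close>. There \<open>t (1 + t)\<close> has value 2, first
  derivative 3 and second derivative 2, whence the factors 3 and 9.
\<close>
lemma clausen_sums:
  defines "M0 n \<equiv> \<Sum>k\<le>n. legendre_coeff n k" and "M1 n \<equiv> \<Sum>k\<le>n. of_nat k * legendre_coeff n k"
    and "M2 n \<equiv> \<Sum>k\<le>n. of_nat k ^ 2 * legendre_coeff n k"
  shows "(\<Sum>k\<le>n. clausen_coeff n k * 2 ^ k) = M0 n ^ 2"
    and "3 * (\<Sum>k\<le>n. of_nat k * clausen_coeff n k * 2 ^ k) = 4 * M0 n * M1 n"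
    and "27 * (\<Sum>k\<le>n. of_nat k ^ 2 * clausen_coeff n k * 2 ^ k) = 24 * M1 n ^ 2 + 24 * M0 n * M2 n - 4 * M0 n * M1 n"
proof -
  define W W' W'' where "W = poly (legendre_poly n) 1" and "W' = poly (pderiv (legendre_poly n)) 1"
    and "W'' = poly (pderiv (pderiv (legendre_poly n))) 1"
  define Q Q' Q'' where "Q = poly (clausen_poly n) 2" and "Q' = poly (pderiv (clausen_poly n)) 2"
    and "Q'' = poly (pderiv (pderiv (clausen_poly n))) 2"
  have M: "M0 n = W" "M1 n = W'" "M2 n = W'' + W'"
    using poly_poly_upto[of "legendre_coeff n" n 1] poly_pderiv_poly_upto[of 1 "legendre_coeff n" n] poly_pderiv2_poly_upto[of 1 "legendre_coeff n" n]
    by (simp_all add: M0_def M1_def M2_def W_def W'_def W''_def legendre_poly_def)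
  have V: "(\<Sum>k\<le>n. clausen_coeff n k * 2 ^ k) = Q" "(\<Sum>k\<le>n. of_nat k * clausen_coeff n k * 2 ^ k) = 2 * Q'"
    "(\<Sum>k\<le>n. of_nat k ^ 2 * clausen_coeff n k * 2 ^ k) = 4 * Q'' + 2 * Q'"
    using poly_poly_upto[of "clausen_coeff n" n 2] poly_pderiv_poly_upto[of 2 "clausen_coeff n" n] poly_pderiv2_poly_upto[of 2 "clausen_coeff n" n]
    by (simp_all add: Q_def Q'_def Q''_def clausen_poly_def)
  have 0: "W ^ 2 = Q"
    using arg_cong[OF clausen[of n], of "\<lambda>f. poly f 1"] by (simp add: poly_pcompose quad_def W_def Q_def)
  have d1: "2 * (legendre_poly n * pderiv (legendre_poly n)) = (pderiv (clausen_poly n) \<circ>\<^sub>p quad) * pderiv quad"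
    using arg_cong[OF clausen[of n], of pderiv] unfolding pderiv_square pderiv_pcompose .
  have 1: "2 * W * W' = 3 * Q'"
    using arg_cong[OF d1, of "\<lambda>f. poly f 1"]
    by (simp add: poly_pcompose pderiv_quad W_def W'_def Q'_def) (simp add: quad_def)
  have d2: "2 * (legendre_poly n * pderiv (pderiv (legendre_poly n)) + pderiv (legendre_poly n) * pderiv (legendre_poly n))
     = (pderiv (clausen_poly n) \<circ>\<^sub>p quad) * pderiv (pderiv quad) + pderiv quad * ((pderiv (pderiv (clausen_poly n)) \<circ>\<^sub>p quad) * pderiv quad)"
  proof -
    have "pderiv (2 :: rat poly) = 0" by (simp add: numeral_poly pderiv_pCons)
    then show ?thesis
      using arg_cong[OF d1, of pderiv] unfolding pderiv_mult pderiv_pcompose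
      by (simp only: mult_zero_right add_0_right)
  qed
  have 2: "2 * W * W'' + 2 * W' ^ 2 = 2 * Q' + 9 * Q''"
    using arg_cong[OF d2, of "\<lambda>f. poly f 1"]
    by (simp add: poly_pcompose pderiv_quad pderiv_pCons W_def W'_def W''_def Q'_def Q''_def power2_eq_square algebra_simps) (simp add: quad_def)
  show "(\<Sum>k\<le>n. clausen_coeff n k * 2 ^ k) = M0 n ^ 2" using V M 0 by simp
  show "3 * (\<Sum>k\<le>n. of_nat k * clausen_coeff n k * 2 ^ k) = 4 * M0 n * M1 n" unfolding V M using 1 by (simp add: mult_ac)
  show "27 * (\<Sum>k\<le>n. of_nat k ^ 2 * clausen_coeff n k * 2 ^ k) = 24 * M1 n ^ 2 + 24 * M0 n * M2 n - 4 * M0 n * M1 n"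
    unfolding V M using 1 2 by (simp add: algebra_simps)
qed

text \<open>
  The recurrence \<open>clausen_coeff_Suc\<close> divided by \<open>k + 1\<close> and by \<open>(k + 1)^2\<close>, summed against \<open>2^(k+1)\<close>.
\<close>
lemma sum_clausen_over_Suc:
  fixes n :: nat
  defines "N \<equiv> of_nat n * (of_nat n + 1) :: rat"
    and "V0 \<equiv> \<Sum>k\<le>n. clausen_coeff n k * 2 ^ k" and "V1 \<equiv> \<Sum>k\<le>n. of_nat k * clausen_coeff n k * 2 ^ k"
    and "V2 \<equiv> \<Sum>k\<le>n. of_nat k ^ 2 * clausen_coeff n k * 2 ^ k"
    and "Y1 \<equiv> \<Sum>k\<le>n. clausen_coeff n k / (of_nat k + 1) * 2 ^ k"
    and "Y2 \<equiv> \<Sum>k\<le>n. clausen_coeff n k / (of_nat k + 1) ^ 2 * 2 ^ k"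
  shows "4 * N * Y1 = 8 * N * V0 - 9 * V2 - 4 * V1"
    and "V1 = 8 * N * Y1 - 4 * N * Y2 - 8 * V1 + 4 * V0 - 4 * Y1"
proof -
  have nz: "rat_of_nat k + 1 \<noteq> 0" for k using of_nat_neq_0[of k] by (simp add: add.commute)
  have step: "(of_nat k + 1) ^ 3 * clausen_coeff n (Suc k) = 2 * (2 * of_nat k + 1) * (N - of_nat k * (of_nat k + 1)) * clausen_coeff n k" for k
    unfolding N_def by (rule clausen_coeff_Suc)
  have "V2 = (\<Sum>k\<le>n. of_nat (Suc k) ^ 2 * clausen_coeff n (Suc k) * 2 ^ Suc k)"
    unfolding V2_def by (rule sum_shift) (simp_all add: clausen_coeff_beyond)
  also have "\<dots> = (\<Sum>k\<le>n. 8 * N * (clausen_coeff n k * 2 ^ k) - 4 * N * (clausen_coeff n k / (of_nat k + 1) * 2 ^ k)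
      - 8 * (of_nat k ^ 2 * clausen_coeff n k * 2 ^ k) - 4 * (of_nat k * clausen_coeff n k * 2 ^ k))"
  proof (intro sum.cong refl)
    fix k
    define K where "K = rat_of_nat k + 1"
    have K: "K \<noteq> 0" "rat_of_nat k = K - 1" "of_nat (Suc k) = K" using nz[of k] by (simp_all add: K_def)
    have "K * (of_nat (Suc k) ^ 2 * clausen_coeff n (Suc k)) = 2 * (2 * K - 1) * (N - (K - 1) * K) * clausen_coeff n k"
      using step[of k] unfolding K by (simp add: power3_eq_cube power2_eq_square algebra_simps)
    then have "of_nat (Suc k) ^ 2 * clausen_coeff n (Suc k) = 2 * (2 * K - 1) * (N - (K - 1) * K) * clausen_coeff n k / K"
      using K(1) by (simp add: field_simps)
    also have "\<dots> = 4 * N * clausen_coeff n k - 2 * N * (clausen_coeff n k / K) - 4 * ((K - 1) ^ 2 * clausen_coeff n k) - 2 * ((K - 1) * clausen_coeff n k)"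
      using K(1) by (simp add: field_simps power2_eq_square)
    finally show "of_nat (Suc k) ^ 2 * clausen_coeff n (Suc k) * 2 ^ Suc k =
        8 * N * (clausen_coeff n k * 2 ^ k) - 4 * N * (clausen_coeff n k / (of_nat k + 1) * 2 ^ k)
        - 8 * (of_nat k ^ 2 * clausen_coeff n k * 2 ^ k) - 4 * (of_nat k * clausen_coeff n k * 2 ^ k)"
      unfolding K K_def[symmetric] by (simp only: power_Suc) (simp add: algebra_simps)
  qed
  also have "\<dots> = 8 * N * V0 - 4 * N * Y1 - 8 * V2 - 4 * V1"
    unfolding V0_def V1_def V2_def Y1_def by (simp only: sum_subtractf sum_distrib_left)
  finally show "4 * N * Y1 = 8 * N * V0 - 9 * V2 - 4 * V1" by simp
  have "V1 = (\<Sum>k\<le>n. of_nat (Suc k) * clausen_coeff n (Suc k) * 2 ^ Suc k)"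
    unfolding V1_def by (rule sum_shift) (simp_all add: clausen_coeff_beyond)
  also have "\<dots> = (\<Sum>k\<le>n. 8 * N * (clausen_coeff n k / (of_nat k + 1) * 2 ^ k) - 4 * N * (clausen_coeff n k / (of_nat k + 1) ^ 2 * 2 ^ k)
      - 8 * (of_nat k * clausen_coeff n k * 2 ^ k) + 4 * (clausen_coeff n k * 2 ^ k) - 4 * (clausen_coeff n k / (of_nat k + 1) * 2 ^ k))"
  proof (intro sum.cong refl)
    fix k
    define K where "K = rat_of_nat k + 1"
    have K: "K \<noteq> 0" "rat_of_nat k = K - 1" "of_nat (Suc k) = K" using nz[of k] by (simp_all add: K_def)
    have "K ^ 2 * (of_nat (Suc k) * clausen_coeff n (Suc k)) = 2 * (2 * K - 1) * (N - (K - 1) * K) * clausen_coeff n k"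
      using step[of k] unfolding K by (simp add: power3_eq_cube power2_eq_square algebra_simps)
    then have "of_nat (Suc k) * clausen_coeff n (Suc k) = 2 * (2 * K - 1) * (N - (K - 1) * K) * clausen_coeff n k / K ^ 2"
      using K(1) by (simp add: field_simps)
    also have "\<dots> = 4 * N * (clausen_coeff n k / K) - 2 * N * (clausen_coeff n k / K ^ 2) - 4 * ((K - 1) * clausen_coeff n k) + 2 * clausen_coeff n k - 2 * (clausen_coeff n k / K)"
      using K(1) by (simp add: field_simps power2_eq_square)
    finally show "of_nat (Suc k) * clausen_coeff n (Suc k) * 2 ^ Suc k =
        8 * N * (clausen_coeff n k / (of_nat k + 1) * 2 ^ k) - 4 * N * (clausen_coeff n k / (of_nat k + 1) ^ 2 * 2 ^ k)
      - 8 * (of_nat k * clausen_coeff n k * 2 ^ k) + 4 * (clausen_coeff n k * 2 ^ k) - 4 * (clausen_coeff n k / (of_nat k + 1) * 2 ^ k)"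
      unfolding K K_def[symmetric] by (simp only: power_Suc) (simp add: algebra_simps)
  qed
  also have "\<dots> = 8 * N * Y1 - 4 * N * Y2 - 8 * V1 + 4 * V0 - 4 * Y1"
    unfolding V0_def V1_def Y2_def Y1_def by (simp only: sum_subtractf sum.distrib sum_distrib_left)
  finally show "V1 = 8 * N * Y1 - 4 * N * Y2 - 8 * V1 + 4 * V0 - 4 * Y1" .
qed

section \<open>Delannoy numbers as Taylor coefficients\<close>

unbundle fps_syntax

text \<open>
  The coefficient of \<open>z^k\<close> is the Delannoy number \<open>D(n,k)\<close>.
\<close>
definition delannoy_fps :: "nat \<Rightarrow> rat fps" where
  "delannoy_fps n = (1 + fps_X) ^ n * inverse (1 - fps_X) ^ (n + 1)"

lemma geom: "(1 - fps_X) * inverse (1 - fps_X) = (1 :: rat fps)"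
  by (rule inverse_mult_eq_1') simp

lemma deriv_geom_power:
  "(1 - fps_X) * fps_deriv (inverse (1 - fps_X) ^ k) = of_nat k * inverse (1 - fps_X :: rat fps) ^ k"
proof (cases k)
  case (Suc j)
  define g where "g = inverse (1 - fps_X :: rat fps)"
  have "fps_deriv g = g * g"
    unfolding g_def by (subst fps_inverse_deriv) (simp_all add: power2_eq_square)
  then have "(1 - fps_X) * fps_deriv (g ^ k) = of_nat k * (((1 - fps_X) * g) * (g * g ^ j))"
    unfolding fps_deriv_power fps_of_nat Suc by (simp add: algebra_simps)
  then show ?thesis using geom by (simp add: g_def Suc)
qed simp

lemma deriv_linear_power:
  "(1 + fps_X) * fps_deriv ((1 + fps_X) ^ k) = of_nat k * (1 + fps_X :: rat fps) ^ k"
proof (cases k)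
  case (Suc j)
  then show ?thesis unfolding fps_deriv_power fps_of_nat by (simp add: algebra_simps)
qed simp

lemma nth_geom_power: "inverse (1 - fps_X :: rat fps) ^ (n + 1) $ k = of_nat ((n + k) choose k)"
proof (induction k)
  case 0 show ?case by (simp add: fps_nth_power_0)
next
  case (Suc k)
  define h where "h = inverse (1 - fps_X :: rat fps) ^ (n + 1)"
  have "((1 - fps_X) * fps_deriv h) $ k = (of_nat (n + 1) * h) $ k"
    unfolding h_def by (simp only: deriv_geom_power)
  then have "(of_nat k + 1) * h $ (Suc k) = (of_nat n + of_nat k + 1) * h $ k"
    by (cases k) (simp_all add: left_diff_distrib algebra_simps fps_mult_of_nat_nth)
  also have "\<dots> = (of_nat k + 1) * of_nat ((n + Suc k) choose Suc k)"
    unfolding rat_binomial_diag_Suc using Suc by (simp add: h_def)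
  finally have "rat_of_nat k + 1 = 0 \<or> h $ (Suc k) = of_nat ((n + Suc k) choose Suc k)"
    by (simp only: mult_cancel_left)
  moreover have "rat_of_nat k + 1 \<noteq> 0" using of_nat_neq_0[of k] by (simp add: add.commute)
  ultimately show ?case by (simp add: h_def)
qed

lemma nth_linear_power: "(1 + fps_X :: rat fps) ^ n $ k = of_nat (n choose k)"
proof (induction k)
  case 0 show ?case by (simp add: fps_nth_power_0)
next
  case (Suc k)
  define h where "h = (1 + fps_X :: rat fps) ^ n"
  have "((1 + fps_X) * fps_deriv h) $ k = (of_nat n * h) $ k"
    unfolding h_def by (simp only: deriv_linear_power)
  then have "(of_nat k + 1) * h $ (Suc k) = (of_nat n - of_nat k) * h $ k"
    by (cases k) (simp_all add: distrib_right algebra_simps fps_mult_of_nat_nth)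
  also have "\<dots> = (of_nat k + 1) * of_nat (n choose Suc k)"
    unfolding rat_binomial_Suc using Suc by (simp add: h_def)
  finally have "rat_of_nat k + 1 = 0 \<or> h $ (Suc k) = of_nat (n choose Suc k)"
    by (simp only: mult_cancel_left)
  moreover have "rat_of_nat k + 1 \<noteq> 0" using of_nat_neq_0[of k] by (simp add: add.commute)
  ultimately show ?case by (simp add: h_def)
qed

lemma delannoy_0: "delannoy_fps n $ 0 = 1"
  by (simp add: delannoy_fps_def fps_nth_power_0)

text \<open>
  The logarithmic derivative of the series is \<open>n / (1 + z) + (n + 1) / (1 - z)\<close>, that is
  \<open>(2 n + 1 + z) / (1 - z^2)\<close>. For \<open>2 n + 1 = p\<close> the first term of the recurrence is small.
\<close>
lemma delannoy_Suc:
  "(of_nat k + 1) * delannoy_fps n $ Suc k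
    = (2 * of_nat n + 1) * delannoy_fps n $ k + (if k = 0 then 0 else of_nat k * delannoy_fps n $ (k - 1))"
proof -
  define g h where "g = (1 + fps_X :: rat fps) ^ n" and "h = inverse (1 - fps_X :: rat fps) ^ (n + 1)"
  have F: "delannoy_fps n = g * h" by (simp add: delannoy_fps_def g_def h_def)
  have "(1 - fps_X) * (1 + fps_X) * fps_deriv (delannoy_fps n)
     = (1 + fps_X) * g * ((1 - fps_X) * fps_deriv h) + (1 - fps_X) * h * ((1 + fps_X) * fps_deriv g)"
    unfolding F fps_deriv_mult by (simp add: algebra_simps)
  also have "\<dots> = (1 + fps_X) * g * (of_nat (n + 1) * h) + (1 - fps_X) * h * (of_nat n * g)"
    unfolding g_def h_def deriv_geom_power deriv_linear_power ..
  also have "\<dots> = (of_nat (2 * n + 1) + fps_X) * delannoy_fps n"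
    unfolding F by (simp add: algebra_simps)
  finally have e: "fps_deriv (delannoy_fps n) - fps_X * (fps_X * fps_deriv (delannoy_fps n))
     = of_nat (2 * n + 1) * delannoy_fps n + fps_X * delannoy_fps n"
    by (simp add: algebra_simps)
  define M where "M = 2 * n + 1"
  have "(fps_deriv (delannoy_fps n) - fps_X * (fps_X * fps_deriv (delannoy_fps n))) $ k
     = (of_nat M * delannoy_fps n + fps_X * delannoy_fps n) $ k"
    unfolding e M_def ..
  then have "(of_nat k + 1) * delannoy_fps n $ Suc k
    = of_nat M * delannoy_fps n $ k + (if k = 0 then 0 else of_nat k * delannoy_fps n $ (k - 1))"
  proof (cases k)
    case (Suc j)
    then show ?thesis
      using \<open>_ $ k = _ $ k\<close> by (cases j) (simp_all add: algebra_simps)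
  qed (simp add: algebra_simps)
  then show ?thesis by (simp add: M_def)
qed

text \<open>
  The sum is the convolution of the coefficients of the two factors of the series.
\<close>
lemma sum_legendre_delannoy: "(\<Sum>k\<le>n. legendre_coeff n k) = delannoy_fps n $ n"
proof -
  have "delannoy_fps n $ n = (inverse (1 - fps_X) ^ (n + 1) * (1 + fps_X) ^ n) $ n"
    by (simp add: delannoy_fps_def mult.commute)
  also have "\<dots> = (\<Sum>k\<le>n. of_nat ((n + k) choose k) * of_nat (n choose (n - k)))"
    unfolding fps_mult_nth nth_geom_power nth_linear_power by (simp add: atLeast0AtMost)
  also have "\<dots> = (\<Sum>k\<le>n. legendre_coeff n k)"
    by (intro sum.cong refl) (simp add: legendre_coeff_def binomial_symmetric[symmetric])
  finally show ?thesis by simp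
qed

text \<open>
  The weight \<open>k\<close> differentiates the factor \<open>h = (1 - z)^(-n-1)\<close>, and \<open>z h' = (n + 1) z h / (1 - z)\<close>;
  division by \<open>1 - z\<close> forms partial sums.
\<close>
lemma sum_k_legendre_delannoy: assumes "n > 0"
  shows "(\<Sum>k\<le>n. of_nat k * legendre_coeff n k) = (of_nat n + 1) * (\<Sum>i<n. delannoy_fps n $ i)"
proof -
  define g h where "g = (1 + fps_X :: rat fps) ^ n" and "h = inverse (1 - fps_X :: rat fps) ^ (n + 1)"
  define G where "G = inverse (1 - fps_X :: rat fps)"
  have F: "delannoy_fps n = g * h" by (simp add: delannoy_fps_def g_def h_def)
  obtain n' where n': "n = Suc n'" using assms by (cases n) auto
  have "fps_deriv h = of_nat (n + 1) * (G * h)"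
  proof -
    have "G * ((1 - fps_X) * fps_deriv h) = G * (of_nat (n + 1) * h)"
      unfolding h_def deriv_geom_power ..
    moreover have "G * ((1 - fps_X) * fps_deriv h) = ((1 - fps_X) * G) * fps_deriv h" by (simp only: mult_ac)
    ultimately show ?thesis using geom by (simp add: G_def mult_ac)
  qed
  then have e: "(fps_X * fps_deriv h) * g = of_nat (n + 1) * (fps_X * (G * delannoy_fps n))"
    unfolding F by (simp only: mult_ac)
  have part: "(G * f) $ k = (\<Sum>i\<le>k. f $ i)" for f k
  proof -
    have "G $ i = 1" for i using nth_geom_power[of 0 i] by (simp add: G_def)
    then have "(f * G) $ k = (\<Sum>i\<le>k. f $ i)" by (simp add: fps_mult_nth atLeast0AtMost)
    then show ?thesis by (simp add: mult.commute)
  qed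
  have "(\<Sum>k\<le>n. of_nat k * legendre_coeff n k) = (\<Sum>k\<le>n. (fps_X * fps_deriv h) $ k * g $ (n - k))"
  proof (intro sum.cong refl)
    fix k assume "k \<in> {..n}"
    have "(fps_X * fps_deriv h) $ k = of_nat k * of_nat ((n + k) choose k)"
      using nth_geom_power[of n k, folded h_def] by (cases k) (simp_all del: binomial_Suc_Suc)
    then show "of_nat k * legendre_coeff n k = (fps_X * fps_deriv h) $ k * g $ (n - k)"
      using \<open>k \<in> {..n}\<close> unfolding g_def nth_linear_power by (simp add: legendre_coeff_def binomial_symmetric[symmetric])
  qed
  also have "\<dots> = ((fps_X * fps_deriv h) * g) $ n"
    unfolding fps_mult_nth by (simp add: atLeast0AtMost)
  also have "\<dots> = (of_nat n + 1) * (\<Sum>i<n. delannoy_fps n $ i)"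
    unfolding e fps_mult_of_nat_nth(1) by (simp add: n' part lessThan_Suc_atMost)
  finally show ?thesis .
qed

section \<open>Central binomial coefficients and an alternating sum\<close>

text \<open>
  The coefficients of \<open>(1 - z)^(-1/2)\<close>.
\<close>
definition cbin :: "nat \<Rightarrow> rat" where "cbin i = of_nat ((2 * i) choose i) / 4 ^ i"

lemma cbin_0 [simp]: "cbin 0 = 1" by (simp add: cbin_def)

lemma cbin_Suc: "2 * (of_nat i + 1) * cbin (Suc i) = (2 * of_nat i + 1) * cbin i"
proof -
  have "2 * (of_nat i + 1) * cbin (Suc i) = 2 * ((of_nat i + 1) * of_nat ((2 * Suc i) choose Suc i)) / (4 * 4 ^ i)"
    unfolding cbin_def power_Suc by (simp add: field_simps del: binomial_Suc_Suc mult_Suc_right)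
  also have "\<dots> = (2 * of_nat i + 1) * cbin i"
    unfolding rat_central_binomial_Suc cbin_def by (simp add: field_simps)
  finally show ?thesis .
qed

text \<open>
  The partial sums are the coefficients of \<open>(1 - z)^(-3/2)\<close>, a multiple of the derivative.
\<close>
lemma sum_cbin: "(\<Sum>i<k. cbin i) = 2 * of_nat k * cbin k"
proof (induction k)
  case (Suc k)
  then show ?case using cbin_Suc[of k] by (simp add: algebra_simps)
qed simp

text \<open>
  The coefficient of \<open>z^(2i+1)\<close> in \<open>(1 - z^2)^(-1/2) artanh z\<close>.
\<close>
definition cbin_log :: "nat \<Rightarrow> rat" where
  "cbin_log i = (\<Sum>l\<le>i. cbin l / (2 * of_nat (i - l) + 1))"

lemma odd_nonzero: "2 * rat_of_nat k + 1 \<noteq> 0"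
  using of_nat_neq_0[of "2 * k", where 'a = rat] by (simp add: add.commute)

text \<open>
  The series \<open>F = (1 - z^2)^(-1/2) artanh z\<close> satisfies \<open>(1 - z^2) F' = z F + (1 - z^2)^(-1/2)\<close>; here the
  coefficients are compared.
\<close>
lemma cbin_log_Suc: "(2 * of_nat i + 3) * cbin_log (Suc i) = cbin (Suc i) + (2 * of_nat i + 2) * cbin_log i"
proof -
  define g where "g j l = cbin l / (2 * of_nat (j - l) + 1)" for j l :: nat
  have G: "cbin_log j = (\<Sum>l\<le>j. g j l)" for j by (simp add: cbin_log_def g_def)
  have *: "(2 * of_nat j + 1) * g j l = 2 * of_nat l * g j l + cbin l" if "l \<le> j" for j l
    using that odd_nonzero[of "j - l"] by (simp add: g_def of_nat_diff field_simps)
  have "(2 * of_nat (Suc i) + 1) * cbin_log (Suc i) = (\<Sum>l\<le>Suc i. 2 * of_nat l * g (Suc i) l + cbin l)"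
    unfolding G sum_distrib_left by (intro sum.cong refl *) auto
  also have "\<dots> = (\<Sum>l\<le>Suc i. 2 * of_nat l * g (Suc i) l) + (\<Sum>l\<le>Suc i. cbin l)"
    by (rule sum.distrib)
  also have "(\<Sum>l\<le>Suc i. 2 * of_nat l * g (Suc i) l) = (\<Sum>l\<le>i. 2 * of_nat (Suc l) * g (Suc i) (Suc l))"
    by (subst sum.atMost_Suc_shift) simp
  also have "\<dots> = (\<Sum>l\<le>i. (2 * of_nat i + 2) * g i l - cbin l)"
  proof (intro sum.cong refl)
    fix l assume "l \<in> {..i}"
    then have l: "l \<le> i" by simp
    have "2 * of_nat (Suc l) * g (Suc i) (Suc l) = (2 * (of_nat l + 1) * cbin (Suc l)) / (2 * of_nat (i - l) + 1)"
      by (simp add: g_def add.commute)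
    also have "\<dots> = (2 * of_nat l + 1) * g i l"
      unfolding cbin_Suc by (simp add: g_def)
    also have "\<dots> = (2 * of_nat i + 2) * g i l - cbin l"
      using *[OF l] by (simp add: algebra_simps)
    finally show "2 * of_nat (Suc l) * g (Suc i) (Suc l) = (2 * of_nat i + 2) * g i l - cbin l" .
  qed
  also have "\<dots> = (2 * of_nat i + 2) * cbin_log i - (\<Sum>l\<le>i. cbin l)"
    unfolding G by (simp only: sum_subtractf sum_distrib_left)
  finally show ?thesis by (simp add: algebra_simps)
qed

text \<open>
  Summation of the convolution over a triangle, in which the sums of \<open>cbin\<close> are known.
\<close>
lemma sum_cbin_log:
  "(\<Sum>i<k. cbin_log i) = (\<Sum>l<k. (2 * of_nat l + 1) * cbin l / (2 * of_nat (k - Suc l) + 1))"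
proof -
  define f where "f l r = cbin l / (2 * of_nat r + 1)" for l r :: nat
  have "(\<Sum>i<k. cbin_log i) = (\<Sum>i<k. \<Sum>l\<le>i. f l (i - l))"
    by (simp add: cbin_log_def f_def)
  also have "\<dots> = (\<Sum>(l, r)\<in>{(l, r). l + r < k}. f l r)"
    by (rule sum.triangle_reindex[symmetric])
  also have "{(l, r). l + r < k} = (\<lambda>(r, l). (l, r)) ` (SIGMA r:{..<k}. {..<k - r})"
    by (auto simp: image_iff)
  also have "(\<Sum>(l, r)\<in>\<dots>. f l r) = (\<Sum>(r, l)\<in>(SIGMA r:{..<k}. {..<k - r}). f l r)"
    by (subst sum.reindex) (auto simp: inj_on_def case_prod_unfold)
  also have "\<dots> = (\<Sum>r<k. \<Sum>l<k - r. f l r)"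
    by (subst sum.Sigma) auto
  also have "\<dots> = (\<Sum>r<k. (2 * of_nat (k - Suc r) + 1) * cbin (k - Suc r) / (2 * of_nat r + 1))"
  proof (intro sum.cong refl)
    fix r assume "r \<in> {..<k}"
    then have r: "k - r = Suc (k - Suc r)" by auto
    have "(\<Sum>l<k - r. f l r) = (\<Sum>l<k - r. cbin l) / (2 * of_nat r + 1)"
      by (simp add: f_def sum_divide_distrib)
    also have "(\<Sum>l<k - r. cbin l) = (2 * of_nat (k - Suc r) + 1) * cbin (k - Suc r)"
      unfolding sum_cbin r cbin_Suc[symmetric] by simp
    finally show "(\<Sum>l<k - r. f l r) = (2 * of_nat (k - Suc r) + 1) * cbin (k - Suc r) / (2 * of_nat r + 1)" .
  qed
  also have "\<dots> = (\<Sum>l<k. (2 * of_nat l + 1) * cbin l / (2 * of_nat (k - Suc l) + 1))"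
    by (subst sum.nat_diff_reindex[symmetric]) (auto intro!: sum.cong)
  finally show ?thesis .
qed

text \<open>
  The partial fraction expansion of \<open>1 / (x (x - 2) \<dots> (x - 2 N))\<close>. Pascal's rule writes the sum for
  \<open>N + 1\<close> as a difference of two shifted sums for \<open>N\<close>.
\<close>
lemma binomial_partial_fractions:
  fixes x :: rat
  assumes "\<And>i. i \<le> N \<Longrightarrow> x \<noteq> 2 * of_nat i"
  shows "(\<Sum>i\<le>N. (-1) ^ i * of_nat (N choose i) / (x - 2 * of_nat i)) * (\<Prod>i\<le>N. x - 2 * of_nat i) = (-2) ^ N * fact N"
  using assms
proof (induction N arbitrary: x)
  case 0 then show ?case by simp
next
  case (Suc N)
  define S where "S x = (\<Sum>i\<le>N. (-1) ^ i * of_nat (N choose i) / (x - 2 * of_nat i))" for x :: rat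
  define P where "P x = (\<Prod>i\<le>N. x - 2 * of_nat i)" for x :: rat
  have "(\<Sum>i\<le>Suc N. (-1) ^ i * of_nat (Suc N choose i) / (x - 2 * of_nat i)) =
    1 / x + (\<Sum>i\<le>N. (-1) ^ Suc i * of_nat (Suc N choose Suc i) / (x - 2 * of_nat (Suc i)))"
    by (subst sum.atMost_Suc_shift) simp
  also have "\<dots> = 1 / x + (\<Sum>i\<le>N. (-1) ^ Suc i * of_nat (N choose Suc i) / (x - 2 * of_nat (Suc i)))
      - (\<Sum>i\<le>N. (-1) ^ i * of_nat (N choose i) / ((x - 2) - 2 * of_nat i))"
  proof -
    have "(-1) ^ Suc i * of_nat (Suc N choose Suc i) / (x - 2 * of_nat (Suc i))
        = (-1) ^ Suc i * of_nat (N choose Suc i) / (x - 2 * of_nat (Suc i))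
        - (-1) ^ i * of_nat (N choose i) / ((x - 2) - 2 * of_nat i)" for i
    proof -
      have "x - 2 * of_nat (Suc i) = (x - 2) - 2 * of_nat i" by simp
      then show ?thesis
        unfolding binomial_Suc_Suc of_nat_add
        by (simp only: diff_divide_distrib[symmetric]) (simp add: algebra_simps)
    qed
    then show ?thesis by (simp only: sum_subtractf)
  qed
  also have "1 / x + (\<Sum>i\<le>N. (-1) ^ Suc i * of_nat (N choose Suc i) / (x - 2 * of_nat (Suc i))) =
     (\<Sum>i\<le>Suc N. (-1) ^ i * of_nat (N choose i) / (x - 2 * of_nat i))"
    by (subst sum.atMost_Suc_shift) simp
  also have "\<dots> = S x" by (simp add: S_def binomial_eq_0)
  finally have e: "(\<Sum>i\<le>Suc N. (-1) ^ i * of_nat (Suc N choose i) / (x - 2 * of_nat i)) = S x - S (x - 2)"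
    by (simp add: S_def)
  have P1: "(\<Prod>i\<le>Suc N. x - 2 * of_nat i) = P x * (x - 2 * of_nat (Suc N))" by (simp add: P_def)
  have P2: "(\<Prod>i\<le>Suc N. x - 2 * of_nat i) = x * P (x - 2)"
    unfolding P_def by (subst prod.atMost_Suc_shift) (simp add: algebra_simps)
  have i1: "S x * P x = (-2) ^ N * fact N"
    unfolding S_def P_def by (rule Suc.IH) (use Suc.prems in auto)
  have i2: "S (x - 2) * P (x - 2) = (-2) ^ N * fact N"
    unfolding S_def P_def
  proof (rule Suc.IH)
    fix i assume "i \<le> N" then show "x - 2 \<noteq> 2 * of_nat i" using Suc.prems[of "Suc i"] by (auto simp: algebra_simps)
  qed
  have "(S x - S (x - 2)) * (\<Prod>i\<le>Suc N. x - 2 * of_nat i) = (S x * P x) * (x - 2 * of_nat (Suc N)) - x * (S (x - 2) * P (x - 2))"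
    unfolding left_diff_distrib by (subst P1, subst P2) (simp only: mult_ac)
  also have "\<dots> = (-2) ^ Suc N * fact (Suc N)"
    unfolding i1 i2 by (simp add: algebra_simps)
  finally show ?case unfolding e .
qed

lemma prod_odd: "(\<Prod>j<k. 2 * rat_of_nat j + 1) * (2 ^ k * fact k) = fact (2 * k)"
proof (induction k)
  case (Suc k)
  have "(\<Prod>j<Suc k. 2 * rat_of_nat j + 1) * (2 ^ Suc k * fact (Suc k))
      = ((\<Prod>j<k. 2 * rat_of_nat j + 1) * (2 ^ k * fact k)) * ((2 * of_nat k + 1) * (2 * (of_nat k + 1)))"
    by (simp add: algebra_simps)
  also have "\<dots> = fact (2 * Suc k)" unfolding Suc by (simp add: algebra_simps)
  finally show ?case .
qed simp

text \<open>
  At \<open>x = N = 2 k - 1\<close> the terms \<open>i\<close> and \<open>N - i\<close> of the partial fraction expansion coincide, so the sum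
  over \<open>i < k\<close> is half of the full sum; the product of the \<open>N - 2 i\<close> is \<open>(-1)^k\<close> times the square of an odd double
  factorial.
\<close>
lemma alternating_half_sum:
  assumes "k > 0"
  shows "8 * of_nat k * of_nat ((2 * k) choose k) * (\<Sum>l<k. (-1) ^ l * of_nat ((2 * k - 1) choose l) / (2 * of_nat (k - Suc l) + 1))
     = - ((-1) ^ k * 16 ^ k :: rat)"
proof -
  define N where "N = 2 * k - 1"
  have N: "rat_of_nat N = 2 * of_nat k - 1" "{..N} = {..<k} \<union> {k..<2 * k}" "odd N"
    using assms by (auto simp: N_def of_nat_diff)
  define s where "s = (\<Sum>l<k. (-1) ^ l * of_nat (N choose l) / (2 * rat_of_nat (k - Suc l) + 1))"
  define g where "g i = (-1) ^ i * of_nat (N choose i) / (of_nat N - 2 * rat_of_nat i)" for i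
  have den: "2 * rat_of_nat (k - Suc l) + 1 = of_nat N - 2 * of_nat l" if "l < k" for l
    using that assms by (simp add: N_def of_nat_diff)
  have g1: "(\<Sum>i<k. g i) = s" unfolding s_def g_def by (rule sum.cong[OF refl], subst den) simp_all
  have bij: "bij_betw (\<lambda>i. N - i) {..<k} {k..<2 * k}"
    using assms by (intro bij_betwI[of _ _ _ "\<lambda>i. N - i"]) (auto simp: N_def)
  have "(\<Sum>i\<in>{k..<2 * k}. g i) = (\<Sum>i<k. g (N - i))" by (rule sum.reindex_bij_betw[OF bij, symmetric])
  also have "\<dots> = (\<Sum>i<k. g i)"
  proof (intro sum.cong refl)
    fix i assume "i \<in> {..<k}"
    then have i: "i \<le> N" using assms by (simp add: N_def)
    have "(-1 :: rat) ^ (N - i) = - ((-1) ^ i)" using i N(3) by (auto simp: minus_one_power_iff)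
    moreover have "rat_of_nat N - 2 * rat_of_nat (N - i) = - (of_nat N - 2 * of_nat i)" using i by (simp add: of_nat_diff)
    ultimately show "g (N - i) = g i" unfolding g_def binomial_symmetric[OF i, symmetric] by (simp only: minus_divide_divide mult_minus_left)
  qed
  finally have 1: "(\<Sum>i\<le>N. g i) = 2 * s"
    unfolding N(2) using g1 by (subst sum.union_disjoint) auto
  define P where "P = (\<Prod>j<k. 2 * rat_of_nat j + 1)"
  have f1: "(\<Prod>i<k. of_nat N - 2 * rat_of_nat i) = P"
  proof -
    have "(\<Prod>i<k. of_nat N - 2 * rat_of_nat i) = (\<Prod>i<k. 2 * rat_of_nat (k - Suc i) + 1)"
      by (rule prod.cong[OF refl], subst den) simp_all
    also have "\<dots> = P" unfolding P_def by (rule prod.nat_diff_reindex)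
    finally show ?thesis .
  qed
  have "(\<Prod>i\<in>{k..<2 * k}. of_nat N - 2 * rat_of_nat i) = (\<Prod>i<k. of_nat N - 2 * rat_of_nat (N - i))"
    by (rule prod.reindex_bij_betw[OF bij, symmetric])
  also have "\<dots> = (\<Prod>i<k. - 1 * (of_nat N - 2 * rat_of_nat i))"
  proof (intro prod.cong refl)
    fix i assume "i \<in> {..<k}"
    then have "i \<le> N" using assms by (simp add: N_def)
    then show "of_nat N - 2 * rat_of_nat (N - i) = - 1 * (of_nat N - 2 * of_nat i)" by (simp add: of_nat_diff)
  qed
  also have "\<dots> = (-1) ^ k * P" unfolding prod.distrib f1 by simp
  finally have 2: "(\<Prod>i\<le>N. of_nat N - 2 * rat_of_nat i) = (-1) ^ k * P ^ 2"
    unfolding N(2) using f1 by (subst prod.union_disjoint) (auto simp: power2_eq_square)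
  have "(\<Sum>i\<le>N. g i) * (\<Prod>i\<le>N. of_nat N - 2 * rat_of_nat i) = (-2) ^ N * fact N"
    unfolding g_def
  proof (rule binomial_partial_fractions)
    fix i have "N \<noteq> 2 * i" using N(3) by auto
    then show "rat_of_nat N \<noteq> 2 * of_nat i" by (metis of_nat_eq_iff of_nat_mult of_nat_numeral)
  qed
  then have 3: "2 * s * ((-1) ^ k * P ^ 2) = - (2 ^ N * fact N)"
    unfolding 1 2 using N(3) by simp
  (* The rest eliminates N and the odd double factorial P in favour of C(2k,k). *)
  have 4: "2 * 2 ^ N = (4 :: rat) ^ k" "2 * of_nat k * fact N = (fact (2 * k) :: rat)"
  proof -
    have "2 * k = Suc N" using assms by (simp add: N_def)
    then show "2 * 2 ^ N = (4 :: rat) ^ k" using power_mult[of "2::rat" 2 k] by simp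
    show "2 * of_nat k * fact N = (fact (2 * k) :: rat)"
      unfolding \<open>2 * k = Suc N\<close> fact_Suc using \<open>2 * k = Suc N\<close> by (metis of_nat_mult of_nat_numeral)
  qed
  define F where "F = (fact (2 * k) :: rat)"
  define f where "f = (fact k :: rat)"
  have F0: "F \<noteq> 0" "f \<noteq> 0" by (simp_all add: F_def f_def)
  have b: "rat_of_nat ((2 * k) choose k) = F / f ^ 2"
    unfolding F_def f_def by (subst binomial_fact) (simp_all add: power2_eq_square mult_2)
  have P: "P * (2 ^ k * f) = F" unfolding P_def F_def f_def by (rule prod_odd)
  have pk: "(2::rat) ^ k \<noteq> 0" "(4::rat) ^ k = 2 ^ k * 2 ^ k" "(16::rat) ^ k = (2 ^ k) ^ 4"
    by (simp_all add: power_mult_distrib[symmetric] power_mult[symmetric] mult.commute[of k 4], simp add: power_mult)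
  have "P = F / (2 ^ k * f)" using P F0 pk(1) by (simp add: field_simps)
  then have P2: "P ^ 2 * (2 ^ k) ^ 2 * f ^ 2 = F ^ 2" using F0 pk(1) by (simp add: power_divide power_mult_distrib)
  define T where "T = (2 :: rat) ^ k"
  define e where "e = (-1 :: rat) ^ k"
  have e2: "e * e = 1" by (simp add: e_def power_mult_distrib[symmetric])
  have "2 * s * (e * P ^ 2) * (2 * (2 * of_nat k)) = - ((2 * 2 ^ N) * (2 * of_nat k * fact N))"
    using 3 by (simp add: e_def)
  then have 5: "2 * s * (e * P ^ 2) * (2 * (2 * of_nat k)) = - (T * T * F)"
    unfolding 4 unfolding pk(2) T_def F_def .
  have "F * (F * (8 * of_nat k * s * e)) = (P ^ 2 * T ^ 2 * f ^ 2) * (8 * of_nat k * s * e)"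
    unfolding P2[folded T_def] by (simp add: power2_eq_square)
  also have "\<dots> = (2 * s * (e * P ^ 2) * (2 * (2 * of_nat k))) * (T ^ 2 * f ^ 2)"
    by (simp add: algebra_simps)
  also have "\<dots> = F * (- (T ^ 4 * f ^ 2))"
    unfolding 5 by (simp add: power2_eq_square power4_eq_xxxx)
  finally have "F * (8 * of_nat k * s * e) = - (T ^ 4 * f ^ 2)" using F0 by (simp only: mult_cancel_left) simp
  then have "e * (F * (8 * of_nat k * s * e)) = e * (- (T ^ 4 * f ^ 2))" by (simp only:)
  then have "F * (8 * of_nat k * s) * (e * e) = - (e * T ^ 4) * f ^ 2" by (simp add: algebra_simps)
  then have "F * (8 * of_nat k * s) = - (e * T ^ 4) * f ^ 2" using e2 by simp
  then have "8 * of_nat k * (F / f ^ 2) * s = - (e * T ^ 4)" using F0 by (simp add: field_simps)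
  then show ?thesis unfolding s_def N_def b e_def pk(3) T_def .
qed

lemma choose_Suc_ratio: "of_nat ((2 * k) choose (k + 1)) = of_nat k / (of_nat k + 1) * rat_of_nat ((2 * k) choose k)"
proof -
  have "(of_nat k + 1) * rat_of_nat ((2 * k) choose (k + 1)) = of_nat k * of_nat ((2 * k) choose k)"
    using rat_binomial_Suc[of k "2 * k"] by simp
  moreover have "rat_of_nat k + 1 \<noteq> 0" using of_nat_neq_0[of k] by (simp add: add.commute)
  ultimately show ?thesis by (simp add: field_simps)
qed

lemma falling_product: "(\<Prod>i<k. rat_of_nat N - of_nat i) = fact k * of_nat (N choose k)"
  unfolding binomial_gbinomial gbinomial_prod_rev by (simp add: atLeast0LessThan)

text \<open>
  In other words \<open>C(-1/2, k) = (-1)^k cbin k\<close>.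
\<close>
lemma half_product: "(\<Prod>i<k. - 1 / 2 - rat_of_nat i) = fact k * ((-1) ^ k * cbin k)"
proof (induction k)
  case (Suc k)
  have "(\<Prod>i<Suc k. - 1 / 2 - rat_of_nat i) = (fact k * ((-1) ^ k * cbin k)) * (- 1 / 2 - of_nat k)"
    by (simp only: prod.lessThan_Suc Suc)
  then have "2 * (\<Prod>i<Suc k. - 1 / 2 - rat_of_nat i) = - (fact k * ((-1) ^ k * ((2 * of_nat k + 1) * cbin k)))"
    by (simp add: algebra_simps)
  also have "\<dots> = 2 * (fact (Suc k) * ((-1) ^ Suc k * cbin (Suc k)))"
    unfolding cbin_Suc[symmetric] by (simp add: algebra_simps)
  finally show ?case unfolding mult_cancel_left by simp
qed simp

lemma catalan_eq: "catalan k = 1 / (of_nat k + 1) * of_nat ((2 * k) choose k)"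
  by (simp add: catalan_def add.commute)

section \<open>The Legendre value at 3 modulo the square of p\<close>

context gauss_prime begin

lemma n_lt_p: "2 * n < p" "2 * m \<le> n" "m < p" "n < p" by (simp_all add: p_eq n_def)

lemma rat_N: "of_nat n * (of_nat n + 1) = ((of_nat p) ^ 2 - 1) / (4 :: rat)"
  by (simp add: p_eq power2_eq_square field_simps)

text \<open>
  As \<open>n (n + 1) = (p^2 - 1) / 4\<close>, the parameter of Legendre's equation is the one for
  \<open>n = -1/2\<close>, up to \<open>p^2\<close>.
\<close>
lemma pcong_N: "pcong 2 (of_nat n * (of_nat n + 1)) (- 1 / 4)"
  unfolding rat_N by (rule pcongI[of "1 / 4"]) (auto simp: field_simps intro!: Zp_divide)

lemma unit_Suc: "k < 2 * n \<Longrightarrow> unit (of_nat k + 1)"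
  using unit_less[of "Suc k"] p_eq by (simp add: add.commute)

lemma Zp_binomial [simp, intro]: "legendre_coeff n k \<in> Zp" "clausen_coeff n k \<in> Zp"
  unfolding legendre_coeff_def clausen_coeff_def by (intro Zp_mult Zp_of_nat)+

text \<open>
  The coefficients of \<open>P_n(1 + 2 t)\<close> for the exponent \<open>n = -1/2\<close>.
\<close>
definition central :: "nat \<Rightarrow> rat" where "central k = of_nat ((2 * k) choose k) ^ 2 / (- 16) ^ k"

lemma central_Suc: "(of_nat k + 1) ^ 2 * central (Suc k) = - ((2 * of_nat k + 1) ^ 2 / 4) * central k"
proof -
  have "(of_nat k + 1) ^ 2 * central (Suc k) = ((of_nat k + 1) * of_nat ((2 * Suc k) choose Suc k)) ^ 2 / ((-16) * (-16) ^ k)"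
    unfolding central_def power_Suc power_mult_distrib by simp
  also have "\<dots> = - ((2 * of_nat k + 1) ^ 2 / 4) * central k"
    unfolding rat_central_binomial_Suc power_mult_distrib central_def by simp
  finally show ?thesis .
qed

text \<open>
  The quotient is the product of the factors \<open>1 - p^2 / (2 j - 1)^2\<close> over \<open>1 \<le> j \<le> k\<close>.
\<close>
lemma legendre_coeff_cong_central: "k \<le> n \<Longrightarrow> pcong 2 (legendre_coeff n k) (central k)"
proof (induction k)
  case 0 show ?case by (simp add: central_def)
next
  case (Suc k)
  have "pcong 2 ((of_nat k + 1) ^ 2 * legendre_coeff n (Suc k)) ((of_nat k + 1) ^ 2 * central (Suc k))"
    unfolding legendre_coeff_Suc central_Suc
  proof (rule pcong_mult)
    show "pcong 2 (of_nat n * (of_nat n + 1) - of_nat k * (of_nat k + 1)) (- ((2 * of_nat k + 1) ^ 2 / 4))"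
      unfolding rat_N by (rule pcongI[of "1 / 4"]) (auto simp: field_simps power2_eq_square intro!: Zp_divide)
    show "- ((2 * rat_of_nat k + 1) ^ 2 / 4) \<in> Zp"
      by (intro Zp_uminus Zp_divide Zp_power Zp_add Zp_mult) auto
  qed (use Suc in auto)
  moreover have "unit ((of_nat k + 1) ^ 2)" using Suc.prems n_lt_p by (intro unit_power unit_Suc) simp
  ultimately show ?case by (rule pcong_cancel[rotated])
qed

lemma Zp_cbin [intro]: "cbin k \<in> Zp"
  unfolding cbin_def by (intro Zp_divide Zp_of_nat unit_power unit_numeral)

lemma unit_odd: "2 * k + 1 < p \<Longrightarrow> unit (2 * of_nat k + 1)"
  using unit_less[of "2 * k + 1"] by (simp add: add.commute)

lemma unit_double_Suc: "k < 2 * n \<Longrightarrow> unit (2 * (of_nat k + 1))"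
  by (intro unit_mult unit_numeral unit_Suc)

lemma Zp_cbin_log: "i < m \<Longrightarrow> cbin_log i \<in> Zp"
  unfolding cbin_log_def by (intro Zp_sum Zp_divide Zp_cbin unit_odd) (simp add: p_def)

definition delannoy :: "nat \<Rightarrow> rat" where "delannoy j = delannoy_fps n $ j"

lemma delannoy_rec: "(of_nat k + 1) * delannoy (Suc k) = of_nat p * delannoy k + (if k = 0 then 0 else of_nat k * delannoy (k - 1))"
  unfolding delannoy_def delannoy_Suc by (simp add: p_eq)

text \<open>
  The series is \<open>(1 - z^2)^(-1/2) exp (p artanh z)\<close>; truncating the exponential after the linear term
  leaves an even part free of \<open>p\<close> and an odd part proportional to \<open>p\<close>. The proof runs both recurrences in parallel.
\<close>
lemma delannoy_cong: "i \<le> m \<Longrightarrow> pcong 2 (delannoy (2 * i)) (cbin i) \<and> (i < m \<longrightarrow> pcong 2 (delannoy (2 * i + 1)) (of_nat p * cbin_log i))"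
proof (induction i)
  case 0
  have "delannoy 1 = of_nat p" using delannoy_rec[of 0] by (simp add: delannoy_def delannoy_0)
  then show ?case by (simp add: delannoy_def delannoy_0 cbin_log_def)
next
  case (Suc i)
  then have im: "i < m" "i \<le> m" by simp_all
  have ev: "pcong 2 (delannoy (2 * i)) (cbin i)" and od: "pcong 2 (delannoy (2 * i + 1)) (of_nat p * cbin_log i)"
    using Suc im by auto
  have odZ: "delannoy (2 * i + 1) \<in> Zp"
    by (rule pcong_Zp[OF od]) (intro Zp_mult Zp_of_nat Zp_cbin_log im)
  have "pcong 2 (of_nat p * delannoy (2 * i + 1)) (of_nat p * (of_nat p * cbin_log i))"
    by (intro pcong_scale od Zp_of_nat)
  also have "pcong 2 \<dots> 0"
    using pcong_p2[OF Zp_cbin_log[OF im(1)]] by (simp add: power2_eq_square mult.assoc)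
  finally have 1: "pcong 2 (of_nat p * delannoy (2 * i + 1)) 0" .
  have "(2 * (of_nat i + 1)) * delannoy (2 * Suc i) = of_nat p * delannoy (2 * i + 1) + (2 * of_nat i + 1) * delannoy (2 * i)"
    using delannoy_rec[of "2 * i + 1"] by (simp add: algebra_simps)
  moreover have "pcong 2 \<dots> (0 + (2 * of_nat i + 1) * cbin i)"
    by (intro pcong_add 1 pcong_scale ev Zp_add Zp_mult) auto
  ultimately have "pcong 2 ((2 * (of_nat i + 1)) * delannoy (2 * Suc i)) ((2 * (of_nat i + 1)) * cbin (Suc i))"
    using cbin_Suc[of i] by simp
  then have ev': "pcong 2 (delannoy (2 * Suc i)) (cbin (Suc i))"
    by (rule pcong_cancel[rotated]) (rule unit_double_Suc, use im in \<open>simp add: n_def\<close>)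
  have "pcong 2 (delannoy (2 * Suc i + 1)) (of_nat p * cbin_log (Suc i))" if "Suc i < m"
  proof -
    have "(2 * of_nat (Suc i) + 1) * delannoy (2 * Suc i + 1) = of_nat p * delannoy (2 * Suc i) + (2 * of_nat i + 2) * delannoy (2 * i + 1)"
      using delannoy_rec[of "2 * i + 2"] by (simp add: algebra_simps)
    moreover have "pcong 2 \<dots> (of_nat p * cbin (Suc i) + (2 * of_nat i + 2) * (of_nat p * cbin_log i))"
      by (intro pcong_add pcong_scale ev' od Zp_add Zp_mult) auto
    moreover have "of_nat p * cbin (Suc i) + (2 * of_nat i + 2) * (of_nat p * cbin_log i)
       = (2 * of_nat (Suc i) + 1) * (of_nat p * cbin_log (Suc i))"
    proof -
      have "(2 * of_nat (Suc i) + 1) * (of_nat p * cbin_log (Suc i)) = of_nat p * ((2 * of_nat i + 3) * cbin_log (Suc i))"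
        by (simp add: algebra_simps)
      then show ?thesis unfolding cbin_log_Suc by (simp add: algebra_simps)
    qed
    ultimately have "pcong 2 ((2 * of_nat (Suc i) + 1) * delannoy (2 * Suc i + 1)) ((2 * of_nat (Suc i) + 1) * (of_nat p * cbin_log (Suc i)))"
      by simp
    then show ?thesis
      by (rule pcong_cancel[rotated]) (rule unit_odd, use that in \<open>simp add: p_def\<close>)
  qed
  then show ?case using ev' by blast
qed

definition leg_sum :: rat where "leg_sum = (\<Sum>k\<le>n. legendre_coeff n k)"
definition leg_sum1 :: rat where "leg_sum1 = (\<Sum>k\<le>n. of_nat k * legendre_coeff n k)"
text \<open>
  The combination of value and first moment that is divisible by \<open>p\<close>. It will turn out to be congruent to the
  conjugate of the unit root \<open>leg_sum\<close>.
\<close>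
definition conj_sum :: rat where "conj_sum = leg_sum + 4 * leg_sum1"

lemma Zp_leg_sums [simp, intro]: "leg_sum \<in> Zp" "leg_sum1 \<in> Zp" "conj_sum \<in> Zp"
  unfolding conj_sum_def leg_sum_def leg_sum1_def by (intro Zp_add Zp_sum Zp_mult; simp)+

lemma leg_sum_cong: "pcong 2 leg_sum (cbin m)"
  unfolding leg_sum_def sum_legendre_delannoy using delannoy_cong[of m] by (simp add: delannoy_def flip: n_def)

text \<open>
  The even coefficients contribute \<open>4 n (n + 1) cbin m = (p^2 - 1) cbin m\<close>, which cancels \<open>leg_sum\<close>;
  only the odd coefficients remain.
\<close>
lemma conj_sum_cong_log: "pcong 2 conj_sum (of_nat p * (2 * (\<Sum>i<m. cbin_log i)))"
proof -
  define d where "d = (\<Sum>i<m. cbin_log i)"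
  have dZ: "d \<in> Zp" unfolding d_def by (intro Zp_sum Zp_cbin_log) simp
  have "leg_sum1 = (of_nat n + 1) * (\<Sum>i<2 * m. delannoy i)"
    unfolding leg_sum1_def using sum_k_legendre_delannoy[of n] n_pos by (simp add: delannoy_def flip: n_def)
  also have "pcong 2 \<dots> ((of_nat n + 1) * ((\<Sum>i<m. cbin i) + (\<Sum>i<m. of_nat p * cbin_log i)))"
    unfolding sum_even_odd using delannoy_cong
    by (intro pcong_scale pcong_add pcong_sum Zp_add) auto
  also have "(of_nat n + 1) * ((\<Sum>i<m. cbin i) + (\<Sum>i<m. of_nat p * cbin_log i)) = (of_nat n + 1) * (of_nat n * cbin m + of_nat p * d)"
    unfolding sum_cbin d_def by (simp add: sum_distrib_left rat_p)
  finally have "pcong 2 (leg_sum + 4 * leg_sum1) (cbin m + 4 * ((of_nat n + 1) * (of_nat n * cbin m + of_nat p * d)))"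
    by (intro pcong_add leg_sum_cong pcong_scale) auto
  also have "cbin m + 4 * ((of_nat n + 1) * (of_nat n * cbin m + of_nat p * d))
     = of_nat p * (2 * d) + of_nat p ^ 2 * (cbin m + 2 * d)"
    by (simp add: p_eq algebra_simps power2_eq_square)
  also have "pcong 2 \<dots> (of_nat p * (2 * d) + 0)"
    using dZ by (intro pcong_add pcong_refl pcong_p2 Zp_add Zp_mult) auto
  finally show ?thesis by (simp add: conj_sum_def d_def)
qed

text \<open>
  Modulo \<open>p\<close> the upper arguments \<open>n\<close> and \<open>n - 1\<close> are \<open>-1/2\<close> and \<open>-3/2\<close>.
\<close>
lemma binomial_mod_p:
  "l \<le> n \<Longrightarrow> pcong 1 ((-1) ^ l * of_nat (n choose l)) (cbin l)"
  "l < n \<Longrightarrow> pcong 1 ((-1) ^ l * of_nat ((n - 1) choose l)) ((2 * of_nat l + 1) * cbin l)"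
proof (induction l)
  case (Suc l)
  have n: "rat_of_nat n = of_nat p / 2 - 1 / 2" by (simp add: p_eq field_simps)
  {
    case 1
    then have IH: "pcong 1 ((-1) ^ l * of_nat (n choose l)) (cbin l)" using Suc by simp
    have "2 * (of_nat l + 1) * ((-1) ^ Suc l * rat_of_nat (n choose Suc l))
       = - ((2 * of_nat n - 2 * of_nat l) * ((-1) ^ l * of_nat (n choose l)))"
    proof -
      have "2 * (of_nat l + 1) * ((-1) ^ Suc l * of_nat (n choose Suc l))
        = - (2 * (-1) ^ l * ((of_nat l + 1) * of_nat (n choose Suc l)) :: rat)" by (simp add: algebra_simps)
      then show ?thesis unfolding rat_binomial_Suc by (simp add: algebra_simps)
    qed
    also have "pcong 1 \<dots> (- (( - 2 * of_nat l - 1) * cbin l))"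
    proof (intro IH pcong_uminus pcong_mult)
      show "pcong 1 (2 * of_nat n - 2 * of_nat l) (- 2 * of_nat l - 1)"
        by (rule pcongI[of 1]) (auto simp: n)
    qed auto
    also have "\<dots> = 2 * (of_nat l + 1) * cbin (Suc l)" unfolding cbin_Suc by (simp add: algebra_simps)
    finally show ?case
      by (rule pcong_cancel[rotated]) (rule unit_double_Suc, use 1 in simp)
  next
    case 2
    then have IH: "pcong 1 ((-1) ^ l * of_nat ((n - 1) choose l)) ((2 * of_nat l + 1) * cbin l)" using Suc by simp
    have "2 * (of_nat l + 1) * ((-1) ^ Suc l * rat_of_nat ((n - 1) choose Suc l))
       = - ((2 * of_nat n - 2 - 2 * of_nat l) * ((-1) ^ l * of_nat ((n - 1) choose l)))"
    proof -
      have "2 * (of_nat l + 1) * ((-1) ^ Suc l * of_nat ((n - 1) choose Suc l))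
        = - (2 * (-1) ^ l * ((of_nat l + 1) * of_nat ((n - 1) choose Suc l)) :: rat)" by (simp add: algebra_simps)
      also have "\<dots> = - (2 * (-1) ^ l * ((of_nat n - 1 - of_nat l) * of_nat ((n - 1) choose l)))"
        unfolding rat_binomial_Suc using n_pos by (simp add: of_nat_diff)
      finally show ?thesis by (simp add: algebra_simps)
    qed
    also have "pcong 1 \<dots> (- (( - 2 * of_nat l - 3) * ((2 * of_nat l + 1) * cbin l)))"
    proof (intro IH pcong_uminus pcong_mult)
      show "pcong 1 (2 * of_nat n - 2 - 2 * of_nat l) (- 2 * of_nat l - 3)"
        by (rule pcongI[of 1]) (auto simp: n)
    qed auto
    also have "\<dots> = 2 * (of_nat l + 1) * ((2 * of_nat (Suc l) + 1) * cbin (Suc l))"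
    proof -
      have "2 * (of_nat l + 1) * ((2 * of_nat (Suc l) + 1) * cbin (Suc l)) = (2 * of_nat l + 3) * (2 * (of_nat l + 1) * cbin (Suc l))"
        by (simp add: algebra_simps)
      then show ?thesis unfolding cbin_Suc by (simp add: algebra_simps)
    qed
    finally show ?case
      by (rule pcong_cancel[rotated]) (rule unit_double_Suc, use 2 in simp)
  }
qed simp_all

definition mid_binom :: rat where "mid_binom = of_nat (n choose m)"

lemma unit_mid_binom: "unit mid_binom"
proof -
  have "n choose m dvd fact n"
    using binomial_fact_lemma[of m n] by (metis dvd_triv_right le_add1 mult_2 n_def)
  moreover have "\<not> p dvd fact n" using prime_p n_lt_p by (simp add: prime_dvd_fact_iff)
  ultimately show ?thesis unfolding mid_binom_def by (intro unit_of_nat) (meson dvd_trans)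
qed

text \<open>
  The factor \<open>p\<close> is already present, so the logarithmic sum is needed modulo \<open>p\<close> only. There
  \<open>(2 l + 1) cbin l\<close> becomes a binomial coefficient and \<open>alternating_half_sum\<close> applies, with
  \<open>16^m = 2^(p-1) \<equiv> 1\<close> and \<open>4 m \<equiv> -1\<close>.
\<close>
lemma conj_sum_cong: "pcong 2 conj_sum (of_nat p * ((-1) ^ m / mid_binom))"
proof -
  define s where "s = (\<Sum>l<m. (-1) ^ l * of_nat ((n - 1) choose l) / (2 * rat_of_nat (m - Suc l) + 1))"
  have "pcong 1 (\<Sum>i<m. cbin_log i) s"
    unfolding sum_cbin_log s_def
  proof (intro pcong_sum pcong_divide unit_odd)
    fix l assume "l \<in> {..<m}"
    then show "pcong 1 ((2 * of_nat l + 1) * cbin l) ((-1) ^ l * of_nat ((n - 1) choose l))"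
      by (intro pcong_sym[OF binomial_mod_p(2)]) (simp add: n_def)
  qed (simp add: p_def)
  moreover have "pcong 1 (2 * s) ((-1) ^ m / mid_binom)"
  proof -
    have e: "8 * of_nat m * mid_binom * s = - ((-1) ^ m * 16 ^ m)"
      using alternating_half_sum[OF m_pos] unfolding s_def mid_binom_def n_def[symmetric] .
    have "[2 ^ (p - 1) = 1] (mod p)"
      using prime_p p_ge by (intro fermat_theorem) (auto dest: dvd_imp_le)
    then have "[int (2 ^ (p - 1)) = int 1] (mod int p)" by (simp only: cong_int_iff)
    then have "pcong 1 (of_int (2 ^ (p - 1))) (of_int 1)" by (intro pcong_of_int) simp
    moreover have "(2 :: rat) ^ (p - 1) = 16 ^ m" unfolding p_def by (simp add: power_mult)
    ultimately have f: "pcong 1 (16 ^ m) 1" by simp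
    have "4 * of_nat m * (mid_binom * (2 * s)) = - ((-1) ^ m * 16 ^ m)" using e by (simp add: algebra_simps)
    also have "pcong 1 \<dots> (- ((-1) ^ m * 1))" by (intro pcong_uminus pcong_scale f Zp_power) auto
    also have "pcong 1 \<dots> (4 * of_nat m * (-1) ^ m)"
    (* The difference is a multiple of 4 m + 1 = p. *)
    proof (rule pcongI)
      show "- ((-1) ^ m) \<in> Zp" by (intro Zp_uminus Zp_power) auto
      show "- ((-1 :: rat) ^ m * 1) = 4 * of_nat m * (-1) ^ m + of_nat p ^ 1 * - ((-1) ^ m)"
        by (simp add: p_def algebra_simps)
    qed
    finally have "pcong 1 (mid_binom * (2 * s)) ((-1) ^ m)"
      using unit_less[of m] n_lt_p m_pos
      by (intro pcong_cancel[of "4 * of_nat m" 1 "mid_binom * (2 * s)"]) (auto intro!: unit_mult)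
    then have "pcong 1 (mid_binom * (2 * s) / mid_binom) ((-1) ^ m / mid_binom)" using unit_mid_binom by (rule_tac pcong_divide)
    then show ?thesis using unit_nonzero[OF unit_mid_binom] by simp
  qed
  ultimately have "pcong 1 (2 * (\<Sum>i<m. cbin_log i)) ((-1) ^ m / mid_binom)"
    using pcong_trans[OF pcong_scale[of 2]] by blast
  then show ?thesis using pcong_trans[OF conj_sum_cong_log pcong_p_mult] by blast
qed

lemma Zp_minus_1 [simp, intro]: "- 1 \<in> Zp"
  using Zp_of_int[of "-1"] by simp

lemma Zp_minus_1_power [simp, intro]: "(- 1) ^ k \<in> Zp"
  by (rule Zp_power[OF Zp_minus_1])

section \<open>The Chowla-Dwork-Evans congruence\<close>

text \<open>
  A first-order expansion in \<open>p s\<close>; what matters is that the slope \<open>c\<close> is the same for all \<open>s\<close>.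
\<close>
lemma perturbed_product:
  fixes \<alpha> :: "nat \<Rightarrow> rat"
  assumes "\<And>i. \<alpha> i \<in> Zp"
  shows "\<exists>c\<in>Zp. \<forall>s\<in>Zp. pcong 2 (\<Prod>i<k. \<alpha> i + of_nat p * s) ((\<Prod>i<k. \<alpha> i) + of_nat p * s * c)"
proof (induction k)
  case 0 show ?case by (intro bexI[of _ 0]) auto
next
  case (Suc k)
  define a where "a = (\<Prod>i<k. \<alpha> i)"
  have aZ: "a \<in> Zp" unfolding a_def using assms by (induction k) auto
  obtain c where c: "c \<in> Zp" "\<And>s. s \<in> Zp \<Longrightarrow> pcong 2 (\<Prod>i<k. \<alpha> i + of_nat p * s) (a + of_nat p * s * c)"
    using Suc unfolding a_def by blast
  have "pcong 2 (\<Prod>i<Suc k. \<alpha> i + of_nat p * s) ((\<Prod>i<Suc k. \<alpha> i) + of_nat p * s * (a + c * \<alpha> k))" if s: "s \<in> Zp" for s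
  proof -
    have "pcong 2 (\<Prod>i<Suc k. \<alpha> i + of_nat p * s) ((a + of_nat p * s * c) * (\<alpha> k + of_nat p * s))"
      unfolding prod.lessThan_Suc using c(2)[OF s] assms s by (intro pcong_scaleR) auto
    also have "(a + of_nat p * s * c) * (\<alpha> k + of_nat p * s)
       = ((\<Prod>i<Suc k. \<alpha> i) + of_nat p * s * (a + c * \<alpha> k)) + of_nat p ^ 2 * (s * s * c)"
      by (simp add: a_def[symmetric] power2_eq_square algebra_simps)
    also have "pcong 2 \<dots> (((\<Prod>i<Suc k. \<alpha> i) + of_nat p * s * (a + c * \<alpha> k)) + 0)"
      using c s by (intro pcong_add pcong_refl pcong_p2) auto
    finally show ?thesis by simp
  qed
  moreover have "a + c * \<alpha> k \<in> Zp" using aZ c assms by auto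
  ultimately show ?case by blast
qed

lemma unit_fact: "k < p \<Longrightarrow> unit (fact k)"
  using unit_of_nat[of "fact k"] prime_p by (simp add: prime_dvd_fact_iff)

text \<open>
  This is the binomial coefficient \<open>C(-1/2, m)\<close>.
\<close>
definition half_binomial :: rat where "half_binomial = (-1) ^ m * cbin m"

lemma Zp_half_binomial [simp, intro]: "half_binomial \<in> Zp" unfolding half_binomial_def by auto

text \<open>
  The upper arguments are \<open>n = -1/2 + p/2\<close> and \<open>6 m + 1 = -1/2 + 3 p/2\<close>. By \<open>perturbed_product\<close> both
  coefficients deviate from \<open>C(-1/2, m)\<close> linearly, in the ratio 1 to 3, and the deviations cancel.
\<close>
lemma binomial_combination:
  "pcong 2 (3 * mid_binom - of_nat ((6 * m + 1) choose m)) (2 * half_binomial)"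
  "pcong 1 (of_nat ((6 * m + 1) choose m)) half_binomial"
proof -
  define \<alpha> where "\<alpha> i = - 1 / 2 - rat_of_nat i" for i
  have "\<alpha> i \<in> Zp" for i unfolding \<alpha>_def by (intro Zp_diff Zp_divide) auto
  from perturbed_product[of \<alpha> m, OF this] obtain c where c: "c \<in> Zp"
    "\<And>s. s \<in> Zp \<Longrightarrow> pcong 2 (\<Prod>i<m. \<alpha> i + of_nat p * s) ((\<Prod>i<m. \<alpha> i) + of_nat p * s * c)" by blast
  have 0: "(\<Prod>i<m. \<alpha> i) = fact m * half_binomial" unfolding \<alpha>_def half_binomial_def by (rule half_product)
  have "(\<Prod>i<m. \<alpha> i + of_nat p * (1 / 2)) = (\<Prod>i<m. rat_of_nat n - of_nat i)"
    by (rule prod.cong[OF refl]) (simp add: \<alpha>_def p_eq field_simps)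
  then have 1: "(\<Prod>i<m. \<alpha> i + of_nat p * (1 / 2)) = fact m * mid_binom" unfolding falling_product mid_binom_def .
  have "(\<Prod>i<m. \<alpha> i + of_nat p * (3 / 2)) = (\<Prod>i<m. rat_of_nat (6 * m + 1) - of_nat i)"
    by (rule prod.cong[OF refl]) (simp add: \<alpha>_def p_def field_simps)
  then have 2: "(\<Prod>i<m. \<alpha> i + of_nat p * (3 / 2)) = fact m * of_nat ((6 * m + 1) choose m)" unfolding falling_product .
  have h: "1 / 2 \<in> Zp" "3 / 2 \<in> Zp" by (intro Zp_divide; simp)+
  note c1 = c(2)[OF h(1), unfolded 0 1] and c2 = c(2)[OF h(2), unfolded 0 2]
  have f: "unit (fact m)" using n_lt_p by (intro unit_fact)
  have "pcong 2 (3 * (fact m * mid_binom) - fact m * of_nat ((6 * m + 1) choose m))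
     (3 * (fact m * half_binomial + of_nat p * (1 / 2) * c) - (fact m * half_binomial + of_nat p * (3 / 2) * c))"
    by (intro pcong_diff pcong_scale c1 c2) auto
  also have "3 * (fact m * half_binomial + of_nat p * (1 / 2) * c) - (fact m * half_binomial + of_nat p * (3 / 2) * c) = fact m * (2 * half_binomial)"
    by (simp add: algebra_simps)
  also have "3 * (fact m * mid_binom) - fact m * of_nat ((6 * m + 1) choose m) = fact m * (3 * mid_binom - of_nat ((6 * m + 1) choose m))"
    by (simp only: right_diff_distrib mult.left_commute)
  finally show "pcong 2 (3 * mid_binom - of_nat ((6 * m + 1) choose m)) (2 * half_binomial)" by (rule pcong_cancel[OF f])
  have "pcong 1 (fact m * of_nat ((6 * m + 1) choose m)) (fact m * half_binomial + of_nat p * (3 / 2 * c))"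
    using pcong_21[OF c2] by (simp only: mult.assoc)
  also have "pcong 1 \<dots> (fact m * half_binomial + 0)" by (intro pcong_add pcong_refl pcong_p1 Zp_mult c(1) h(2))
  finally have "pcong 1 (fact m * of_nat ((6 * m + 1) choose m)) (fact m * half_binomial)" by simp
  then show "pcong 1 (of_nat ((6 * m + 1) choose m)) half_binomial" by (rule pcong_cancel[OF f])
qed

text \<open>
  The passage from \<open>C(6m+1,m)\<close> to \<open>2 C(6m,m)\<close> is a factor congruent to \<open>1 - 2 p\<close>; the
  correction is needed only to first order.
\<close>
lemma binomial_combination':
  "pcong 2 (3 * mid_binom - 2 * of_nat ((6 * m) choose m)) (2 * half_binomial + of_nat p * (2 * half_binomial))"
proof -
  define C C' where "C = rat_of_nat ((6 * m) choose m)" and "C' = rat_of_nat ((6 * m + 1) choose m)"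
  have CZ: "C \<in> Zp" "C' \<in> Zp" by (simp_all add: C_def C'_def)
  have "(6 * m + 1 - m) * ((6 * m + 1) choose m) = (6 * m + 1) * ((6 * m) choose m)"
    using binomial_absorb_comp[of "6 * m + 1" m] by (simp only: diff_add_inverse2)
  then have "rat_of_nat ((6 * m + 1 - m) * ((6 * m + 1) choose m)) = of_nat ((6 * m + 1) * ((6 * m) choose m))" by (simp only:)
  then have "(5 * of_nat m + 1) * C' = (6 * of_nat m + 1) * C"
    unfolding of_nat_mult by (simp add: C_def C'_def add.commute)
  then have e: "(5 * of_nat p - 1) * C' = (3 * of_nat p - 1) * (2 * C)" by (simp add: p_def algebra_simps)
  have un: "unit (3 * of_nat p - 1)"
  proof (rule pcong_unit)
    show "pcong 1 (3 * of_nat p - 1) (- 1)" by (rule pcongI[of 3]) auto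
    show "unit (- 1)" by (intro unit_uminus) simp
  qed
  have "(3 * of_nat p - 1) * (2 * C) = (3 * of_nat p - 1) * ((1 - 2 * of_nat p) * C') + of_nat p ^ 2 * (6 * C')"
    unfolding e[symmetric] by (simp add: power2_eq_square algebra_simps)
  also have "pcong 2 \<dots> ((3 * of_nat p - 1) * ((1 - 2 * of_nat p) * C') + 0)"
    using CZ by (intro pcong_add pcong_refl pcong_p2) auto
  finally have "pcong 2 (2 * C) ((1 - 2 * of_nat p) * C')" using pcong_cancel[OF un] by simp
  then have "pcong 2 (3 * mid_binom - 2 * C) (3 * mid_binom - (1 - 2 * of_nat p) * C')" by (intro pcong_diff pcong_refl)
  also have "3 * mid_binom - (1 - 2 * of_nat p) * C' = (3 * mid_binom - C') + of_nat p * (2 * C')" by (simp add: algebra_simps)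
  also have "pcong 2 \<dots> (2 * half_binomial + of_nat p * (2 * half_binomial))"
    unfolding C'_def by (intro pcong_add binomial_combination(1) pcong_p_mult pcong_scale binomial_combination(2)) auto
  finally show ?thesis by (simp add: C_def)
qed

lemma Zp_mid_binom [simp, intro]: "mid_binom \<in> Zp" by (simp add: mid_binom_def)

text \<open>
  Exactly one factor \<open>p\<close> occurs in \<open>(6 m)!\<close> and none in \<open>(3 m)!\<close>. The cofactor is determined modulo
  \<open>p\<close> by Wilson's theorem and its reflections.
\<close>
lemma binomial_6m_3m: "pcong 2 (of_nat ((6 * m) choose (3 * m))) (- (of_nat p * (2 / mid_binom)))"
proof -
  define C where "C = (6 * m) choose (3 * m)"
  have C: "C * (fact (3 * m) * fact (3 * m)) = fact (6 * m)"
    using binomial_fact_lemma[of "3 * m" "6 * m"] by (simp add: C_def mult_ac)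
  have f6: "fact (6 * m) = fact (4 * m) * p * (\<Prod>i<2 * m - 1. p + Suc i)"
  proof -
    have "fact (p + k) = fact p * (\<Prod>i<k. p + Suc i)" for k
      by (induction k) (simp_all add: algebra_simps)
    from this[of "2 * m - 1"] show ?thesis using m_pos by (simp add: p_def algebra_simps)
  qed
  have nd: "\<not> p dvd fact (3 * m)" using prime_p by (simp add: prime_dvd_fact_iff p_def)
  have "p dvd C * (fact (3 * m) * fact (3 * m))" unfolding C f6 by simp
  then have "p dvd C" using nd prime_p by (simp add: prime_dvd_mult_iff)
  then obtain D where D: "C = p * D" by blast
  have "p * (D * (fact (3 * m) * fact (3 * m))) = p * (fact (4 * m) * (\<Prod>i<2 * m - 1. p + Suc i))"
    using C f6 unfolding D by (simp only: mult_ac)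
  then have e: "D * (fact (3 * m) * fact (3 * m)) = fact (4 * m) * (\<Prod>i<2 * m - 1. p + Suc i)" using p_ge by simp
  define F1 F2 F3 :: int where "F1 = fact m" and "F2 = fact (2 * m)" and "F3 = fact (3 * m)"
  have W4: "[fact (4 * m) = (-1 :: int)] (mod int p)" using fact_reflect[of 0] by (simp add: p_def)
  have W3: "[F1 * F3 * (-1) ^ m = -1] (mod int p)" using fact_reflect[of m] unfolding F1_def F3_def by (simp add: p_def)
  have W2: "[F2 * F2 = -1] (mod int p)" using fact_n_square unfolding F2_def n_def .
  have prd: "[(\<Prod>i<2 * m - 1. int (p + Suc i)) = fact (2 * m - 1)] (mod int p)"
  proof -
    have "[(\<Prod>i<k. int (p + Suc i)) = fact k] (mod int p)" for k
    proof (induction k)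
      case (Suc k)
      have "[(\<Prod>i<k. int (p + Suc i)) * int (p + Suc k) = fact k * int (Suc k)] (mod int p)"
        by (intro cong_mult Suc) (simp add: cong_iff_dvd_diff)
      then show ?case by (simp add: mult.commute)
    qed simp
    then show ?thesis .
  qed
  have "[int D * (F3 * F3) = (-1) * fact (2 * m - 1)] (mod int p)"
  proof -
    have "int D * (F3 * F3) = fact (4 * m) * (\<Prod>i<2 * m - 1. int (p + Suc i))"
      using arg_cong[OF e, of int] by (simp add: F3_def)
    then show ?thesis using cong_mult[OF W4 prd] by simp
  qed
  then have "[int D * (F3 * F3) * (F1 * F1) * (2 * int m) = (-1) * fact (2 * m - 1) * (F1 * F1) * (2 * int m)] (mod int p)"
    by (rule cong_mult[OF cong_mult[OF _ cong_refl] cong_refl])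
  moreover have "(-1) * fact (2 * m - 1) * (F1 * F1) * (2 * int m) = - (F2 * (F1 * F1))"
    using m_pos fact_reduce[of "2 * m", where 'a = int] by (simp add: F2_def)
  moreover have "[int D * (F3 * F3) * (F1 * F1) * (2 * int m) = int D * (2 * int m)] (mod int p)"
  proof -
    have "(F1 * F3 * (-1) ^ m) * (F1 * F3 * (-1) ^ m) = (F3 * F3) * (F1 * F1)"
      by (simp add: minus_one_power_iff)
    then have "[(F3 * F3) * (F1 * F1) = (-1) * (-1)] (mod int p)" using cong_mult[OF W3 W3] by (simp only:)
    from cong_mult[OF cong_mult[OF cong_refl[of "int D"] this] cong_refl[of "2 * int m"]]
    show ?thesis by (simp add: mult.assoc)
  qed
  ultimately have "[int D * (2 * int m) = - (F2 * (F1 * F1))] (mod int p)" by (metis cong_sym cong_trans)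
  then have "[int D * (2 * int m) * (int (n choose m)) = - (F2 * (F1 * F1)) * int (n choose m)] (mod int p)"
    by (rule cong_mult[OF _ cong_refl])
  moreover have "F1 * F1 * int (n choose m) = F2"
    using arg_cong[OF binomial_fact_lemma[of m "2 * m"], of int] by (simp add: F1_def F2_def n_def)
  then have "- (F2 * (F1 * F1)) * int (n choose m) = - (F2 * F2)" by (simp add: mult.assoc)
  moreover have "[- (F2 * F2) = 1] (mod int p)" using cong_minus_minus_iff[of "F2 * F2" "-1" "int p"] W2 by simp
  ultimately have fin: "[int D * (2 * int m) * int (n choose m) = 1] (mod int p)" by (metis cong_trans)
  have "pcong 1 (of_int (int D * (2 * int m) * int (n choose m))) (of_int 1)" by (rule pcong_of_int) (simp add: fin)
  then have "pcong 1 (of_nat D * (2 * of_nat m) * mid_binom) 1" by (simp add: mid_binom_def)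
  then have "pcong 1 (2 * (of_nat D * (2 * of_nat m) * mid_binom)) (2 * 1)" by (intro pcong_scale) auto
  then have "pcong 1 (- (2 * (of_nat D * (2 * of_nat m) * mid_binom))) (- (2 * 1))" by (rule pcong_uminus)
  moreover have "- (2 * (of_nat D * (2 * of_nat m) * mid_binom)) = mid_binom * of_nat D - of_nat p * (of_nat D * mid_binom)"
    by (simp add: p_def algebra_simps)
  moreover have "pcong 1 (mid_binom * of_nat D - 0) (mid_binom * of_nat D - of_nat p * (of_nat D * mid_binom))"
    by (intro pcong_diff pcong_refl pcong_sym[OF pcong_p1]) auto
  ultimately have "pcong 1 (mid_binom * of_nat D) (- 2)" using pcong_trans by auto
  then have "pcong 1 (mid_binom * of_nat D / mid_binom) (- 2 / mid_binom)" by (intro pcong_divide unit_mid_binom)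
  then have "pcong 1 (of_nat D) (- (2 / mid_binom))" using unit_nonzero[OF unit_mid_binom] by simp
  from pcong_p_mult[OF this] show ?thesis unfolding C_def[symmetric] D by simp
qed

text \<open>
  The two evaluations of the Jacobsthal sum are compared: \<open>- 4 e x\<close> exactly, and a combination of
  binomial coefficients modulo \<open>p^2\<close>. The factor \<open>1 + p\<close> of \<open>binomial_combination'\<close> cancels the
  factor \<open>1 - p\<close> that comes from the number of units modulo \<open>p\<close>.
\<close>
theorem chowla_dwork_evans:
  assumes "int p = x ^ 2 + y ^ 2" "[x = 1] (mod 4)"
  shows "pcong 2 (2 * of_int x) (half_binomial + of_nat p / mid_binom)"
proof -
  define X where "X = rat_of_int x"
  define e where "e = (-1 :: rat) ^ m"
  have e2: "e * e = 1" by (simp add: e_def power_mult_distrib[symmetric])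
  have bZ: "inverse mid_binom \<in> Zp" using unit_mid_binom by (simp add: unit_def)
  define Z where "Z = 3 * mid_binom - 2 * of_nat ((6 * m) choose m) - of_nat ((6 * m) choose (3 * m))"
  have Z: "pcong 2 Z (2 * half_binomial + of_nat p * (2 * half_binomial) - - (of_nat p * (2 / mid_binom)))"
    unfolding Z_def by (intro pcong_diff binomial_combination' binomial_6m_3m)
  have "pcong 2 (of_int (2 * jacobsthal_sum (-1))) (of_int ((int p - 1) * (-1) ^ m *
     (3 * int (n choose m) - 2 * int ((6 * m) choose m) - int ((6 * m) choose (3 * m)))))"
    by (rule pcong_of_int[OF jacobsthal_cong_binomials])
  then have "pcong 2 (- 4 * e * X) ((of_nat p - 1) * e * Z)"
    unfolding jacobsthal[OF assms] by (simp add: e_def X_def Z_def mid_binom_def mult.assoc)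
  then have "pcong 2 ((- e) * (- 4 * e * X)) ((- e) * ((of_nat p - 1) * e * Z))"
    by (intro pcong_scale) (auto simp: e_def)
  moreover have "(- e) * (- 4 * e * X) = 4 * X * (e * e)" "(- e) * ((of_nat p - 1) * e * Z) = (1 - of_nat p) * Z * (e * e)"
    by (simp_all add: algebra_simps)
  ultimately have "pcong 2 (4 * X * (e * e)) ((1 - of_nat p) * Z * (e * e))" by (simp only:)
  then have "pcong 2 (4 * X) ((1 - of_nat p) * Z)" by (simp only: e2 mult_1_right)
  also have "pcong 2 \<dots> ((1 - of_nat p) * (2 * half_binomial + of_nat p * (2 * half_binomial) - - (of_nat p * (2 / mid_binom))))"
    by (intro pcong_scale Z) auto
  also have "(1 - of_nat p) * (2 * half_binomial + of_nat p * (2 * half_binomial) - - (of_nat p * (2 / mid_binom)))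
     = 2 * (half_binomial + of_nat p / mid_binom) + of_nat p ^ 2 * (- (2 * half_binomial + 2 * inverse mid_binom))"
    by (simp add: power2_eq_square algebra_simps divide_inverse)
  also have "pcong 2 \<dots> (2 * (half_binomial + of_nat p / mid_binom) + 0)"
    using bZ by (intro pcong_add pcong_refl pcong_p2) auto
  finally have "pcong 2 (2 * (2 * X)) (2 * (half_binomial + of_nat p / mid_binom))" by simp
  then show ?thesis unfolding X_def by (rule pcong_cancel[OF unit_numeral(2)])
qed

text \<open>
  In \<open>p / C(n,m)\<close> only the residue modulo \<open>p\<close> of the denominator matters, and
  \<open>C(n,m) \<equiv> C(-1/2,m) \<equiv> 2 x\<close>. So the congruence of Chowla, Dwork and Evans can be solved for
  \<open>C(-1/2,m)\<close>.
\<close>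
lemma leg_sum_and_conj_sum_values:
  assumes xy: "int p = x ^ 2 + y ^ 2" "[x = 1] (mod 4)"
  shows "unit (of_int x)"
    and "pcong 2 leg_sum ((-1) ^ m * (2 * of_int x - of_nat p / (2 * of_int x)))"
    and "pcong 2 conj_sum ((-1) ^ m * (of_nat p / (2 * of_int x)))"
proof -
  define X where "X = rat_of_int x"
  define e where "e = (-1 :: rat) ^ m"
  have e2: "e * e = 1" by (simp add: e_def power_mult_distrib[symmetric])
  have eZ: "e \<in> Zp" by (simp add: e_def)
  have bZ: "inverse mid_binom \<in> Zp" using unit_mid_binom by (simp add: unit_def)
  have "x \<noteq> 0" using xy(2) by (auto simp: cong_def)
  have "\<not> int p dvd x"
  proof
    assume "int p dvd x"
    then have "int p \<le> \<bar>x\<bar>" using dvd_imp_le_int[OF \<open>x \<noteq> 0\<close> \<open>int p dvd x\<close>] by simp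
    then have "int p * int p \<le> \<bar>x\<bar> * \<bar>x\<bar>" by (rule_tac mult_mono) simp_all
    also have "\<dots> = x ^ 2" by (simp add: power2_eq_square)
    also have "\<dots> \<le> int p" using xy(1) by simp
    finally have "int p * int p \<le> int p * 1" by simp
    then show False using p_ge mult_le_cancel_left_pos[of "int p" "int p" 1] by simp
  qed
  then show uX: "unit (of_int x)" by (rule unit_of_int)
  have cde: "pcong 2 (2 * X) (half_binomial + of_nat p / mid_binom)" unfolding X_def by (rule chowla_dwork_evans[OF xy])
  have "m \<le> n" by (simp add: n_def)
  then have "pcong 1 (e * mid_binom) (cbin m)" unfolding e_def mid_binom_def by (rule binomial_mod_p(1))
  then have "pcong 1 (e * (e * mid_binom)) (e * cbin m)" by (intro pcong_scale eZ)
  then have bu: "pcong 1 mid_binom half_binomial" using e2 by (simp add: half_binomial_def e_def mult.assoc[symmetric])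
  also have "pcong 1 half_binomial (half_binomial + of_nat p * inverse mid_binom)"
    using pcong_add[OF pcong_refl pcong_sym[OF pcong_p1[OF bZ]], of half_binomial] by simp
  also have "half_binomial + of_nat p * inverse mid_binom = half_binomial + of_nat p / mid_binom" by (simp add: divide_inverse)
  also have "pcong 1 \<dots> (2 * X)" by (rule pcong_sym[OF pcong_21[OF cde]])
  finally have b2X: "pcong 1 mid_binom (2 * X)" .
  have u2X: "unit (2 * X)" using uX by (intro unit_mult) (simp_all add: X_def)
  have "pcong 1 (mid_binom / (mid_binom * (2 * X))) ((2 * X) / (mid_binom * (2 * X)))" by (intro pcong_divide unit_mult unit_mid_binom u2X b2X)
  then have inv: "pcong 1 (1 / (2 * X)) (1 / mid_binom)" using unit_nonzero[OF unit_mid_binom] unit_nonzero[OF u2X] by simp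
  have pb: "pcong 2 (of_nat p / mid_binom) (of_nat p / (2 * X))" using pcong_p_mult[OF pcong_sym[OF inv]] by simp
  have "pcong 2 (2 * X - of_nat p / (2 * X)) ((half_binomial + of_nat p / mid_binom) - of_nat p / mid_binom)"
    by (intro pcong_diff cde pcong_sym[OF pb])
  then have "pcong 2 half_binomial (2 * X - of_nat p / (2 * X))" by (rule_tac pcong_sym) simp
  then have "pcong 2 (e * half_binomial) (e * (2 * X - of_nat p / (2 * X)))" by (intro pcong_scale eZ)
  moreover have "e * half_binomial = cbin m" using e2 by (simp add: half_binomial_def e_def mult.assoc[symmetric])
  ultimately show "pcong 2 leg_sum ((-1) ^ m * (2 * of_int x - of_nat p / (2 * of_int x)))"
    using pcong_trans[OF leg_sum_cong] by (simp add: X_def e_def)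
  have "pcong 2 conj_sum (e * (of_nat p / mid_binom))" using conj_sum_cong by (simp add: e_def mult_ac)
  also have "pcong 2 \<dots> (e * (of_nat p / (2 * X)))" by (intro pcong_scale eZ pb)
  finally show "pcong 2 conj_sum ((-1) ^ m * (of_nat p / (2 * of_int x)))" by (simp add: X_def e_def)
qed

section \<open>Sums with two binomial coefficients\<close>

lemma unit_Suc_le: "k \<le> n \<Longrightarrow> unit (of_nat k + 1)"
  using unit_less[of "Suc k"] p_eq n_pos by (simp add: add.commute)

lemma sum_central_cong:
  assumes "\<And>k. k \<le> n \<Longrightarrow> f k \<in> Zp"
  shows "pcong 2 (\<Sum>k\<le>n. f k * central k) (\<Sum>k\<le>n. f k * legendre_coeff n k)"
  using assms by (intro pcong_sum pcong_scale pcong_sym[OF legendre_coeff_cong_central]) auto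

text \<open>
  These are the indices for which a carry occurs when \<open>k\<close> is added to itself in base \<open>p\<close>.
\<close>
lemma central_binomial_dvd: assumes "n < k" "k < p" shows "p dvd (2 * k) choose k"
proof -
  have "p dvd fact (2 * k)" using assms p_eq prime_p by (simp add: prime_dvd_fact_iff)
  then have "p dvd fact k * fact k * ((2 * k) choose k)" using binomial_fact_lemma[of k "2 * k"] by simp
  moreover have "\<not> p dvd fact k" using assms prime_p by (simp add: prime_dvd_fact_iff)
  ultimately show ?thesis using prime_p by (simp add: prime_dvd_mult_iff)
qed

lemma central_binomial_square_cong: assumes "n < k" "k < p" "c \<in> Zp"
  shows "pcong 2 (of_nat ((2 * k) choose k) ^ 2 * c) 0"
proof -
  obtain d where d: "(2 * k) choose k = p * d" using central_binomial_dvd[OF assms(1,2)] by blast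
  have "of_nat ((2 * k) choose k) ^ 2 * c = of_nat p ^ 2 * (of_nat d ^ 2 * c)"
    unfolding d by (simp add: power_mult_distrib)
  then show ?thesis using assms(3) by (simp only:) (intro pcong_p2 Zp_mult Zp_power Zp_of_nat)
qed

lemma sum_split: "(\<Sum>k = 0..p - 1. f k) = (\<Sum>k\<le>n. f k) + (\<Sum>k\<in>{n<..<p}. f k)" for f :: "nat \<Rightarrow> rat"
proof -
  have "{0..p - 1} = {..n} \<union> {n<..<p}" using p_eq by auto
  then show ?thesis by (simp only:) (rule sum.union_disjoint; auto)
qed

lemma pcong_sum_0: "(\<And>k. k \<in> S \<Longrightarrow> pcong 2 (f k) 0) \<Longrightarrow> pcong 2 (sum f S) 0"
  using pcong_sum[of S 2 f "\<lambda>_. 0"] by simp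

text \<open>
  Changing the base from -16 to 8 is the evaluation at \<open>t = -2\<close>.
\<close>
lemma central_8: "central k * (-2) ^ k = of_nat ((2 * k) choose k) ^ 2 / 8 ^ k"
proof -
  have "(- 16 :: rat) ^ k = 8 ^ k * (-2) ^ k" unfolding power_mult_distrib[symmetric] by simp
  then show ?thesis by (simp add: central_def)
qed

lemma Zp_minus_2_power [simp, intro]: "(- 2) ^ k \<in> Zp"
  by (intro Zp_power Zp_uminus Zp_numeral)

lemma Zp_inverse_Suc: "k \<le> n \<Longrightarrow> 1 / (of_nat k + 1) \<in> Zp"
  by (intro Zp_divide unit_Suc_le) auto

text \<open>
  The sums are evaluations at \<open>t = 1\<close>, except \<open>leg_sum_inv8\<close>, which is taken at \<open>t = -2\<close>.
\<close>
definition leg_sum_inv :: rat where "leg_sum_inv = (\<Sum>k\<le>n. legendre_coeff n k / (of_nat k + 1))"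
definition leg_sum_inv8 :: rat where "leg_sum_inv8 = (\<Sum>k\<le>n. legendre_coeff n k / (of_nat k + 1) * (-2) ^ k)"
definition leg_sum2 :: rat where "leg_sum2 = (\<Sum>k\<le>n. of_nat k ^ 2 * legendre_coeff n k)"

lemma Zp_leg_sum_variants [simp, intro]: "leg_sum_inv \<in> Zp" "leg_sum_inv8 \<in> Zp" "leg_sum2 \<in> Zp"
  unfolding leg_sum_inv_def leg_sum_inv8_def leg_sum2_def
  by (intro Zp_sum Zp_mult Zp_divide unit_Suc_le Zp_binomial Zp_minus_2_power Zp_power Zp_of_nat; simp)+

lemma N_mult_cong: "z \<in> Zp \<Longrightarrow> pcong 2 (of_nat n * (of_nat n + 1) * z) (- 1 / 4 * z)"
  by (rule pcong_scaleR[OF _ pcong_N])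

lemma leg_sum_inv_cong: "pcong 2 leg_sum_inv (- 8 * leg_sum1)"
proof -
  have "of_nat n * (of_nat n + 1) * leg_sum_inv = 2 * leg_sum1"
    using sum_legendre_over_Suc[of n 1] by (simp add: leg_sum_inv_def leg_sum1_def)
  then have "pcong 2 (2 * leg_sum1) (- 1 / 4 * leg_sum_inv)" using N_mult_cong[of leg_sum_inv] by simp
  then have "pcong 2 (- 4 * (2 * leg_sum1)) (- 4 * (- 1 / 4 * leg_sum_inv))" by (intro pcong_scale Zp_uminus Zp_numeral)
  then show ?thesis by (rule_tac pcong_sym) simp
qed

lemma leg_sum_inv8_cong: "pcong 2 leg_sum_inv8 (- 4 * leg_sum1)"
proof -
  have "of_nat n * (of_nat n + 1) * (- 2) * leg_sum_inv8 = - (2 * leg_sum1)"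
    using sum_legendre_over_Suc[of n "-2"] sum_legendre_reflect(2)[OF even_n] by (simp add: leg_sum_inv8_def leg_sum1_def)
  then have "of_nat n * (of_nat n + 1) * leg_sum_inv8 = leg_sum1" by simp
  then have "pcong 2 leg_sum1 (- 1 / 4 * leg_sum_inv8)" using N_mult_cong[of leg_sum_inv8] by simp
  then have "pcong 2 (- 4 * leg_sum1) (- 4 * (- 1 / 4 * leg_sum_inv8))" by (intro pcong_scale Zp_uminus Zp_numeral)
  then show ?thesis by (rule_tac pcong_sym) simp
qed

lemma leg_sum2_cong: "pcong 2 leg_sum2 (- (1 / 8) * conj_sum)"
proof -
  have "2 * leg_sum2 = of_nat n * (of_nat n + 1) * leg_sum - leg_sum1"
    using sum_legendre_square[of 1 n] by (simp add: leg_sum2_def leg_sum1_def leg_sum_def)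
  moreover have "pcong 2 (of_nat n * (of_nat n + 1) * leg_sum - leg_sum1) (- 1 / 4 * leg_sum - leg_sum1)"
    by (intro pcong_diff pcong_refl N_mult_cong) simp
  moreover have "- 1 / 4 * leg_sum - leg_sum1 = 2 * (- (1 / 8) * conj_sum)" by (simp add: conj_sum_def field_simps)
  ultimately show ?thesis using pcong_cancel[OF unit_numeral(2)] by simp
qed

lemma sum_square_8: "pcong 2 (\<Sum>k\<le>n. of_nat k ^ 2 * legendre_coeff n k * (-2) ^ k) (- (1 / 2) * leg_sum - 4 * leg_sum1)"
proof -
  define S where "S = (\<Sum>k\<le>n. of_nat k ^ 2 * legendre_coeff n k * (-2) ^ k)"
  have "- S + - 2 * (2 * leg_sum1) = of_nat n * (of_nat n + 1) * - 2 * leg_sum"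
    using sum_legendre_square[of "-2" n] unfolding sum_legendre_reflect[OF even_n] S_def leg_sum_def leg_sum1_def by simp
  then have "S = 2 * (of_nat n * (of_nat n + 1) * leg_sum) - 4 * leg_sum1" by (simp add: algebra_simps)
  also have "pcong 2 \<dots> (2 * (- 1 / 4 * leg_sum) - 4 * leg_sum1)" by (intro pcong_diff pcong_refl pcong_scale N_mult_cong) auto
  finally show ?thesis by (simp add: S_def)
qed

section \<open>Sums with three binomial coefficients\<close>

definition clausen_sum :: rat where "clausen_sum = (\<Sum>k\<le>n. clausen_coeff n k * 2 ^ k)"
definition clausen_sum_inv :: rat where "clausen_sum_inv = (\<Sum>k\<le>n. clausen_coeff n k / (of_nat k + 1) * 2 ^ k)"
definition clausen_sum_inv2 :: rat where "clausen_sum_inv2 = (\<Sum>k\<le>n. clausen_coeff n k / (of_nat k + 1) ^ 2 * 2 ^ k)"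

text \<open>
  All moments of the Clausen coefficients are quadratic in \<open>leg_sum\<close> and \<open>conj_sum\<close>. With \<open>A V \<equiv> p\<close>
  and \<open>V^2 \<equiv> 0\<close> they become linear in \<open>A^2\<close> and \<open>p\<close>.
\<close>
lemma triple_sums:
  assumes AV: "pcong 2 (leg_sum * conj_sum) (of_nat p)" and VV: "pcong 2 (conj_sum * conj_sum) 0"
  shows "clausen_sum = leg_sum * leg_sum" and "pcong 2 clausen_sum_inv (3 / 2 * (leg_sum * leg_sum) - of_nat p)" and "pcong 2 clausen_sum_inv2 (2 * (leg_sum * leg_sum) - 3 * of_nat p)"
proof -
  define a where "a = leg_sum * leg_sum"
  define P where "P = rat_of_nat p"
  define N :: rat where "N = of_nat n * (of_nat n + 1)"
  define V1 where "V1 = (\<Sum>k\<le>n. of_nat k * clausen_coeff n k * 2 ^ k)"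
  define V2 where "V2 = (\<Sum>k\<le>n. of_nat k ^ 2 * clausen_coeff n k * 2 ^ k)"
  have Z: "a \<in> Zp" "P \<in> Zp" "V1 \<in> Zp" "V2 \<in> Zp" "clausen_sum \<in> Zp" "clausen_sum_inv \<in> Zp" "clausen_sum_inv2 \<in> Zp"
    unfolding a_def P_def V1_def V2_def clausen_sum_def clausen_sum_inv_def clausen_sum_inv2_def
    by (intro Zp_sum Zp_mult Zp_divide unit_power unit_Suc_le Zp_binomial Zp_power Zp_of_nat Zp_numeral Zp_leg_sums; simp)+
  have clausen_sum: "clausen_sum = a"
    using clausen_sums(1)[of n] unfolding clausen_sum_def a_def leg_sum_def by (simp add: power2_eq_square)
  have "3 * V1 = 4 * leg_sum * leg_sum1" using clausen_sums(2)[of n] unfolding V1_def leg_sum_def leg_sum1_def .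
  then have "3 * V1 = leg_sum * conj_sum - a" by (simp add: conj_sum_def a_def algebra_simps)
  also have "pcong 2 \<dots> (P - a)" unfolding P_def by (intro pcong_diff AV pcong_refl)
  also have "P - a = 3 * ((P - a) / 3)" by (simp add: field_simps)
  finally have "pcong 2 (3 * V1) (3 * ((P - a) / 3))" .
  then have V1: "pcong 2 V1 ((P - a) / 3)" by (rule pcong_cancel[OF unit_numeral(3)])
  have "27 * V2 = 24 * leg_sum1 ^ 2 + 24 * leg_sum * leg_sum2 - 4 * leg_sum * leg_sum1"
    using clausen_sums(3)[of n] unfolding V2_def leg_sum_def leg_sum1_def leg_sum2_def .
  also have "\<dots> = 3 / 2 * (conj_sum * conj_sum - 2 * (leg_sum * conj_sum) + a) + 24 * (leg_sum * leg_sum2) - (leg_sum * conj_sum - a)"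
    by (simp add: conj_sum_def a_def algebra_simps power2_eq_square)
  also have "pcong 2 \<dots> (3 / 2 * (0 - 2 * P + a) + 24 * (- (1 / 8) * P) - (P - a))"
  proof (intro pcong_add pcong_diff pcong_scale pcong_refl)
    have "pcong 2 (leg_sum * leg_sum2) (leg_sum * (- (1 / 8) * conj_sum))" by (intro pcong_scale leg_sum2_cong) auto
    also have "leg_sum * (- (1 / 8) * conj_sum) = - (1 / 8) * (leg_sum * conj_sum)" by simp
    also have "pcong 2 \<dots> (- (1 / 8) * P)" unfolding P_def by (intro pcong_scale AV Zp_uminus Zp_divide) auto
    finally show "pcong 2 (leg_sum * leg_sum2) (- (1 / 8) * P)" .
  qed (auto simp: P_def AV VV intro!: Zp_divide)
  also have "3 / 2 * (0 - 2 * P + a) + 24 * (- (1 / 8) * P) - (P - a) = 27 * (5 / 54 * a - 7 / 27 * P)"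
    by (simp add: field_simps)
  finally have c27: "pcong 2 (27 * V2) (27 * (5 / 54 * a - 7 / 27 * P))" .
  (* 27 is a unit as a product of units. *)
  have "27 * z = 3 * (3 * (3 * z))" for z :: rat by simp
  then have "pcong 2 (3 * (3 * (3 * V2))) (3 * (3 * (3 * (5 / 54 * a - 7 / 27 * P))))"
    using c27 by (simp only:)
  from pcong_cancel[OF unit_numeral(3) pcong_cancel[OF unit_numeral(3) pcong_cancel[OF unit_numeral(3) this]]]
  have V2: "pcong 2 V2 (5 / 54 * a - 7 / 27 * P)" .
  have e1: "4 * (N * clausen_sum_inv) = 8 * (N * clausen_sum) - 9 * V2 - 4 * V1"
    using sum_clausen_over_Suc(1)[of n] unfolding N_def clausen_sum_def V1_def V2_def clausen_sum_inv_def by (simp only: mult.assoc)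
  have e2: "pcong 2 (8 * (N * clausen_sum) - 9 * V2 - 4 * V1) (8 * (- 1 / 4 * a) - 9 * (5 / 54 * a - 7 / 27 * P) - 4 * ((P - a) / 3))"
    unfolding clausen_sum N_def using Z by (intro pcong_diff pcong_scale N_mult_cong V2 V1) auto
  have e3: "pcong 2 (4 * (N * clausen_sum_inv)) (4 * (- 1 / 4 * clausen_sum_inv))" unfolding N_def using Z by (intro pcong_scale N_mult_cong) auto
  have "pcong 2 (- (4 * (- 1 / 4 * clausen_sum_inv))) (- (8 * (- 1 / 4 * a) - 9 * (5 / 54 * a - 7 / 27 * P) - 4 * ((P - a) / 3)))"
    by (rule pcong_uminus[OF pcong_trans[OF pcong_sym[OF e3[unfolded e1]] e2]])
  also have "- (8 * (- 1 / 4 * a) - 9 * (5 / 54 * a - 7 / 27 * P) - 4 * ((P - a) / 3)) = 3 / 2 * a - P"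
    by (simp add: field_simps)
  finally have clausen_sum_inv: "pcong 2 clausen_sum_inv (3 / 2 * a - P)" by simp
  have "V1 = 8 * (N * clausen_sum_inv) - 4 * (N * clausen_sum_inv2) - 8 * V1 + 4 * clausen_sum - 4 * clausen_sum_inv"
    using sum_clausen_over_Suc(2)[of n] unfolding N_def clausen_sum_def V1_def clausen_sum_inv2_def clausen_sum_inv_def by (simp only: mult.assoc)
  then have e4: "- 4 * (N * clausen_sum_inv2) = 9 * V1 - 8 * (N * clausen_sum_inv) + 4 * clausen_sum_inv - 4 * clausen_sum" by simp
  have e5: "pcong 2 (9 * V1 - 8 * (N * clausen_sum_inv) + 4 * clausen_sum_inv - 4 * clausen_sum) (9 * ((P - a) / 3) - 8 * (- 1 / 4 * clausen_sum_inv) + 4 * clausen_sum_inv - 4 * clausen_sum)"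
    unfolding N_def using Z by (intro pcong_add pcong_diff pcong_scale V1 N_mult_cong pcong_refl) auto
  have e6: "pcong 2 (- 4 * (N * clausen_sum_inv2)) (- 4 * (- 1 / 4 * clausen_sum_inv2))" unfolding N_def using Z by (intro pcong_scale N_mult_cong) auto
  have "pcong 2 (- 4 * (- 1 / 4 * clausen_sum_inv2)) (9 * ((P - a) / 3) - 8 * (- 1 / 4 * clausen_sum_inv) + 4 * clausen_sum_inv - 4 * clausen_sum)"
    by (rule pcong_trans[OF pcong_sym[OF e6[unfolded e4]] e5])
  moreover have "9 * ((P - a) / 3) - 8 * (- 1 / 4 * clausen_sum_inv) + 4 * clausen_sum_inv - 4 * clausen_sum = 3 * (P - a) + 6 * clausen_sum_inv - 4 * a"
    unfolding clausen_sum by (simp add: field_simps)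
  ultimately have "pcong 2 (- 4 * (- 1 / 4 * clausen_sum_inv2)) (3 * (P - a) + 6 * clausen_sum_inv - 4 * a)" by (simp only:)
  then have "pcong 2 clausen_sum_inv2 (3 * (P - a) + 6 * clausen_sum_inv - 4 * a)" by simp
  also have "pcong 2 \<dots> (3 * (P - a) + 6 * (3 / 2 * a - P) - 4 * a)" by (intro pcong_add pcong_diff pcong_refl pcong_scale clausen_sum_inv) auto
  finally have clausen_sum_inv2: "pcong 2 clausen_sum_inv2 (2 * a - 3 * P)" by (simp add: algebra_simps)
  show "clausen_sum = leg_sum * leg_sum" "pcong 2 clausen_sum_inv (3 / 2 * (leg_sum * leg_sum) - of_nat p)" "pcong 2 clausen_sum_inv2 (2 * (leg_sum * leg_sum) - 3 * of_nat p)"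
    using clausen_sum clausen_sum_inv clausen_sum_inv2 by (simp_all add: a_def P_def)
qed

text \<open>
  The factor \<open>2^k = (t (1 + t))^k\<close> at \<open>t = 1\<close> turns base -16 into base -8.
\<close>
lemma triple_term: assumes "k \<le> n" "c \<in> Zp"
  shows "pcong 2 (of_nat ((2 * k) choose k) ^ 3 / (- 8) ^ k * c) (clausen_coeff n k * 2 ^ k * c)"
proof -
  have p8: "(- 16 :: rat) ^ k = (- 8) ^ k * 2 ^ k" unfolding power_mult_distrib[symmetric] by simp
  have "of_nat ((2 * k) choose k) ^ 3 / (- 8) ^ k * c = central k * (of_nat ((2 * k) choose k) * 2 ^ k * c)"
    unfolding central_def p8 by (simp add: power3_eq_cube power2_eq_square)
  also have "pcong 2 \<dots> (legendre_coeff n k * (of_nat ((2 * k) choose k) * 2 ^ k * c))"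
    using assms by (intro pcong_scaleR pcong_sym[OF legendre_coeff_cong_central] Zp_mult) auto
  finally show ?thesis by (simp add: clausen_coeff_def mult.assoc)
qed

lemma triple_sum_1:
  "pcong 2 (\<Sum>k = 0..p - 1. of_nat ((2 * k) choose k) ^ 2 * of_nat ((2 * k) choose (k + 1)) / (- 8) ^ k) (clausen_sum - clausen_sum_inv)"
proof -
  define f where "f k = of_nat ((2 * k) choose k) ^ 2 * of_nat ((2 * k) choose (k + 1)) / (- 8 :: rat) ^ k" for k
  have 1: "pcong 2 (\<Sum>k\<le>n. f k) (\<Sum>k\<le>n. clausen_coeff n k * 2 ^ k * (1 - 1 / (of_nat k + 1)))"
  proof (rule pcong_sum)
    fix k assume "k \<in> {..n}"
    then have k: "k \<le> n" by simp
    have nz: "rat_of_nat k + 1 \<noteq> 0" using of_nat_neq_0[of k] by (simp add: add.commute)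
    have "f k = of_nat ((2 * k) choose k) ^ 3 / (- 8) ^ k * (1 - 1 / (of_nat k + 1))"
      unfolding f_def choose_Suc_ratio using nz by (simp add: field_simps power3_eq_cube power2_eq_square)
    also have "pcong 2 \<dots> (clausen_coeff n k * 2 ^ k * (1 - 1 / (of_nat k + 1)))"
      by (intro triple_term k Zp_diff Zp_inverse_Suc) auto
    finally show "pcong 2 (f k) (clausen_coeff n k * 2 ^ k * (1 - 1 / (of_nat k + 1)))" .
  qed
  have 2: "pcong 2 (\<Sum>k\<in>{n<..<p}. f k) 0"
  proof (rule pcong_sum_0)
    fix k assume k: "k \<in> {n<..<p}"
    have "f k = of_nat ((2 * k) choose k) ^ 2 * (of_nat ((2 * k) choose (k + 1)) / (- 8) ^ k)" by (simp add: f_def)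
    then show "pcong 2 (f k) 0" using k
      by (simp only:) (intro central_binomial_square_cong Zp_divide Zp_of_nat unit_power unit_uminus unit_numeral; simp)
  qed
  have "(\<Sum>k\<le>n. clausen_coeff n k * 2 ^ k * (1 - 1 / (of_nat k + 1))) = clausen_sum - clausen_sum_inv"
    unfolding clausen_sum_def clausen_sum_inv_def sum_subtractf[symmetric] by (intro sum.cong refl) (simp add: right_diff_distrib)
  then have "pcong 2 ((\<Sum>k\<le>n. f k) + (\<Sum>k\<in>{n<..<p}. f k)) (clausen_sum - clausen_sum_inv + 0)" using 1 2 by (intro pcong_add) simp_all
  then show ?thesis unfolding sum_split[symmetric] f_def by simp
qed

lemma Zp_fact: "fact k \<in> Zp" using Zp_of_nat[of "fact k"] by simp

text \<open>
  By symmetry the lower index may be taken as \<open>p - 2\<close>, and \<open>2 (p - 1) \<equiv> p - 2\<close> modulo \<open>p\<close>.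
\<close>
lemma last_binomial: "pcong 1 (of_nat ((2 * (p - 1)) choose p)) 1"
proof -
  define N where "N = 2 * (p - 1)"
  have p2: "p \<ge> 2" using p_ge by simp
  have sym: "N choose p = N choose (p - 2)"
  proof -
    have "p \<le> N" "N - p = p - 2" using p2 by (auto simp: N_def)
    then show ?thesis using binomial_symmetric[of p N] by simp
  qed
  have "pcong 1 (\<Prod>i<p - 2. rat_of_nat N - of_nat i) (\<Prod>i<p - 2. rat_of_nat (p - 2) - of_nat i)"
  proof -
    have "pcong 1 (\<Prod>i<k. rat_of_nat N - of_nat i) (\<Prod>i<k. rat_of_nat (p - 2) - of_nat i)" for k
    proof (induction k)
      case (Suc k)
      have "pcong 1 (rat_of_nat N - of_nat k) (rat_of_nat (p - 2) - of_nat k)"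
        using p2 by (intro pcongI[of 1]) (auto simp: N_def of_nat_diff)
      moreover have "(\<Prod>i<k. rat_of_nat (p - 2) - of_nat i) \<in> Zp" unfolding falling_product by (intro Zp_mult Zp_fact Zp_of_nat)
      ultimately show ?case unfolding prod.lessThan_Suc by (intro pcong_mult Suc) auto
    qed simp
    then show ?thesis .
  qed
  then have "pcong 1 (fact (p - 2) * of_nat (N choose (p - 2))) (fact (p - 2) * 1)"
    unfolding falling_product by simp
  then have "pcong 1 (of_nat (N choose (p - 2))) 1" by (rule pcong_cancel[OF unit_fact, rotated]) (use p2 in simp)
  then show ?thesis unfolding N_def[symmetric] sym .
qed

text \<open>
  At \<open>k = p - 1\<close> the denominator \<open>k + 1 = p\<close> removes the divisibility of \<open>C(2k,k+1)\<close> by \<open>p\<close>, so the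
  term is only divisible by \<open>p\<close> once. It equals \<open>p z^3 / ((p - 1) (-8)^(p-1))\<close> with \<open>z = C(2p-2,p) \<equiv> 1\<close>.
\<close>
lemma last_term:
  "pcong 2 (of_nat ((2 * (p - 1)) choose (p - 1)) * of_nat ((2 * (p - 1)) choose (p - 1 + 1)) ^ 2 / (- 8) ^ (p - 1)) (- of_nat p)"
proof -
  define z where "z = rat_of_nat ((2 * (p - 1)) choose p)"
  have p1: "p - 1 + 1 = p" "rat_of_nat (p - 1) = of_nat p - 1" using p_ge by (simp_all add: of_nat_diff)
  have z: "pcong 1 z 1" unfolding z_def by (rule last_binomial)
  have zZ: "z \<in> Zp" by (simp add: z_def)
  have e: "of_nat p * z = (of_nat p - 1) * rat_of_nat ((2 * (p - 1)) choose (p - 1))"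
    using rat_binomial_Suc[of "p - 1" "2 * (p - 1)"] p_ge by (simp add: z_def of_nat_diff algebra_simps)
  have "[(- 8 :: int) ^ (2 * n) = 1] (mod int p)"
  proof (rule unit_power_cong_1)
    have "\<not> p dvd 2" using p_ge by (auto dest: dvd_imp_le)
    then have "\<not> p dvd 2 ^ 3" using prime_p prime_dvd_power by blast
    then have "\<not> int p dvd int (2 ^ 3)" by (simp only: int_dvd_int_iff not_False_eq_True)
    then show "\<not> int p dvd - 8" by simp
  qed
  then have "pcong 1 (of_int ((- 8) ^ (2 * n))) (of_int 1)" by (rule_tac pcong_of_int) (simp only: power_one_right)
  then have q: "pcong 1 ((- 8) ^ (p - 1)) 1" by (simp add: p_eq)
  define Q where "Q = (of_nat p - 1) * (- 8 :: rat) ^ (p - 1)"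
  have Q1: "pcong 1 Q ((0 - 1) * 1)"
  proof -
    have "pcong 1 (of_nat p * 1) (0 :: rat)" by (rule pcong_p1) simp
    then show ?thesis unfolding Q_def by (intro pcong_mult pcong_diff q) (auto intro!: Zp_power)
  qed
  have uQ: "unit Q" by (rule pcong_unit[OF Q1]) (simp add: unit_uminus)
  have "of_nat p - 1 \<noteq> (0 :: rat)" using uQ by (auto simp: Q_def unit_def)
  then have C: "rat_of_nat ((2 * (p - 1)) choose (p - 1)) = of_nat p * z / (of_nat p - 1)"
    using e by (simp add: field_simps)
  have "pcong 1 (z * (z * z)) (1 * (1 * 1))" using zZ by (intro pcong_mult z) auto
  also have "pcong 1 (1 * (1 * 1)) (- 1 * ((0 - 1) * 1))" by simp
  also have "pcong 1 \<dots> (- 1 * Q)" by (intro pcong_scale pcong_sym[OF Q1]) auto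
  finally have "pcong 1 (z * (z * z) / Q) (- 1 * Q / Q)" by (intro pcong_divide uQ)
  then have "pcong 1 (z * (z * z) / Q) (- 1)" using unit_nonzero[OF uQ] by simp
  from pcong_p_mult[OF this] show ?thesis
    unfolding p1(1) C z_def[symmetric] by (simp add: Q_def power2_eq_square mult.assoc)
qed

text \<open>
  Here \<open>C(2k,k+1)^2 = (1 - 1 / (k + 1))^2 C(2k,k)^2\<close>. Beyond \<open>n\<close> all terms but the
  last one vanish modulo \<open>p^2\<close>.
\<close>
lemma triple_sum_2:
  "pcong 2 (\<Sum>k = 0..p - 1. of_nat ((2 * k) choose k) * of_nat ((2 * k) choose (k + 1)) ^ 2 / (- 8) ^ k)
    (clausen_sum - 2 * clausen_sum_inv + clausen_sum_inv2 - of_nat p)"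
proof -
  define f where "f k = of_nat ((2 * k) choose k) * of_nat ((2 * k) choose (k + 1)) ^ 2 / (- 8 :: rat) ^ k" for k
  have f: "f k = of_nat ((2 * k) choose k) ^ 3 / (- 8) ^ k * (of_nat k / (of_nat k + 1)) ^ 2" for k
    unfolding f_def choose_Suc_ratio by (simp add: power3_eq_cube power2_eq_square mult_ac)
  have "pcong 2 (\<Sum>k\<le>n. f k) (\<Sum>k\<le>n. clausen_coeff n k * 2 ^ k * (of_nat k / (of_nat k + 1)) ^ 2)"
    unfolding f by (intro pcong_sum triple_term Zp_power Zp_divide unit_Suc_le Zp_of_nat) auto
  also have "(\<Sum>k\<le>n. clausen_coeff n k * 2 ^ k * (of_nat k / (of_nat k + 1)) ^ 2) = clausen_sum - 2 * clausen_sum_inv + clausen_sum_inv2"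
    unfolding clausen_sum_def clausen_sum_inv_def clausen_sum_inv2_def sum_distrib_left sum_subtractf[symmetric] sum.distrib[symmetric]
  proof (rule sum.cong[OF refl])
    fix k
    define K where "K = rat_of_nat k + 1"
    have K: "K \<noteq> 0" "rat_of_nat k = K - 1" using of_nat_neq_0[of k] by (simp_all add: K_def add.commute)
    have q: "(rat_of_nat k / K) ^ 2 = 1 - 2 / K + 1 / K ^ 2"
      unfolding K(2) using K(1) by (simp add: field_simps power2_eq_square)
    show "clausen_coeff n k * 2 ^ k * (of_nat k / (of_nat k + 1)) ^ 2
        = clausen_coeff n k * 2 ^ k - 2 * (clausen_coeff n k / (of_nat k + 1) * 2 ^ k) + clausen_coeff n k / (of_nat k + 1) ^ 2 * 2 ^ k"
      unfolding K_def[symmetric] q by (simp add: algebra_simps)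
  qed
  finally have 1: "pcong 2 (\<Sum>k\<le>n. f k) (clausen_sum - 2 * clausen_sum_inv + clausen_sum_inv2)" .
  have 2: "pcong 2 (\<Sum>k\<in>{n<..<p - 1}. f k) 0"
  proof (rule pcong_sum_0)
    fix k assume k: "k \<in> {n<..<p - 1}"
    have "Suc k < p" using k by auto
    then have u: "unit (of_nat k + 1)" using unit_less[of "Suc k"] by (simp add: add.commute)
    have "f k = of_nat ((2 * k) choose k) ^ 2 * (of_nat ((2 * k) choose k) / (- 8) ^ k * (of_nat k / (of_nat k + 1)) ^ 2)"
      unfolding f by (simp add: power3_eq_cube power2_eq_square mult_ac)
    moreover have "pcong 2 \<dots> 0"
      using k u by (intro central_binomial_square_cong Zp_mult Zp_power Zp_divide Zp_of_nat unit_power unit_uminus unit_numeral) auto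
    ultimately show "pcong 2 (f k) 0" by simp
  qed
  have 3: "pcong 2 (f (p - 1)) (- of_nat p)" unfolding f_def by (rule last_term)
  have "{n<..<p} = insert (p - 1) {n<..<p - 1}" using p_eq n_pos by auto
  then have "(\<Sum>k\<in>{n<..<p}. f k) = f (p - 1) + (\<Sum>k\<in>{n<..<p - 1}. f k)" by simp
  then have "(\<Sum>k = 0..p - 1. f k) = (\<Sum>k\<le>n. f k) + (f (p - 1) + (\<Sum>k\<in>{n<..<p - 1}. f k))"
    by (simp only: sum_split)
  moreover have "pcong 2 \<dots> ((clausen_sum - 2 * clausen_sum_inv + clausen_sum_inv2) + (- of_nat p + 0))" by (intro pcong_add 1 2 3)
  ultimately show ?thesis unfolding f_def by simp
qed

section \<open>The sums over k as Legendre moments\<close>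

lemma sum_linear_8:
  "pcong 2 (\<Sum>k = 0..n. of_nat (k + 1) / 8 ^ k * of_nat ((2 * k) choose k) ^ 2) (leg_sum + 2 * leg_sum1)"
proof -
  have "(\<Sum>k = 0..n. of_nat (k + 1) / 8 ^ k * of_nat ((2 * k) choose k) ^ 2) = (\<Sum>k\<le>n. (of_nat k + 1) * (-2) ^ k * central k)"
    unfolding atLeast0AtMost
  proof (rule sum.cong[OF refl])
    fix k
    have "(of_nat k + 1) * (-2) ^ k * central k = (of_nat k + 1) * (central k * (-2) ^ k)" by (simp only: mult_ac)
    then show "of_nat (k + 1) / 8 ^ k * of_nat ((2 * k) choose k) ^ 2 = (of_nat k + 1) * (-2) ^ k * central k"
      unfolding central_8 by (simp add: add.commute)
  qed
  also have "pcong 2 \<dots> (\<Sum>k\<le>n. (of_nat k + 1) * (-2) ^ k * legendre_coeff n k)"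
    by (intro sum_central_cong Zp_mult Zp_add) auto
  also have "(\<Sum>k\<le>n. (of_nat k + 1) * (-2) ^ k * legendre_coeff n k) = (\<Sum>k\<le>n. legendre_coeff n k * (-2) ^ k) + (\<Sum>k\<le>n. of_nat k * legendre_coeff n k * (-2) ^ k)"
    unfolding sum.distrib[symmetric] by (intro sum.cong refl) (simp add: algebra_simps)
  also have "\<dots> = leg_sum + 2 * leg_sum1"
    unfolding sum_legendre_reflect[OF even_n] leg_sum_def leg_sum1_def ..
  finally show ?thesis .
qed

lemma sum_linear_16:
  "pcong 2 (\<Sum>k = 0..n. of_nat (2 * k + 1) / (- 16) ^ k * of_nat ((2 * k) choose k) ^ 2) (leg_sum + 2 * leg_sum1)"
proof -
  have "(\<Sum>k = 0..n. of_nat (2 * k + 1) / (- 16) ^ k * of_nat ((2 * k) choose k) ^ 2) = (\<Sum>k\<le>n. (2 * of_nat k + 1) * central k)"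
    unfolding atLeast0AtMost by (rule sum.cong[OF refl]) (simp add: central_def)
  also have "pcong 2 \<dots> (\<Sum>k\<le>n. (2 * of_nat k + 1) * legendre_coeff n k)"
    by (intro sum_central_cong Zp_add Zp_mult) auto
  also have "(\<Sum>k\<le>n. (2 * of_nat k + 1) * legendre_coeff n k) = leg_sum + 2 * leg_sum1"
    unfolding leg_sum_def leg_sum1_def sum_distrib_left sum.distrib[symmetric] by (intro sum.cong refl) (simp add: algebra_simps)
  finally show ?thesis .
qed

lemma sum_catalan_8: "pcong 2 (\<Sum>k = 0..n. of_nat ((2 * k) choose k) * catalan k / 8 ^ k) leg_sum_inv8"
proof -
  have "(\<Sum>k = 0..n. of_nat ((2 * k) choose k) * catalan k / 8 ^ k) = (\<Sum>k\<le>n. (1 / (of_nat k + 1)) * (-2) ^ k * central k)"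
    unfolding atLeast0AtMost
  proof (rule sum.cong[OF refl])
    fix k
    have "(1 / (of_nat k + 1)) * (-2) ^ k * central k = (1 / (of_nat k + 1)) * (central k * (-2) ^ k)" by (simp only: mult_ac)
    then show "of_nat ((2 * k) choose k) * catalan k / 8 ^ k = (1 / (of_nat k + 1)) * (-2) ^ k * central k"
      unfolding central_8 catalan_eq by (simp add: power2_eq_square)
  qed
  also have "pcong 2 \<dots> (\<Sum>k\<le>n. (1 / (of_nat k + 1)) * (-2) ^ k * legendre_coeff n k)"
    by (intro sum_central_cong Zp_mult Zp_inverse_Suc) auto
  also have "\<dots> = leg_sum_inv8" unfolding leg_sum_inv8_def by (intro sum.cong refl) (simp add: mult_ac)
  finally show ?thesis .
qed

lemma sum_catalan_16: "pcong 2 (\<Sum>k = 0..n. of_nat ((2 * k) choose k) * catalan k / (- 16) ^ k) leg_sum_inv"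
proof -
  have "(\<Sum>k = 0..n. of_nat ((2 * k) choose k) * catalan k / (- 16) ^ k) = (\<Sum>k\<le>n. (1 / (of_nat k + 1)) * central k)"
    unfolding atLeast0AtMost by (rule sum.cong[OF refl]) (simp add: catalan_eq central_def power2_eq_square)
  also have "pcong 2 \<dots> (\<Sum>k\<le>n. (1 / (of_nat k + 1)) * legendre_coeff n k)"
    by (intro sum_central_cong Zp_inverse_Suc)
  also have "\<dots> = leg_sum_inv" unfolding leg_sum_inv_def by (intro sum.cong refl) simp
  finally show ?thesis .
qed

lemma schroeder_eq: "schroeder n = leg_sum_inv"
  unfolding schroeder_def leg_sum_inv_def legendre_coeff_eq_choose catalan_eq by (intro sum.cong refl) simp

lemma sum_k_16: "pcong 2 (\<Sum>k = 0..n. of_nat k * of_nat ((2 * k) choose k) ^ 2 / (- 16) ^ k) leg_sum1"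
proof -
  have "(\<Sum>k = 0..n. of_nat k * of_nat ((2 * k) choose k) ^ 2 / (- 16) ^ k) = (\<Sum>k\<le>n. of_nat k * central k)"
    unfolding atLeast0AtMost by (rule sum.cong[OF refl]) (simp add: central_def)
  also have "pcong 2 \<dots> leg_sum1" unfolding leg_sum1_def by (intro sum_central_cong) auto
  finally show ?thesis .
qed

lemma sum_k2_16: "pcong 2 (\<Sum>k = 0..n. of_nat k ^ 2 * of_nat ((2 * k) choose k) ^ 2 / (- 16) ^ k) leg_sum2"
proof -
  have "(\<Sum>k = 0..n. of_nat k ^ 2 * of_nat ((2 * k) choose k) ^ 2 / (- 16) ^ k) = (\<Sum>k\<le>n. of_nat k ^ 2 * central k)"
    unfolding atLeast0AtMost by (rule sum.cong[OF refl]) (simp add: central_def)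
  also have "pcong 2 \<dots> leg_sum2" unfolding leg_sum2_def by (intro sum_central_cong Zp_power) auto
  finally show ?thesis .
qed

lemma sum_k_8: "pcong 2 (\<Sum>k = 0..p - 1. of_nat k * of_nat ((2 * k) choose k) ^ 2 / 8 ^ k) (2 * leg_sum1)"
proof -
  define f where "f k = of_nat k * of_nat ((2 * k) choose k) ^ 2 / (8 :: rat) ^ k" for k
  have "(\<Sum>k\<le>n. f k) = (\<Sum>k\<le>n. of_nat k * (-2) ^ k * central k)"
  proof (rule sum.cong[OF refl])
    fix k
    have "of_nat k * (-2) ^ k * central k = of_nat k * (central k * (-2) ^ k)" by (simp only: mult_ac)
    then show "f k = of_nat k * (-2) ^ k * central k" unfolding central_8 f_def by simp
  qed
  also have "pcong 2 \<dots> (\<Sum>k\<le>n. of_nat k * (-2) ^ k * legendre_coeff n k)"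
    by (intro sum_central_cong Zp_mult) auto
  also have "\<dots> = 2 * leg_sum1"
    unfolding leg_sum1_def sum_legendre_reflect(2)[OF even_n, symmetric] by (intro sum.cong refl) (simp add: mult_ac)
  finally have 1: "pcong 2 (\<Sum>k\<le>n. f k) (2 * leg_sum1)" .
  have 2: "pcong 2 (\<Sum>k\<in>{n<..<p}. f k) 0"
  proof (rule pcong_sum_0)
    fix k assume k: "k \<in> {n<..<p}"
    have "f k = of_nat ((2 * k) choose k) ^ 2 * (of_nat k / 8 ^ k)" by (simp add: f_def)
    then show "pcong 2 (f k) 0" using k
      by (simp only:) (intro central_binomial_square_cong Zp_divide Zp_of_nat unit_power unit_numeral; simp)
  qed
  have "pcong 2 ((\<Sum>k\<le>n. f k) + (\<Sum>k\<in>{n<..<p}. f k)) (2 * leg_sum1 + 0)" by (intro pcong_add 1 2)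
  then show ?thesis unfolding sum_split[symmetric] f_def by simp
qed

lemma sum_k2_8: "pcong 2 (\<Sum>k = 0..n. of_nat k ^ 2 * of_nat ((2 * k) choose k) ^ 2 / 8 ^ k) (- (1 / 2) * leg_sum - 4 * leg_sum1)"
proof -
  have "(\<Sum>k = 0..n. of_nat k ^ 2 * of_nat ((2 * k) choose k) ^ 2 / 8 ^ k) = (\<Sum>k\<le>n. of_nat k ^ 2 * (-2) ^ k * central k)"
    unfolding atLeast0AtMost
  proof (rule sum.cong[OF refl])
    fix k
    have "of_nat k ^ 2 * (-2) ^ k * central k = of_nat k ^ 2 * (central k * (-2) ^ k)" by (simp only: mult_ac)
    then show "of_nat k ^ 2 * of_nat ((2 * k) choose k) ^ 2 / 8 ^ k = of_nat k ^ 2 * (-2) ^ k * central k"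
      unfolding central_8 by simp
  qed
  also have "pcong 2 \<dots> (\<Sum>k\<le>n. of_nat k ^ 2 * (-2) ^ k * legendre_coeff n k)"
    by (intro sum_central_cong Zp_mult Zp_power) auto
  also have "\<dots> = (\<Sum>k\<le>n. of_nat k ^ 2 * legendre_coeff n k * (-2) ^ k)" by (intro sum.cong refl) (simp add: mult_ac)
  also have "pcong 2 \<dots> (- (1 / 2) * leg_sum - 4 * leg_sum1)" by (rule sum_square_8)
  finally show ?thesis .
qed

lemma rat_congI2: "pcong 2 r t \<Longrightarrow> pcong 2 s t \<Longrightarrow> t \<in> Zp \<Longrightarrow> rat_cong p 2 r s"
  by (rule rat_congI[OF pcong_Zp pcong_Zp pcong_trans[OF _ pcong_sym]])

section \<open>The values in terms of x\<close>

text \<open>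
  Substitution of \<open>A = e (2 x - r / 2)\<close> and \<open>V = e r / 2\<close> with \<open>r = p / x\<close>, whose square is
  negligible.
\<close>
lemma canonical_values:
  assumes xy: "int p = x ^ 2 + y ^ 2" "[x = 1] (mod 4)"
  defines "X \<equiv> rat_of_int x" and "e \<equiv> (- 1 :: rat) ^ m"
  shows "X \<in> Zp" "of_nat p / X \<in> Zp" "of_nat p / (4 * X) \<in> Zp" "of_nat p / (16 * X) \<in> Zp"
    and "pcong 2 (leg_sum + 2 * leg_sum1) (e * X)"
    and "pcong 2 (- 4 * leg_sum1) (e * (2 * X - of_nat p / X))"
    and "pcong 2 (- 8 * leg_sum1) (e * 2 * (2 * X - of_nat p / X))"
    and "pcong 2 (- (1 / 2) * leg_sum - 4 * leg_sum1) (e * (X - 3 * of_nat p / (4 * X)))"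
    and "pcong 2 leg_sum2 ((- 1) ^ (m + 1) * (of_nat p / (16 * X)))"
    and "pcong 2 (clausen_sum - clausen_sum_inv) (2 * of_nat p - 2 * X ^ 2)"
    and "pcong 2 (clausen_sum - 2 * clausen_sum_inv + clausen_sum_inv2 - of_nat p) (- 2 * of_nat p)"
proof -
  define P where "P = rat_of_nat p"
  define r where "r = P / X"
  have uX: "unit X" and leg_sum: "pcong 2 leg_sum (e * (2 * X - P / (2 * X)))" and conj_sum: "pcong 2 conj_sum (e * (P / (2 * X)))"
    using leg_sum_and_conj_sum_values[OF xy] unfolding X_def e_def P_def by auto
  have X0: "X \<noteq> 0" by (rule unit_nonzero[OF uX])
  have rr: "P / (2 * X) = r / 2" "P / (4 * X) = r / 4" "P / (16 * X) = r / 16" "P = X * r"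
    using X0 by (simp_all add: r_def field_simps)
  have e2: "e * e = 1" by (simp add: e_def power_mult_distrib[symmetric])
  have Z: "X \<in> Zp" "r \<in> Zp" "e \<in> Zp" "P \<in> Zp"
    unfolding r_def by (auto intro: unit_Zp uX simp: e_def P_def intro!: Zp_divide)
  have XiZ: "inverse X \<in> Zp" using uX by (simp add: unit_def)
  show "X \<in> Zp" by (rule Z)
  show "of_nat p / X \<in> Zp" using Z(2) by (simp add: r_def P_def)
  have "r / 4 \<in> Zp" "r / 16 \<in> Zp" by (intro Zp_divide Z unit_numeral)+
  then show "of_nat p / (4 * X) \<in> Zp" "of_nat p / (16 * X) \<in> Zp"
    by (simp_all only: P_def[symmetric] rr(2,3))
  note leg_sum' = leg_sum[unfolded rr(1)] and conj_sum' = conj_sum[unfolded rr(1)]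
  have rp: "r * r = of_nat p ^ 2 * (inverse X * inverse X)"
    by (simp add: r_def P_def power2_eq_square divide_inverse)
  have r2: "pcong 2 (r * r * c) 0" if "c \<in> Zp" for c
    unfolding rp mult.assoc using XiZ that by (intro pcong_p2 Zp_mult)
  have "pcong 2 (4 * leg_sum1) (e * (r / 2) - e * (2 * X - r / 2))"
    using pcong_diff[OF conj_sum' leg_sum'] by (simp add: conj_sum_def)
  also have "e * (r / 2) - e * (2 * X - r / 2) = - (e * (2 * X - r))" by (simp add: algebra_simps)
  finally have M: "pcong 2 (4 * leg_sum1) (- (e * (2 * X - r)))" .
  from pcong_uminus[OF M] have M': "pcong 2 (- 4 * leg_sum1) (e * (2 * X - r))" by simp
  then show "pcong 2 (- 4 * leg_sum1) (e * (2 * X - of_nat p / X))" by (simp add: r_def P_def)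
  have "pcong 2 (2 * (- 4 * leg_sum1)) (2 * (e * (2 * X - r)))" by (intro pcong_scale M') auto
  then show "pcong 2 (- 8 * leg_sum1) (e * 2 * (2 * X - of_nat p / X))" by (simp add: r_def P_def mult_ac)
  have "pcong 2 (leg_sum + conj_sum) (e * (2 * X - r / 2) + e * (r / 2))" by (intro pcong_add leg_sum' conj_sum')
  moreover have "leg_sum + conj_sum = 2 * (leg_sum + 2 * leg_sum1)" "e * (2 * X - r / 2) + e * (r / 2) = 2 * (e * X)"
    by (simp_all add: conj_sum_def algebra_simps)
  ultimately have "pcong 2 (2 * (leg_sum + 2 * leg_sum1)) (2 * (e * X))" by (simp only:)
  then show "pcong 2 (leg_sum + 2 * leg_sum1) (e * X)" by (rule pcong_cancel[OF unit_numeral(2)])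
  have h2: "- (1 / 2) \<in> Zp" "- (1 / 8) \<in> Zp" by (intro Zp_uminus Zp_divide; simp)+
  have "pcong 2 (- (1 / 2) * leg_sum + - 4 * leg_sum1) (- (1 / 2) * (e * (2 * X - r / 2)) + e * (2 * X - r))"
    by (intro pcong_add pcong_scale h2 leg_sum' M')
  moreover have "- (1 / 2) * (e * (2 * X - r / 2)) + e * (2 * X - r) = e * (X - 3 * P / (4 * X))"
  proof -
    have "3 * P / (4 * X) = 3 * (r / 4)" unfolding rr(2)[symmetric] by simp
    then show ?thesis by (simp only:) (simp add: algebra_simps)
  qed
  ultimately show "pcong 2 (- (1 / 2) * leg_sum - 4 * leg_sum1) (e * (X - 3 * of_nat p / (4 * X)))" by (simp add: P_def)
  have "pcong 2 leg_sum2 (- (1 / 8) * (e * (r / 2)))" by (rule pcong_trans[OF leg_sum2_cong pcong_scale[OF h2(2) conj_sum']])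
  moreover have "- (1 / 8) * (e * (r / 2)) = (- 1) ^ (m + 1) * (of_nat p / (16 * X))"
    unfolding P_def[symmetric] rr(3) by (simp add: e_def)
  ultimately show "pcong 2 leg_sum2 ((- 1) ^ (m + 1) * (of_nat p / (16 * X)))" by (simp only:)
  have VZ: "e * (r / 2) \<in> Zp" "e * (2 * X - r / 2) \<in> Zp" using Z by (auto intro!: Zp_mult Zp_divide Zp_diff)
  have "pcong 2 (leg_sum * conj_sum) (e * (2 * X - r / 2) * (e * (r / 2)))"
    by (intro pcong_mult leg_sum' conj_sum' VZ) simp
  also have "e * (2 * X - r / 2) * (e * (r / 2)) = (e * e) * (X * r - r * r * (1 / 4))" by (simp add: algebra_simps)
  also have "\<dots> = P - r * r * (1 / 4)" using e2 rr(4) by simp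
  also have "pcong 2 \<dots> (P - 0)" by (intro pcong_diff pcong_refl r2 Zp_divide) auto
  finally have AV: "pcong 2 (leg_sum * conj_sum) (of_nat p)" by (simp add: P_def)
  have "pcong 2 (conj_sum * conj_sum) (e * (r / 2) * (e * (r / 2)))" by (intro pcong_mult conj_sum' VZ) simp
  also have "e * (r / 2) * (e * (r / 2)) = (e * e) * (r * r * (1 / 4))" by (simp add: algebra_simps)
  also have "\<dots> = r * r * (1 / 4)" using e2 by simp
  also have "pcong 2 \<dots> 0" by (intro r2 Zp_divide) auto
  finally have VV: "pcong 2 (conj_sum * conj_sum) 0" .
  have "pcong 2 (leg_sum * leg_sum) (e * (2 * X - r / 2) * (e * (2 * X - r / 2)))" by (intro pcong_mult leg_sum' VZ) simp
  also have "e * (2 * X - r / 2) * (e * (2 * X - r / 2)) = (e * e) * (4 * (X * X) - 2 * (X * r) + r * r * (1 / 4))"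
    by (simp add: algebra_simps)
  also have "\<dots> = 4 * (X * X) - 2 * P + r * r * (1 / 4)" using e2 rr(4) by simp
  also have "pcong 2 \<dots> (4 * (X * X) - 2 * P + 0)" by (intro pcong_add pcong_refl r2 Zp_divide) auto
  finally have AA: "pcong 2 (leg_sum * leg_sum) (4 * (X * X) - 2 * P)" by simp
  note t = triple_sums[OF AV VV]
  have "pcong 2 (clausen_sum - clausen_sum_inv) (leg_sum * leg_sum - (3 / 2 * (leg_sum * leg_sum) - P))" unfolding t(1) P_def by (intro pcong_diff pcong_refl t(2))
  also have "leg_sum * leg_sum - (3 / 2 * (leg_sum * leg_sum) - P) = P + - (1 / 2) * (leg_sum * leg_sum)" by (simp add: field_simps)
  also have "pcong 2 \<dots> (P + - (1 / 2) * (4 * (X * X) - 2 * P))" by (intro pcong_add pcong_refl pcong_scale h2 AA)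
  also have "P + - (1 / 2) * (4 * (X * X) - 2 * P) = 2 * P - 2 * X ^ 2" by (simp add: power2_eq_square field_simps)
  finally show "pcong 2 (clausen_sum - clausen_sum_inv) (2 * of_nat p - 2 * X ^ 2)" by (simp add: P_def)
  have "pcong 2 (clausen_sum - 2 * clausen_sum_inv + clausen_sum_inv2 - P) (leg_sum * leg_sum - 2 * (3 / 2 * (leg_sum * leg_sum) - P) + (2 * (leg_sum * leg_sum) - 3 * P) - P)"
    unfolding t(1) P_def by (intro pcong_add pcong_diff pcong_refl pcong_scale t(2,3)) auto
  also have "leg_sum * leg_sum - 2 * (3 / 2 * (leg_sum * leg_sum) - P) + (2 * (leg_sum * leg_sum) - 3 * P) - P = - 2 * P" by (simp add: field_simps)
  finally show "pcong 2 (clausen_sum - 2 * clausen_sum_inv + clausen_sum_inv2 - of_nat p) (- 2 * of_nat p)" by (simp add: P_def)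
qed

end

theorem theorem1p2:
  fixes p :: nat and x y :: int
  assumes "prime p" and "[p = 1] (mod 4)"
    and "int p = x ^ 2 + y ^ 2" and "[x = 1] (mod 4)" and "[y = 0] (mod 2)"
  shows
    "rat_cong p 2
       ((- 1) ^ ((p - 1) div 4) * of_int x)
       (\<Sum>k = 0..(p - 1) div 2. of_nat (k + 1) / 8 ^ k * of_nat ((2 * k) choose k) ^ 2) \<and>
     rat_cong p 2
       (\<Sum>k = 0..(p - 1) div 2. of_nat (k + 1) / 8 ^ k * of_nat ((2 * k) choose k) ^ 2)
       (\<Sum>k = 0..(p - 1) div 2. of_nat (2 * k + 1) / (- 16) ^ k * of_nat ((2 * k) choose k) ^ 2) \<and>
     rat_cong p 2
       (\<Sum>k = 0..(p - 1) div 2. of_nat ((2 * k) choose k) * catalan k / 8 ^ k)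
       (- 2 * (\<Sum>k = 0..p - 1. of_nat k * of_nat ((2 * k) choose k) ^ 2 / 8 ^ k)) \<and>
     rat_cong p 2
       (- 2 * (\<Sum>k = 0..p - 1. of_nat k * of_nat ((2 * k) choose k) ^ 2 / 8 ^ k))
       ((- 1) ^ ((p - 1) div 4) * (2 * of_int x - of_nat p / of_int x)) \<and>
     rat_cong p 2
       (schroeder ((p - 1) div 2))
       (\<Sum>k = 0..(p - 1) div 2. of_nat ((2 * k) choose k) * catalan k / (- 16) ^ k) \<and>
     rat_cong p 2
       (\<Sum>k = 0..(p - 1) div 2. of_nat ((2 * k) choose k) * catalan k / (- 16) ^ k)
       (- 8 * (\<Sum>k = 0..(p - 1) div 2. of_nat k * of_nat ((2 * k) choose k) ^ 2 / (- 16) ^ k)) \<and>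
     rat_cong p 2
       (- 8 * (\<Sum>k = 0..(p - 1) div 2. of_nat k * of_nat ((2 * k) choose k) ^ 2 / (- 16) ^ k))
       ((- 1) ^ ((p - 1) div 4) * 2 * (2 * of_int x - of_nat p / of_int x)) \<and>
     rat_cong p 2
       (\<Sum>k = 0..(p - 1) div 2. of_nat k ^ 2 * of_nat ((2 * k) choose k) ^ 2 / 8 ^ k)
       ((- 1) ^ ((p - 1) div 4) * (of_int x - 3 * of_nat p / (4 * of_int x))) \<and>
     rat_cong p 2
       (\<Sum>k = 0..(p - 1) div 2. of_nat k ^ 2 * of_nat ((2 * k) choose k) ^ 2 / (- 16) ^ k)
       ((- 1) ^ ((p + 3) div 4) * (of_nat p / (16 * of_int x))) \<and>
     rat_cong p 2
       (\<Sum>k = 0..p - 1. of_nat ((2 * k) choose k) ^ 2 * of_nat ((2 * k) choose (k + 1)) / (- 8) ^ k)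
       (2 * of_nat p - 2 * of_int x ^ 2) \<and>
     rat_cong p 2
       (\<Sum>k = 0..p - 1. of_nat ((2 * k) choose k) * of_nat ((2 * k) choose (k + 1)) ^ 2 / (- 8) ^ k)
       (- 2 * of_nat p)"
proof -
  define m where "m = (p - 1) div 4"
  have "p > 0" using assms(1) prime_gt_0_nat by blast
  then have p: "p = 4 * m + 1" using assms(2) unfolding m_def cong_def by presburger
  interpret gauss_prime p "2 * m" m
    by (unfold_locales) (use assms(1) p in simp_all)
  have d: "(p - 1) div 2 = 2 * m" "(p - 1) div 4 = m" "(p + 3) div 4 = m + 1" using p by simp_all
  note v = canonical_values[OF assms(3,4)]
  define X where "X = rat_of_int x"
  define e where "e = (- 1 :: rat) ^ m"
  note v = v[folded X_def e_def]
  have eZ: "e \<in> Zp" by (simp add: e_def)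
  have r3: "3 * of_nat p / (4 * X) \<in> Zp" using Zp_mult[OF Zp_numeral(1) v(3)] by simp
  have Z: "e * X \<in> Zp" "e * (2 * X - of_nat p / X) \<in> Zp" "e * 2 * (2 * X - of_nat p / X) \<in> Zp"
    "e * (X - 3 * of_nat p / (4 * X)) \<in> Zp" "(- 1) ^ (m + 1) * (of_nat p / (16 * X)) \<in> Zp"
    "2 * of_nat p - 2 * X ^ 2 \<in> Zp" "- 2 * of_nat p \<in> Zp"
    by (intro eZ v(1-4) r3 Zp_minus_1_power Zp_mult Zp_diff Zp_power Zp_uminus Zp_numeral Zp_of_nat)+
  note s8 = pcong_trans[OF sum_linear_8 v(5)] and s16 = pcong_trans[OF sum_linear_16 v(5)]
  have c8: "pcong 2 (\<Sum>k = 0..2 * m. of_nat ((2 * k) choose k) * catalan k / 8 ^ k) (e * (2 * X - of_nat p / X))"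
    by (rule pcong_trans[OF sum_catalan_8 pcong_trans[OF leg_sum_inv8_cong v(6)]])
  have "pcong 2 (- 2 * (\<Sum>k = 0..p - 1. of_nat k * of_nat ((2 * k) choose k) ^ 2 / 8 ^ k)) (- 2 * (2 * leg_sum1))"
    by (intro pcong_scale sum_k_8 Zp_uminus Zp_numeral)
  then have k8: "pcong 2 (- 2 * (\<Sum>k = 0..p - 1. of_nat k * of_nat ((2 * k) choose k) ^ 2 / 8 ^ k)) (e * (2 * X - of_nat p / X))"
    using pcong_trans[OF _ v(6)] by simp
  have z1: "pcong 2 leg_sum_inv (e * 2 * (2 * X - of_nat p / X))" by (rule pcong_trans[OF leg_sum_inv_cong v(7)])
  note sch = z1[folded schroeder_eq] and c16 = pcong_trans[OF sum_catalan_16 z1]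
  have "pcong 2 (- 8 * (\<Sum>k = 0..2 * m. of_nat k * of_nat ((2 * k) choose k) ^ 2 / (- 16) ^ k)) (- 8 * leg_sum1)"
    by (intro pcong_scale sum_k_16 Zp_uminus Zp_numeral)
  note k16 = pcong_trans[OF this v(7)]
  note k2 = pcong_trans[OF sum_k2_8 v(8)] pcong_trans[OF sum_k2_16 v(9)]
  note t = pcong_trans[OF triple_sum_1 v(10)] pcong_trans[OF triple_sum_2 v(11)]
  show ?thesis
    unfolding d X_def[symmetric] e_def[symmetric]
    by (intro conjI)
      (rule rat_congI2[OF pcong_refl s8 Z(1)] rat_congI2[OF s8 s16 Z(1)] rat_congI2[OF c8 k8 Z(2)]
        rat_congI2[OF k8 pcong_refl Z(2)] rat_congI2[OF sch c16 Z(3)] rat_congI2[OF c16 k16 Z(3)]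
        rat_congI2[OF k16 pcong_refl Z(3)] rat_congI2[OF k2(1) pcong_refl Z(4)] rat_congI2[OF k2(2) pcong_refl Z(5)]
        rat_congI2[OF t(1) pcong_refl Z(6)] rat_congI2[OF t(2) pcong_refl Z(7)])+
qed

end
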